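(* Let $\mathcal G$ be of one of the types B0, C0, D0, CI, DIII, BI(a), BI(b), CII, DI(a) for $\mathfrak g_N$, with $N-2\ge3$ if $\mathfrak g_N=\mathfrak{so}_N$ and $N-2\ge2$ if $\mathfrak g_N=\mathfrak{sp}_N$. Let $V$ be an $X(\mathfrak g_N,\mathcal G)^{tw}$-module and $$V_+=\{w\in V:\ s_{kn}(u)\,w=0\ \text{ for } k<n\}.$$ For $-n+1\le i,j\le n-1$ let $$s^\circ_{ij}(u)=s_{ij}(u+1/2)+\frac{\delta_{ij}}{2u}\,s_{nn}(u+1/2).$$ Then $V_+$ is stable under the action of all operators $s^\circ_{ij}(u)$ with $-n+1\le i,j\le n-1$. Moreover, the assignment $\tilde s'_{ij}(u)\mapsto s^\circ_{ij}(u)$ defines a representation of $\widetilde X(\mathfrak g_{N-2},\mathcal G')^{tw}$ in the space $V_+$.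
   Context: Let $N=2n$ or $N=2n+1$; $\mathfrak g_N=\mathfrak{so}_N$ ($N\ge3$) or $\mathfrak g_N=\mathfrak{sp}_N$ ($N=2n\ge2$). Rows and columns of $N\times N$ matrices are indexed by $-n,\ldots,-1,(0),1,\ldots,n$ ($0$ occurring only if $N$ is odd); $E_{ij}$ are the matrix units. Set $\theta_{ij}=1$ in the orthogonal case, $\theta_{ij}=\mathrm{sign}(i)\,\mathrm{sign}(j)$ in the symplectic case, $(E_{ij})^t=\theta_{ij}E_{-j,-i}$, $P=\sum_{i,j}E_{ij}\otimes E_{ji}$, $Q=\sum_{i,j}\theta_{ij}E_{ij}\otimes E_{-i,-j}$, $\kappa=N/2-1$ for $\mathfrak{so}_N$, $\kappa=N/2+1$ for $\mathfrak{sp}_N$, $R(u)=I-\frac{P}{u}+\frac{Q}{u-\kappa}$. Extended Yangian $X(\mathfrak g_N)$: the unital associative $\mathbb C$-algebra generated by $t_{ij}^{(r)}$ ($r\ge 0$, $t_{ij}^{(0)}=\delta_{ij}$) subject to $R(u-v)T_1(u)T_2(v)=T_2(v)T_1(u)R(u-v)$, where $t_{ij}(u)=\sum_{r\ge0}t_{ij}^{(r)}u^{-r}$, $T(u)=\sum E_{ij}\otimes t_{ij}(u)$ and $T_1,T_2$ denote $T$ placed in the first, resp. second, copy of $\mathrm{End}(\mathbb C^N)$. Put $T^t(u)=\sum(E_{ij})^t\otimes t_{ij}(u)$. The diagonal matrix $\mathcal G=\sum g_{ii}E_{ii}$ (with $p\ge q>0$, $p+q=N$ where $p,q$ occur): B0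 ($\mathfrak{so}_{2n+1}$), C0 ($\mathfrak{sp}_{2n}$), D0 ($\mathfrak{so}_{2n}$): $\mathcal G=I$. CI ($\mathfrak{sp}_{2n}$), DIII ($\mathfrak{so}_{2n}$): $\mathcal G=\sum_{i=1}^n(E_{ii}-E_{-i,-i})$. BI(a) ($\mathfrak{so}_{2n+1}$, $p$ odd, $q$ even): $g_{ii}=1$ for $|i|\le\frac{p-1}2$, $g_{ii}=-1$ for $|i|\ge\frac{p+1}2$. BI(b) ($\mathfrak{so}_{2n+1}$, $p$ even, $q$ odd): $g_{ii}=-1$ for $|i|\le\frac{q-1}2$, $g_{ii}=1$ for $|i|\ge\frac{q+1}2$. CII ($\mathfrak{sp}_{2n}$) and DI(a) ($\mathfrak{so}_{2n}$), $p,q$ even: $g_{ii}=1$ for $1\le|i|\le\frac p2$, $g_{ii}=-1$ for $|i|>\frac p2$. Define $\mathcal G(u)=\mathcal G$ for types B0, C0, D0, CI, DIII, and for CII, DI(a) with $p=q$; otherwise $\mathcal G(u)=(I-c\,u\,\mathcal G)(1-cu)^{-1}$ with $c=\frac4{p-q}$ (expanded in $u^{-1}$). Extended twisted Yangian $X(\mathfrak g_N,\mathcal G)^{tw}$: the subalgebra of $X(\mathfrak g_N)$ generated by the coefficients of the entries $s_{ij}(u)$ of $S(u)=T(u-\kappa/2)\,\mathcal G(u)\,T^t(-u+\kappa/2)$. An operator-valued series acts on, kills, or preserves a space if all its coefficients in $u^{-1}$ do. $\mathfrak g_{N-2}$ is $\mathfrak{so}_{N-2}$, resp. $\mathfrak{sp}_{N-2}$;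 $\mathcal G'=\sum_{i,j=-n+1}^{n-1}g_{ij}E_{ij}$ is the $(N-2)\times(N-2)$ matrix obtained from $\mathcal G$ by deleting the outermost rows and columns. The extended reflection algebra $\widetilde X(\mathfrak g_{N-2},\mathcal G')^{tw}$ is the unital associative $\mathbb C$-algebra generated by $\tilde s'^{(r)}_{ij}$, $-n+1\le i,j\le n-1$, $r\ge0$, with $\tilde s'^{(0)}_{ij}=g_{ij}$, subject only to the reflection equation $R'(u-v)\tilde S'_1(u)R'(u+v)\tilde S'_2(v)=\tilde S'_2(v)R'(u+v)\tilde S'_1(u)R'(u-v)$, where $\tilde S'(u)=\sum E_{ij}\otimes\tilde s'_{ij}(u)$, $\tilde s'_{ij}(u)=\sum_{r\ge0}\tilde s'^{(r)}_{ij}u^{-r}$, and $R'(u)=I-\frac Pu+\frac Q{u-\kappa'}$ is the $R$-matrix of $\mathfrak g_{N-2}$ on $\mathbb C^{N-2}\otimes\mathbb C^{N-2}$, $\kappa'=\kappa-1$. *)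

theory Defs
  imports
    "HOL-Algebra.Generated_Rings"
    "HOL-Library.Poly_Mapping"
    "HOL-Computational_Algebra.Formal_Laurent_Series"
begin

unbundle fps_syntax

section \<open>Algebras given by generators and relations\<close>

text \<open>The free monoid on \<open>'g\<close>, written additively as \<^theory>\<open>HOL-Library.Poly_Mapping\<close> requires;
  finitely supported functions on it then multiply by concatenation of words.\<close>

datatype 'g fword = FWord (letters: "'g list")

instantiation fword :: (type) monoid_add
begin

definition zero_fword :: "'a fword" where
  "0 = FWord []"

definition plus_fword :: "'a fword \<Rightarrow> 'a fword \<Rightarrow> 'a fword" where
  "v + w = FWord (letters v @ letters w)"

instance
  by standard (auto simp: zero_fword_def plus_fword_def)

end

type_synonym 'g free = "'g fword \<Rightarrow>\<^sub>0 complex"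

definition gen :: "'g \<Rightarrow> 'g free" where
  "gen x = Poly_Mapping.single (FWord [x]) 1"

definition scal :: "complex \<Rightarrow> 'g free" where
  "scal c = Poly_Mapping.single 0 c"

definition free_ring :: "'g set \<Rightarrow> 'g free ring" where
  "free_ring X = \<lparr>carrier = {f. \<forall>w \<in> Poly_Mapping.keys f. set (letters w) \<subseteq> X},
     monoid.mult = (*), one = 1, zero = 0, add = (+)\<rparr>"

lemma free_ring_simps:
  "carrier (free_ring X) = {f. \<forall>w \<in> Poly_Mapping.keys f. set (letters w) \<subseteq> X}"
  "f \<otimes>\<^bsub>free_ring X\<^esub> g = f * g"
  "\<one>\<^bsub>free_ring X\<^esub> = 1"
  "\<zero>\<^bsub>free_ring X\<^esub> = 0"
  "f \<oplus>\<^bsub>free_ring X\<^esub> g = f + g"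
  by (simp_all add: free_ring_def)

lemma ring_free_ring: "ring (free_ring X)"
proof (rule ringI)
  show "abelian_group (free_ring X)"
  proof (rule abelian_groupI, unfold free_ring_simps)
    fix f g :: "'a free"
    assume fg: "f \<in> {f. \<forall>w \<in> Poly_Mapping.keys f. set (letters w) \<subseteq> X}"
      "g \<in> {f. \<forall>w \<in> Poly_Mapping.keys f. set (letters w) \<subseteq> X}"
    then show "f + g \<in> {f. \<forall>w \<in> Poly_Mapping.keys f. set (letters w) \<subseteq> X}"
      using Poly_Mapping.keys_add[of f g] by blast
    show "f + g = g + f" by (rule add.commute)
  next
    fix f :: "'a free"
    assume "f \<in> {f. \<forall>w \<in> Poly_Mapping.keys f. set (letters w) \<subseteq> X}"
    then have "- f \<in> {f. \<forall>w \<in> Poly_Mapping.keys f. set (letters w) \<subseteq> X}" by simp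
    then show "\<exists>g\<in>{f. \<forall>w \<in> Poly_Mapping.keys f. set (letters w) \<subseteq> X}. g + f = 0"
      by (rule bexI[rotated]) (rule add.left_inverse)
  qed (simp, rule add.assoc, rule add_0_left)
  show "Group.monoid (free_ring X)"
  proof (rule monoidI, unfold free_ring_simps)
    fix f g :: "'a free"
    assume fg: "f \<in> {f. \<forall>w \<in> Poly_Mapping.keys f. set (letters w) \<subseteq> X}"
      "g \<in> {f. \<forall>w \<in> Poly_Mapping.keys f. set (letters w) \<subseteq> X}"
    have "set (letters w) \<subseteq> X" if w: "w \<in> Poly_Mapping.keys (f * g)" for w
    proof -
      obtain v v' where v: "w = v + v'" "v \<in> Poly_Mapping.keys f" "v' \<in> Poly_Mapping.keys g"
        using Poly_Mapping.keys_mult[of f g] w by blast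
      then have "set (letters v) \<subseteq> X" "set (letters v') \<subseteq> X"
        using fg by blast+
      then show ?thesis by (simp add: v(1) plus_fword_def)
    qed
    then show "f * g \<in> {f. \<forall>w \<in> Poly_Mapping.keys f. set (letters w) \<subseteq> X}" by blast
  next
    have "letters (0 :: 'a fword) = []" by (simp add: zero_fword_def)
    then show "(1 :: 'a free) \<in> {f. \<forall>w \<in> Poly_Mapping.keys f. set (letters w) \<subseteq> X}" by simp
  qed (rule mult.assoc, rule mult_1_left, rule mult_1_right)
qed (simp_all only: free_ring_simps distrib_left distrib_right)

definition rel_ideal :: "'g set \<Rightarrow> 'g free set \<Rightarrow> 'g free set" where
  "rel_ideal X Rel = Idl\<^bsub>free_ring X\<^esub> Rel"

text \<open>The unital associative \<open>\<complex>\<close>-algebra with generators \<open>X\<close> and relations \<open>r = 0\<close> for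
  \<open>r \<in> Rel\<close>. A \<open>\<complex>\<close>-algebra is represented by the record \<^type>\<open>module\<close>, that is, a ring record
  together with a scalar multiplication.\<close>

definition presented_algebra ::
    "'g set \<Rightarrow> 'g free set \<Rightarrow> (complex, 'g free set) module" where
  "presented_algebra X Rel =
     (let I = rel_ideal X Rel; A = free_ring X Quot I
      in ring.extend A
           (module.fields (\<lambda>c a. (I +>\<^bsub>free_ring X\<^esub> scal c) \<otimes>\<^bsub>A\<^esub> a)))"

definition presented_class :: "'g set \<Rightarrow> 'g free set \<Rightarrow> 'g free \<Rightarrow> 'g free set" where
  "presented_class X Rel f = rel_ideal X Rel +>\<^bsub>free_ring X\<^esub> f"

definition generated_subalgebra ::
    "(complex, 'a) module \<Rightarrow> 'a set \<Rightarrow> (complex, 'a) module" where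
  "generated_subalgebra A S =
     A\<lparr>carrier := generate_ring A (range (\<lambda>c. c \<odot>\<^bsub>A\<^esub> \<one>\<^bsub>A\<^esub>) \<union> S)\<rparr>"

text \<open>Unital representations of \<open>A\<close> in a linear subspace \<open>W\<close> of the complex vector space given by
  \<open>scale\<close>. The values of \<open>\<rho>\<close> outside \<open>carrier A\<close> and \<open>W\<close> are irrelevant.\<close>

definition algebra_rep ::
    "(complex, 'a) module \<Rightarrow> (complex \<Rightarrow> 'v::ab_group_add \<Rightarrow> 'v) \<Rightarrow> 'v set \<Rightarrow> ('a \<Rightarrow> 'v \<Rightarrow> 'v) \<Rightarrow> bool"
  where
  "algebra_rep A scale W \<rho> \<longleftrightarrow>
     Modules.module.subspace scale W \<and>
     (\<forall>x \<in> carrier A. \<forall>w \<in> W. \<rho> x w \<in> W) \<and>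
     (\<forall>x \<in> carrier A. \<forall>w \<in> W. \<forall>w' \<in> W. \<rho> x (w + w') = \<rho> x w + \<rho> x w') \<and>
     (\<forall>x \<in> carrier A. \<forall>c. \<forall>w \<in> W. \<rho> x (scale c w) = scale c (\<rho> x w)) \<and>
     (\<forall>x \<in> carrier A. \<forall>y \<in> carrier A. \<forall>w \<in> W. \<rho> (x \<oplus>\<^bsub>A\<^esub> y) w = \<rho> x w + \<rho> y w) \<and>
     (\<forall>x \<in> carrier A. \<forall>y \<in> carrier A. \<forall>w \<in> W. \<rho> (x \<otimes>\<^bsub>A\<^esub> y) w = \<rho> x (\<rho> y w)) \<and>
     (\<forall>c. \<forall>x \<in> carrier A. \<forall>w \<in> W. \<rho> (c \<odot>\<^bsub>A\<^esub> x) w = scale c (\<rho> x w)) \<and>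
     (\<forall>w \<in> W. \<rho> \<one>\<^bsub>A\<^esub> w = w)"


section \<open>Series in spectral parameters\<close>

text \<open>A formal power series stands for a series in \<open>u\<inverse>\<close>, so \<^const>\<open>fps_X\<close> is \<open>u\<inverse>\<close>.
  Two-variable identities live in Laurent series in \<open>u\<inverse>\<close> over Laurent series in \<open>v\<inverse>\<close>:
  the outer variable is \<open>u\<inverse>\<close>. Since \<^typ>\<open>complex fls fls\<close> is a field, rational functions such as
  \<open>1 / (u - v)\<close> are literal quotients there (expanded for \<open>|u| > |v|\<close>), and an equation holds after
  this expansion iff it holds after clearing denominators.\<close>

definition map_fps :: "('a \<Rightarrow> 'b) \<Rightarrow> 'a fps \<Rightarrow> 'b fps" where
  "map_fps h f = Abs_fps (\<lambda>k. h (f $ k))"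

text \<open>Only used with \<open>h 0 = 0\<close>.\<close>

definition map_fls :: "('a::zero \<Rightarrow> 'b::zero) \<Rightarrow> 'a fls \<Rightarrow> 'b fls" where
  "map_fls h f = Abs_fls (\<lambda>k. h (f $$ k))"

definition var_u :: "complex fls fls" where
  "var_u = fls_X_inv"

definition var_v :: "complex fls fls" where
  "var_v = fls_const fls_X_inv"

definition const2 :: "complex \<Rightarrow> complex fls fls" where
  "const2 c = fls_const (fls_const c)"

definition at_u :: "'g free fps \<Rightarrow> 'g free fls fls" where
  "at_u f = map_fls fls_const (fps_to_fls f)"

definition at_v :: "'g free fps \<Rightarrow> 'g free fls fls" where
  "at_v f = fls_const (fps_to_fls f)"

text \<open>\<open>f(a u + b)\<close> for \<open>a \<noteq> 0\<close>, via \<open>(a u + b)\<inverse> = u\<inverse> / (a + b u\<inverse>)\<close>.\<close>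

definition subst_affine :: "complex \<Rightarrow> complex \<Rightarrow> 'g free fps \<Rightarrow> 'g free fps" where
  "subst_affine a b f =
     f oo map_fps scal (fps_X / (fps_const a + fps_const b * fps_X))"


section \<open>The R-matrix\<close>

datatype lie_type = Orth | Sympl

definition rank :: "nat \<Rightarrow> int" where
  "rank N = int (N div 2)"

definition Idx :: "nat \<Rightarrow> int set" where
  "Idx N = {i. \<bar>i\<bar> \<le> rank N \<and> (i = 0 \<longrightarrow> odd N)}"

fun theta :: "lie_type \<Rightarrow> int \<Rightarrow> int \<Rightarrow> complex" where
  "theta Orth i j = 1"
| "theta Sympl i j = of_int (sgn i * sgn j)"

fun kappa :: "lie_type \<Rightarrow> nat \<Rightarrow> complex" where
  "kappa Orth N = of_nat N / 2 - 1"
| "kappa Sympl N = of_nat N / 2 + 1"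

text \<open>Elements of \<open>End(\<complex>\<^sup>N) \<otimes> B\<close> are functions of a row and a column index in \<open>Idx N\<close>; elements of
  \<open>End(\<complex>\<^sup>N) \<otimes> End(\<complex>\<^sup>N) \<otimes> B\<close> are functions of a pair of row indices and a pair of column indices.\<close>

type_synonym 'b mat1 = "int \<Rightarrow> int \<Rightarrow> 'b"
type_synonym 'b mat2 = "int \<times> int \<Rightarrow> int \<times> int \<Rightarrow> 'b"

definition E :: "int \<Rightarrow> int \<Rightarrow> complex mat1" where
  "E i j = (\<lambda>a b. if a = i \<and> b = j then 1 else 0)"

definition tensor :: "complex mat1 \<Rightarrow> complex mat1 \<Rightarrow> complex mat2" where
  "tensor A B = (\<lambda>(a, c) (b, d). A a b * B c d)"

definition P_op :: "nat \<Rightarrow> complex mat2" where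
  "P_op N x y = (\<Sum>i\<in>Idx N. \<Sum>j\<in>Idx N. tensor (E i j) (E j i) x y)"

definition Q_op :: "lie_type \<Rightarrow> nat \<Rightarrow> complex mat2" where
  "Q_op F N x y = (\<Sum>i\<in>Idx N. \<Sum>j\<in>Idx N. theta F i j * tensor (E i j) (E (- i) (- j)) x y)"

definition R_matrix :: "lie_type \<Rightarrow> nat \<Rightarrow> complex fls fls \<Rightarrow> complex fls fls mat2" where
  "R_matrix F N z x y =
     (if x = y then 1 else 0) - const2 (P_op N x y) / z
       + const2 (Q_op F N x y) / (z - const2 (kappa F N))"

definition R_free :: "lie_type \<Rightarrow> nat \<Rightarrow> complex fls fls \<Rightarrow> 'g free fls fls mat2" where
  "R_free F N z x y = map_fls (map_fls scal) (R_matrix F N z x y)"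

definition in_first :: "'b::zero mat1 \<Rightarrow> 'b mat2" where
  "in_first M = (\<lambda>(a, c) (b, d). if c = d then M a b else 0)"

definition in_second :: "'b::zero mat1 \<Rightarrow> 'b mat2" where
  "in_second M = (\<lambda>(a, c) (b, d). if a = b then M c d else 0)"

definition mult2 :: "nat \<Rightarrow> 'b::semiring_0 mat2 \<Rightarrow> 'b mat2 \<Rightarrow> 'b mat2" where
  "mult2 N A B x z = (\<Sum>y \<in> Idx N \<times> Idx N. A x y * B y z)"

text \<open>The coefficients of all matrix entries of \<open>L - M\<close>.\<close>

definition eq_coeffs :: "nat \<Rightarrow> 'g free fls fls mat2 \<Rightarrow> 'g free fls fls mat2 \<Rightarrow> 'g free set" where
  "eq_coeffs N L M =
     {(L x y - M x y) $$ k $$ l | x y k l. x \<in> Idx N \<times> Idx N \<and> y \<in> Idx N \<times> Idx N}"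


section \<open>The extended Yangian\<close>

text \<open>The triple \<open>(i, j, r)\<close> names the generator with lower indices \<open>i, j\<close> and superscript \<open>(r)\<close>.\<close>

type_synonym idx = "int \<times> int \<times> nat"

definition gens :: "nat \<Rightarrow> idx set" where
  "gens N = Idx N \<times> Idx N \<times> UNIV"

definition gen_series :: "int \<Rightarrow> int \<Rightarrow> idx free fps" where
  "gen_series i j = Abs_fps (\<lambda>r. gen (i, j, r))"

definition RTT_rels :: "lie_type \<Rightarrow> nat \<Rightarrow> idx free set" where
  "RTT_rels F N =
     (let R = R_free F N (var_u - var_v);
          T1 = in_first (\<lambda>i j. at_u (gen_series i j));
          T2 = in_second (\<lambda>i j. at_v (gen_series i j))
      in {gen (i, j, 0) - scal (if i = j then 1 else 0) | i j. i \<in> Idx N \<and> j \<in> Idx N}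
         \<union> eq_coeffs N (mult2 N (mult2 N R T1) T2) (mult2 N (mult2 N T2 T1) R))"

definition ext_yangian :: "lie_type \<Rightarrow> nat \<Rightarrow> (complex, idx free set) module" where
  "ext_yangian F N = presented_algebra (gens N) (RTT_rels F N)"

definition yclass :: "lie_type \<Rightarrow> nat \<Rightarrow> idx free \<Rightarrow> idx free set" where
  "yclass F N = presented_class (gens N) (RTT_rels F N)"


section \<open>The extended twisted Yangian\<close>

datatype sym_type = B0 | C0 | D0 | CI | DIII
  | BIa nat nat | BIb nat nat | CII nat nat | DIa nat nat

fun of_type :: "lie_type \<Rightarrow> nat \<Rightarrow> sym_type \<Rightarrow> bool" where
  "of_type F N B0 \<longleftrightarrow> F = Orth \<and> odd N"
| "of_type F N C0 \<longleftrightarrow> F = Sympl \<and> even N"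
| "of_type F N D0 \<longleftrightarrow> F = Orth \<and> even N"
| "of_type F N CI \<longleftrightarrow> F = Sympl \<and> even N"
| "of_type F N DIII \<longleftrightarrow> F = Orth \<and> even N"
| "of_type F N (BIa p q) \<longleftrightarrow>
     F = Orth \<and> odd N \<and> p \<ge> q \<and> q > 0 \<and> p + q = N \<and> odd p \<and> even q"
| "of_type F N (BIb p q) \<longleftrightarrow>
     F = Orth \<and> odd N \<and> p \<ge> q \<and> q > 0 \<and> p + q = N \<and> even p \<and> odd q"
| "of_type F N (CII p q) \<longleftrightarrow>
     F = Sympl \<and> even N \<and> p \<ge> q \<and> q > 0 \<and> p + q = N \<and> even p \<and> even q"
| "of_type F N (DIa p q) \<longleftrightarrow>
     F = Orth \<and> even N \<and> p \<ge> q \<and> q > 0 \<and> p + q = N \<and> even p \<and> even q"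

text \<open>The diagonal entry \<open>g\<^sub>i\<^sub>i\<close>.\<close>

fun g_diag :: "sym_type \<Rightarrow> int \<Rightarrow> complex" where
  "g_diag B0 i = 1"
| "g_diag C0 i = 1"
| "g_diag D0 i = 1"
| "g_diag CI i = of_int (sgn i)"
| "g_diag DIII i = of_int (sgn i)"
| "g_diag (BIa p q) i = (if 2 * \<bar>i\<bar> \<le> int p - 1 then 1 else - 1)"
| "g_diag (BIb p q) i = (if 2 * \<bar>i\<bar> \<le> int q - 1 then - 1 else 1)"
| "g_diag (CII p q) i = (if 2 * \<bar>i\<bar> \<le> int p then 1 else - 1)"
| "g_diag (DIa p q) i = (if 2 * \<bar>i\<bar> \<le> int p then 1 else - 1)"

text \<open>\<open>(1 - c u g) / (1 - c u)\<close>, numerator and denominator multiplied by \<open>u\<inverse>\<close>.\<close>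

definition g_ratio :: "nat \<Rightarrow> nat \<Rightarrow> complex \<Rightarrow> complex fps" where
  "g_ratio p q g =
     (let c = 4 / (of_nat p - of_nat q)
      in (fps_X - fps_const (c * g)) / (fps_X - fps_const c))"

text \<open>The diagonal entries of \<open>\<G>(u)\<close>. In types BI the parities force \<open>p \<noteq> q\<close>.\<close>

fun g_series :: "sym_type \<Rightarrow> int \<Rightarrow> complex fps" where
  "g_series (BIa p q) i = g_ratio p q (g_diag (BIa p q) i)"
| "g_series (BIb p q) i = g_ratio p q (g_diag (BIb p q) i)"
| "g_series (CII p q) i =
     (if p = q then fps_const (g_diag (CII p q) i) else g_ratio p q (g_diag (CII p q) i))"
| "g_series (DIa p q) i =
     (if p = q then fps_const (g_diag (DIa p q) i) else g_ratio p q (g_diag (DIa p q) i))"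
| "g_series t i = fps_const (g_diag t i)"

text \<open>From \<open>(E\<^sub>i\<^sub>j)\<^sup>t = \<theta>\<^sub>i\<^sub>j E\<^sub>-\<^sub>j\<^sub>,\<^sub>-\<^sub>i\<close>: the \<open>(a, b)\<close> entry of \<open>\<Sum> (E\<^sub>i\<^sub>j)\<^sup>t \<otimes> m\<^sub>i\<^sub>j\<close> comes
  from \<open>i = -b\<close>, \<open>j = -a\<close>.\<close>

definition transp :: "lie_type \<Rightarrow> idx free fps mat1 \<Rightarrow> idx free fps mat1" where
  "transp F M a b = map_fps scal (fps_const (theta F (- b) (- a))) * M (- b) (- a)"

text \<open>\<open>s\<^sub>i\<^sub>j(u)\<close> and \<open>s\<^sup>\<circ>\<^sub>i\<^sub>j(u)\<close> are written in the free algebra; their coefficients in the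
  extended Yangian are the images of these under \<^const>\<open>yclass\<close>.\<close>

definition s_series :: "lie_type \<Rightarrow> nat \<Rightarrow> sym_type \<Rightarrow> int \<Rightarrow> int \<Rightarrow> idx free fps" where
  "s_series F N t i j =
     (\<Sum>k\<in>Idx N.
        subst_affine 1 (- kappa F N / 2) (gen_series i k)
        * map_fps scal (g_series t k)
        * subst_affine (- 1) (kappa F N / 2) (transp F gen_series k j))"

definition tw_yangian :: "lie_type \<Rightarrow> nat \<Rightarrow> sym_type \<Rightarrow> (complex, idx free set) module" where
  "tw_yangian F N t = generated_subalgebra (ext_yangian F N)
     {yclass F N (s_series F N t i j $ r) | i j r. i \<in> Idx N \<and> j \<in> Idx N}"

definition s_circ :: "lie_type \<Rightarrow> nat \<Rightarrow> sym_type \<Rightarrow> int \<Rightarrow> int \<Rightarrow> idx free fps" where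
  "s_circ F N t i j =
     subst_affine 1 (1/2) (s_series F N t i j)
     + (if i = j
        then map_fps scal (fps_const (1/2) * fps_X)
             * subst_affine 1 (1/2) (s_series F N t (rank N) (rank N))
        else 0)"

definition V_plus :: "lie_type \<Rightarrow> nat \<Rightarrow> sym_type \<Rightarrow> (idx free set \<Rightarrow> 'v \<Rightarrow> 'v::zero) \<Rightarrow> 'v set" where
  "V_plus F N t \<rho> =
     {w. \<forall>k\<in>Idx N. k < rank N \<longrightarrow> (\<forall>r. \<rho> (yclass F N (s_series F N t k (rank N) $ r)) w = 0)}"


section \<open>The extended reflection algebra\<close>

text \<open>For the R-matrix of type \<open>F\<close> and size \<open>M\<close> and the diagonal matrix with entries \<open>g i\<close>, only the entries
  with \<open>i \<in> Idx M\<close> being used. The generator \<open>(i, j, r)\<close> is now the coefficient of \<open>u\<^sup>-\<^sup>r\<close> in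
  the \<open>(i, j)\<close> entry of the generating matrix of this algebra.\<close>

definition reflection_rels :: "lie_type \<Rightarrow> nat \<Rightarrow> (int \<Rightarrow> complex) \<Rightarrow> idx free set" where
  "reflection_rels F M g =
     (let Rm = R_free F M (var_u - var_v);
          Rp = R_free F M (var_u + var_v);
          S1 = in_first (\<lambda>i j. at_u (gen_series i j));
          S2 = in_second (\<lambda>i j. at_v (gen_series i j))
      in {gen (i, j, 0) - scal (if i = j then g i else 0) | i j. i \<in> Idx M \<and> j \<in> Idx M}
         \<union> eq_coeffs M
             (mult2 M (mult2 M (mult2 M Rm S1) Rp) S2)
             (mult2 M (mult2 M (mult2 M S2 Rp) S1) Rm))"

definition reflection_algebra ::
    "lie_type \<Rightarrow> nat \<Rightarrow> (int \<Rightarrow> complex) \<Rightarrow> (complex, idx free set) module" where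
  "reflection_algebra F M g = presented_algebra (gens M) (reflection_rels F M g)"

definition rclass :: "lie_type \<Rightarrow> nat \<Rightarrow> (int \<Rightarrow> complex) \<Rightarrow> idx free \<Rightarrow> idx free set" where
  "rclass F M g = presented_class (gens M) (reflection_rels F M g)"

end

theory Submission
  imports Defs
begin

text \<open>The shifted matrix \<open>S(u + 1/2)\<close> satisfies the reflection equation with \<open>R(u - v)\<close> and
  \<open>R(u + v + 1)\<close>, because the diagonal matrix \<open>\<G>\<close> does and \<open>T\<close> satisfies the RTT relation, and a
  symmetry relation expresses \<open>s\<^sub>-\<^sub>n\<^sub>,\<^sub>l\<close> through \<open>s\<^sub>-\<^sub>l\<^sub>,\<^sub>n\<close>. Hence \<open>s\<^sub>k\<^sub>n\<close> for \<open>k \<noteq> n\<close> and \<open>s\<^sub>-\<^sub>n\<^sub>,\<^sub>l\<close> for \<open>l \<noteq> -n\<close> lie in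
  the left ideal \<open>L\<close> of elements that annihilate \<open>V\<^sub>+\<close>. A linear functional \<open>f\<close> over the field of Laurent
  series that vanishes on the series with coefficients in \<open>L\<close> turns the reflection equation into
  scalar equations for the values \<open>f (s\<^sub>i\<^sub>j(u) s\<^sub>k\<^sub>l(v))\<close> and \<open>f (s\<^sub>k\<^sub>l(v) s\<^sub>i\<^sub>j(u))\<close>. From these, linear
  algebra over the field gives \<open>f (s\<^sub>i\<^sub>n(u) s\<^sub>k\<^sub>l(v)) = 0\<close> for \<open>i \<noteq> n\<close>, which is the stability of \<open>V\<^sub>+\<close>, and the
  reflection equation of smaller rank for the corrected matrix. Functionals of this kind detect
  membership in \<open>L\<close>, so both statements hold in the algebra modulo \<open>L\<close>.\<close>

text \<open>The shift by 1/2 makes the two ranks fit: at u + 1/2 and v + 1/2 the middle factor is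
  R(u + v + 1), and as \<kappa> = \<kappa>' + 1 its Q term already has the pole of R'(u + v). The P
  term does not fit: it carries 1/(u + v + 1), and its sum also runs over n and -n. Modulo L this
  sum solves a linear equation that turns 1/(u + v + 1) into 1/(u + v), up to products with s_nn;
  the summand s_nn/(2u) is there to cancel these and the leftovers of the Q traces. The obstacle is
  that L is only a left ideal: a relation modulo L cannot be multiplied from the right, and s_ij(u)
  s_kl(v) and s_kl(v) s_ij(u) have to be kept apart. Functionals turn the two orders into two
  families A and C of elements of a field, and unitarity of R exchanges these families while
  negating u - v, so each fact about A gives one about C. The RTT relation is also needed at points
  such as -u + \<kappa>/2, into which its expansion for |u| > |v| does not specialize; for this it
  is first cleared of denominators.\<close>

section \<open>The reflection equation in two ranks\<close>

text \<open>Orthogonal and symplectic cases are treated at once: \<epsilon> is 1 or -1, the signs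
  factor as \<theta> i * \<theta> j, and \<open>card_I\<close> says \<kappa> = N/2 - \<epsilon>.
  With P Q = Q P = \<epsilon> Q and Q^2 = N Q, this value of \<kappa> makes R unitary.\<close>

locale osp_index =
  fixes I :: "int set" and \<theta> :: "int \<Rightarrow> 'k::field" and \<epsilon> \<kappa> :: 'k
  assumes finite_I: "finite I"
    and neg_I [simp]: "- i \<in> I \<longleftrightarrow> i \<in> I"
    and theta_sq: "i \<in> I \<Longrightarrow> \<theta> i * \<theta> i = 1"
    and theta_neg: "i \<in> I \<Longrightarrow> \<theta> (- i) = \<epsilon> * \<theta> i"
    and eps: "\<epsilon> = 1 \<or> \<epsilon> = - 1"
    and card_I: "of_nat (card I) = 2 * \<kappa> + 2 * \<epsilon>"
begin

lemma eps_sq: "\<epsilon> * \<epsilon> = 1"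
  using eps by auto

lemma eps_sq_left: "\<epsilon> * (\<epsilon> * x) = x"
  by (simp add: eps_sq flip: mult.assoc)

lemma theta_sq_left: "i \<in> I \<Longrightarrow> \<theta> i * (\<theta> i * x) = x"
  by (metis mult.assoc mult_1 theta_sq)

text \<open>\<open>R_act\<close> is multiplication by \<open>R(z)\<close> on the row indices or on the column indices; \<open>middle\<close> gives
  the entries of \<open>S\<^sub>1 R(z) S'\<^sub>2\<close> in terms of the products \<open>A i j k l\<close> of the entries \<open>s\<^sub>i\<^sub>j\<close> and \<open>s'\<^sub>k\<^sub>l\<close>.\<close>

definition R_act :: "'k \<Rightarrow> (int \<Rightarrow> int \<Rightarrow> 'k) \<Rightarrow> int \<Rightarrow> int \<Rightarrow> 'k" where
  "R_act z Y i k = Y i k - Y k i / z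
     + (if k = - i then \<theta> i * (\<Sum>p\<in>I. \<theta> p * Y p (- p)) / (z - \<kappa>) else 0)"

definition middle :: "'k \<Rightarrow> (int \<Rightarrow> int \<Rightarrow> int \<Rightarrow> int \<Rightarrow> 'k) \<Rightarrow> int \<Rightarrow> int \<Rightarrow> int \<Rightarrow> int \<Rightarrow> 'k" where
  "middle z A i k j l = A i j k l - (if k = j then (\<Sum>p\<in>I. A i p p l) / z else 0)
     + \<theta> (- k) * \<theta> j * A i (- k) (- j) l / (z - \<kappa>)"

lemma sum_neg: "(\<Sum>p\<in>I. f (- p)) = (\<Sum>p\<in>I. f p)"
proof -
  have "bij_betw uminus I I"
    by (rule bij_betw_byWitness[where f' = uminus]) auto
  then show ?thesis by (rule sum.reindex_bij_betw)
qed

text \<open>This is the relation Q P = \<epsilon> Q: exchanging the two indices in the trace that Q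
  takes costs the sign from \<open>theta_neg\<close>.\<close>

lemma sum_theta_neg: "(\<Sum>p\<in>I. \<theta> p * f (- p) p) = \<epsilon> * (\<Sum>p\<in>I. \<theta> p * f p (- p))"
proof -
  have "(\<Sum>p\<in>I. \<theta> p * f (- p) p) = (\<Sum>p\<in>I. \<theta> (- p) * f p (- p))"
    using sum_neg[of "\<lambda>p. \<theta> p * f (- p) p"] by simp
  then show ?thesis
    by (simp add: sum_distrib_left theta_neg mult.assoc cong: sum.cong)
qed

lemma R_act_cong:
  assumes "\<And>p q. p \<in> I \<Longrightarrow> q \<in> I \<Longrightarrow> Y p q = Y' p q" "i \<in> I" "k \<in> I"
  shows "R_act z Y i k = R_act z Y' i k"
  using assms by (auto simp: R_act_def intro!: sum.cong)

text \<open>R commutes with the flip P, so exchanging the two tensor factors in argument and value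
  changes nothing.\<close>

lemma R_act_flip:
  assumes "i \<in> I" "k \<in> I"
  shows "R_act z (\<lambda>i k. Y k i) k i = R_act z Y i k"
  using assms eps_sq
  by (auto simp: R_act_def sum_theta_neg[of "\<lambda>p q. Y p q"] theta_neg)

text \<open>Off the antidiagonal k = -i only P acts and P^2 = 1 suffices; on it the Q terms cancel
  because N = 2\<kappa> + 2\<epsilon>. This is unitarity, R(-z) R(z) = 1 - 1/z^2.\<close>

lemma R_act_unitary:
  assumes z: "z \<noteq> 0" "z \<noteq> \<kappa>" "z \<noteq> - \<kappa>" and ik: "i \<in> I" "k \<in> I"
  shows "R_act (- z) (R_act z Y) i k = (1 - 1 / z\<^sup>2) * Y i k"
proof -
  define T where "T = (\<Sum>p\<in>I. \<theta> p * Y p (- p))"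
  have 1: "\<theta> p * R_act z Y p (- p) = \<theta> p * Y p (- p) - \<theta> p * Y (- p) p / z + T / (z - \<kappa>)"
    if "p \<in> I" for p
    using that by (simp add: R_act_def T_def algebra_simps theta_sq_left diff_divide_distrib)
  have T': "(\<Sum>p\<in>I. \<theta> p * R_act z Y p (- p)) = T - \<epsilon> * T / z + of_nat (card I) * (T / (z - \<kappa>))"
    by (simp add: 1 sum.distrib sum_subtractf sum_theta_neg[of "\<lambda>p q. Y p q"] sum_divide_distrib[symmetric]
        flip: T_def cong: sum.cong)
  have nz: "z - \<kappa> \<noteq> 0" "- z - \<kappa> \<noteq> 0" "z + \<kappa> \<noteq> 0"
    using z by (auto simp: eq_neg_iff_add_eq_0 add.commute algebra_simps)
  have nz': "- z - \<kappa> = - (z + \<kappa>)" by simp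
  show ?thesis
  proof (cases "k = - i")
    case True
    define s where "s = \<theta> i"
    have n: "\<theta> (- i) = \<epsilon> * s" using ik theta_neg s_def by auto
    have "R_act (- z) (R_act z Y) i k =
        (Y i (- i) - Y (- i) i / z + s * T / (z - \<kappa>)) + (Y (- i) i - Y i (- i) / z + \<epsilon> * s * T / (z - \<kappa>)) / z
        - s * (T - \<epsilon> * T / z + (2 * \<kappa> + 2 * \<epsilon>) * (T / (z - \<kappa>))) / (z + \<kappa>)"
      unfolding R_act_def[of "- z"] nz' T' card_I minus_divide_right[symmetric]
      using True n ik by (simp add: R_act_def T_def[symmetric] s_def)
    also have "\<dots> = (1 - 1 / z\<^sup>2) * Y i (- i)"
    proof -
      \<comment> \<open>With the inverses as atoms, each bound by one polynomial relation, the claim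
        becomes an ideal membership between polynomials.\<close>
      define r d e where "r = inverse z" and "d = inverse (z - \<kappa>)" and "e = inverse (z + \<kappa>)"
      have "z * r = 1" "(z - \<kappa>) * d = 1" "(z + \<kappa>) * e = 1"
        using z nz by (simp_all add: r_def d_def e_def)
      with eps_sq show ?thesis
        unfolding divide_inverse r_def[symmetric] d_def[symmetric] e_def[symmetric]
          power_inverse[symmetric]
        by Groebner_Basis.algebra
    qed
    finally show ?thesis using True by simp
  next
    case False
    then have "i \<noteq> - k" by auto
    with False show ?thesis
      by (simp add: R_act_def power2_eq_square diff_divide_distrib left_diff_distrib)
  qed
qed

lemma R_act_scale: "R_act z (\<lambda>i k. c * Y i k) i k = c * R_act z Y i k"
  by (simp add: R_act_def sum_distrib_left algebra_simps)

lemma R_act_add: "R_act z (\<lambda>i k. Y i k + Y' i k) i k = R_act z Y i k + R_act z Y' i k"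
  by (simp add: R_act_def sum.distrib algebra_simps add_divide_distrib)

lemma R_act_diff: "R_act z (\<lambda>i k. Y i k - Y' i k) i k = R_act z Y i k - R_act z Y' i k"
  by (simp add: R_act_def sum_subtractf algebra_simps diff_divide_distrib)

lemma R_act_sum: "R_act z (\<lambda>i k. \<Sum>p\<in>S. Y p i k) i k = (\<Sum>p\<in>S. R_act z (Y p) i k)"
  by (induction S rule: infinite_finite_induct) (simp_all add: R_act_add, simp_all add: R_act_def)

text \<open>One action is a left and the other a right multiplication; only linearity of
  \<open>R_act\<close> in its argument is used.\<close>

lemma R_act_comm:
  "R_act y (\<lambda>i k. R_act z (\<lambda>j l. M i k j l) j l) i k = R_act z (\<lambda>j l. R_act y (\<lambda>i k. M i k j l) i k) j l"
proof -
  have "R_act y (\<lambda>i k. R_act z (\<lambda>j l. M i k j l) j l) i k =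
     R_act y (\<lambda>i k. M i k j l - 1 / z * M i k l j
       + (if l = - j then \<theta> j / (z - \<kappa>) else 0) * (\<Sum>p\<in>I. \<theta> p * M i k p (- p))) i k"
    by (intro arg_cong3[where f = "R_act y"] ext refl) (simp add: R_act_def)
  also have "\<dots> = R_act y (\<lambda>i k. M i k j l) i k - 1 / z * R_act y (\<lambda>i k. M i k l j) i k
     + (if l = - j then \<theta> j / (z - \<kappa>) else 0) * (\<Sum>p\<in>I. \<theta> p * R_act y (\<lambda>i k. M i k p (- p)) i k)"
    by (simp only: R_act_add R_act_diff R_act_scale R_act_sum)
  also have "\<dots> = R_act z (\<lambda>j l. R_act y (\<lambda>i k. M i k j l) i k) j l"
    by (subst (5) R_act_def) simp
  finally show ?thesis .
qed

text \<open>What has to be added to the outer \<open>middle\<close> to obtain the inner one for the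
  corrected entries. X k l, Y i j and w stand for the products s_nn s_kl, s_ij s_nn and s_nn s_nn;
  r, s, g, \<open>e\<^sub>1\<close>, \<open>e\<^sub>2\<close>, v are the inverses of a, b, b -
  \<kappa>, b + a, b - a, b + 1. The first three groups come from the summands added to A, the last
  two from the remainder h/b between the middles of the two ranks.\<close>

definition correction where
  "correction r s g e\<^sub>1 e\<^sub>2 v w X Y i k j l =
     e\<^sub>2 * (of_bool (k = l) * Y i j - s * of_bool (k = j) * Y i l
        + g * of_bool (l = - j) * \<theta> (- k) * \<theta> j * Y i (- k))
   + e\<^sub>1 * (of_bool (i = j) * X k l - s * of_bool (k = j) * X i l
        + g * of_bool (k = - i) * \<theta> (- k) * \<theta> j * X (- j) l)
   + w * e\<^sub>1 * e\<^sub>2 * (of_bool (i = j) * of_bool (k = l) - s * of_bool (k = j) * of_bool (i = l)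
        + g * of_bool (k = - i) * of_bool (l = - j) * \<theta> (- k) * \<theta> j)
   + r * s * of_bool (k = j) * (X i l - Y i l)
   - v * w * s * of_bool (k = j) * of_bool (i = l)"

text \<open>This is the trace taken by Q. Each Kronecker delta in p selects one summand; where none
  is left the sum gives N or the trace of Y.\<close>

lemma correction_rows:
  assumes "j \<in> I" "l \<in> I"
  shows "(\<Sum>p\<in>I. \<theta> p * correction r s g e\<^sub>1 e\<^sub>2 v w X Y p (- p) j l) =
     e\<^sub>2 * (\<theta> (- l) * Y (- l) j - s * \<theta> (- j) * Y (- j) l
        + g * of_bool (l = - j) * \<theta> j * (\<Sum>p\<in>I. Y p p))
   + e\<^sub>1 * (\<theta> j * X (- j) l - s * \<theta> (- j) * X (- j) l + g * of_nat (card I) * \<theta> j * X (- j) l)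
   + w * e\<^sub>1 * e\<^sub>2 * of_bool (l = - j) * (\<theta> j - s * \<theta> (- j) + g * of_nat (card I) * \<theta> j)
   + r * s * \<theta> (- j) * (X (- j) l - Y (- j) l)
   - v * w * s * \<theta> (- j) * of_bool (l = - j)"
proof -
  have "\<theta> p * correction r s g e\<^sub>1 e\<^sub>2 v w X Y p (- p) j l =
     e\<^sub>2 * ((if p = - l then \<theta> (- l) * Y (- l) j else 0) - s * (if p = - j then \<theta> (- j) * Y (- j) l else 0)
        + g * of_bool (l = - j) * \<theta> j * Y p p)
   + e\<^sub>1 * ((if p = j then \<theta> j * X (- j) l else 0) - s * (if p = - j then \<theta> (- j) * X (- j) l else 0)
        + g * \<theta> j * X (- j) l)
   + w * e\<^sub>1 * e\<^sub>2 * of_bool (l = - j) * ((if p = j then \<theta> j else 0)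
        - s * (if p = - j then \<theta> (- j) else 0) + g * \<theta> j)
   + r * s * (if p = - j then \<theta> (- j) * (X (- j) l - Y (- j) l) else 0)
   - v * w * s * of_bool (l = - j) * (if p = - j then \<theta> (- j) else 0)"
    if "p \<in> I" for p
    using that
    by (auto simp: correction_def minus_equation_iff[of p] algebra_simps theta_sq_left theta_sq)
  then show ?thesis
    using assms finite_I
    by (simp add: sum.distrib sum_subtractf sum.delta sum_distrib_left[symmetric]) (simp add: mult_ac)
qed

lemma correction_columns:
  assumes "i \<in> I" "k \<in> I"
  shows "(\<Sum>p\<in>I. \<theta> p * correction r s g e\<^sub>1 e\<^sub>2 v w X Y i k (- p) p) =
     e\<^sub>2 * (\<theta> k * Y i (- k) - s * \<theta> (- k) * Y i (- k) + g * of_nat (card I) * \<theta> k * Y i (- k))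
   + e\<^sub>1 * (\<theta> (- i) * X k (- i) - s * \<theta> (- k) * X i (- k)
        + g * of_bool (k = - i) * \<theta> k * (\<Sum>p\<in>I. X p p))
   + w * e\<^sub>1 * e\<^sub>2 * of_bool (k = - i) * (\<theta> k - s * \<theta> (- k) + g * of_nat (card I) * \<theta> k)
   + r * s * \<theta> (- k) * (X i (- k) - Y i (- k))
   - v * w * s * \<theta> (- k) * of_bool (k = - i)"
proof -
  have "\<theta> p * correction r s g e\<^sub>1 e\<^sub>2 v w X Y i k (- p) p =
     e\<^sub>2 * ((if p = k then \<theta> k * Y i (- k) else 0) - s * (if p = - k then \<theta> (- k) * Y i (- k) else 0)
        + g * \<theta> k * Y i (- k))
   + e\<^sub>1 * ((if p = - i then \<theta> (- i) * X k (- i) else 0) - s * (if p = - k then \<theta> (- k) * X i (- k) else 0)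
        + g * of_bool (k = - i) * \<theta> k * X p p)
   + w * e\<^sub>1 * e\<^sub>2 * of_bool (k = - i) * ((if p = k then \<theta> k else 0)
        - s * (if p = - k then \<theta> (- k) else 0) + g * \<theta> k)
   + r * s * (if p = - k then \<theta> (- k) * (X i (- k) - Y i (- k)) else 0)
   - v * w * s * of_bool (k = - i) * (if p = - k then \<theta> (- k) else 0)"
    if "p \<in> I" for p
    using that assms
    by (auto simp: correction_def minus_equation_iff[of p] algebra_simps theta_neg theta_sq_left theta_sq
        eps_sq eps_sq_left)
  then show ?thesis
    using assms finite_I
    by (simp add: sum.distrib sum_subtractf sum.delta sum_distrib_left[symmetric]) (simp add: mult_ac)
qed

text \<open>The correction does not satisfy the reflection equation by itself: it misses by terms on
  k = -i and on l = -j. These are the remainders of \<open>reflection_inner\<close> with the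
  opposite sign, so that the two failures cancel in \<open>reflection_reduced\<close>.\<close>

lemma correction_reflection:
  assumes nz: "a \<noteq> 0" "b \<noteq> 0" "a \<noteq> \<kappa>" "b \<noteq> \<kappa>" "a \<noteq> b" "a \<noteq> - b"
    and I: "i \<in> I" "k \<in> I" "j \<in> I" "l \<in> I"
    and inv: "r = inverse a" "s = inverse b" "g = inverse (b - \<kappa>)" "e\<^sub>1 = inverse (b + a)" "e\<^sub>2 = inverse (b - a)"
  shows "R_act a (\<lambda>i k. correction r s g e\<^sub>1 e\<^sub>2 v w X Y i k j l) i k
     - (if k = - i then \<theta> i * (\<theta> j * X (- j) l * (1 + \<epsilon> / a)
          + \<epsilon> * (\<theta> l * Y (- l) j - \<theta> j * Y (- j) l / a)) / ((b - \<kappa>) * (a - \<kappa>)) else 0)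
   = R_act a (\<lambda>j l. correction (- r) s g e\<^sub>2 e\<^sub>1 v w Y X k i l j) j l
     - (if l = - j then \<theta> j * (\<theta> i * X k (- i) * (1 + \<epsilon> / a)
          + \<epsilon> * (\<theta> k * Y i (- k) - \<theta> i * Y k (- i) / a)) / ((b - \<kappa>) * (a - \<kappa>)) else 0)"
proof -
  define d where "d = inverse (a - \<kappa>)"
  have inv': "a * r = 1" "b * s = 1" "(b - \<kappa>) * g = 1" "(a - \<kappa>) * d = 1" "(b + a) * e\<^sub>1 = 1" "(b - a) * e\<^sub>2 = 1"
    using nz by (auto simp: inv d_def eq_neg_iff_add_eq_0 add.commute)
  define N where "N = 2 * \<kappa> + 2 * \<epsilon>"
  \<comment> \<open>Partial fraction identities in a and b; \<open>K2\<close> is the one in which N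
    = 2\<kappa> + 2\<epsilon> is used.\<close>
  have K1: "(r + s) * e\<^sub>1 = r * s" using inv' by Groebner_Basis.algebra
  have K2: "e\<^sub>1 * (d + g + N * d * g - \<epsilon> * r * g - \<epsilon> * s * d) + \<epsilon> * d * r * s = (1 + \<epsilon> * r) * d * g"
    using inv' unfolding N_def by Groebner_Basis.algebra
  have K3: "e\<^sub>2 * (r - s) = r * s" using inv' by Groebner_Basis.algebra
  have K4: "e\<^sub>2 * (d - g) = d * g" using inv' by Groebner_Basis.algebra
  have K5: "e\<^sub>2 * (r * g - s * d) - d * r * s + r * d * g = 0" using inv' by Groebner_Basis.algebra
  have sym: "i = - k \<longleftrightarrow> k = - i" "j = - l \<longleftrightarrow> l = - j" "j = k \<longleftrightarrow> k = j" "l = i \<longleftrightarrow> i = l" "l = k \<longleftrightarrow> k = l" "j = i \<longleftrightarrow> i = j"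
    by auto
  have if_of_bool: "(if P then x else 0) = of_bool P * x" for P and x :: 'k by simp
  define cij ckl ckj cil cki clj :: 'k where
    "cij = of_bool (i = j)" and "ckl = of_bool (k = l)" and "ckj = of_bool (k = j)" and
    "cil = of_bool (i = l)" and "cki = of_bool (k = - i)" and "clj = of_bool (l = - j)"
  note cs = cij_def[symmetric] ckl_def[symmetric] ckj_def[symmetric] cil_def[symmetric] cki_def[symmetric] clj_def[symmetric]
  have th: "\<theta> (- i) = \<epsilon> * \<theta> i" "\<theta> (- k) = \<epsilon> * \<theta> k" "\<theta> (- j) = \<epsilon> * \<theta> j" "\<theta> (- l) = \<epsilon> * \<theta> l"
    using I by (simp_all add: theta_neg)
  define tY where "tY = (\<Sum>p\<in>I. Y p p)"
  define A B Ya Yb Yc Yd where "A = X (- j) l" and "B = X k (- i)" and "Ya = Y (- l) j" and "Yb = Y (- j) l"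
    and "Yc = Y i (- k)" and "Yd = Y k (- i)"
  note atoms = A_def[symmetric] B_def[symmetric] Ya_def[symmetric] Yb_def[symmetric] Yc_def[symmetric] Yd_def[symmetric]
  \<comment> \<open>On the support of a delta the sign of the partner index is known. Apart from
    this the deltas can be opaque.\<close>
  have hk: "cki * \<theta> k = cki * \<epsilon> * \<theta> i" and hl: "clj * \<theta> l = clj * \<epsilon> * \<theta> j"
    using I by (auto simp: cki_def clj_def theta_neg)
  \<comment> \<open>The difference of the two sides is split by the kind of product: the P terms in
    X and in Y, the Q terms over rows and over columns, and the part in w. Each piece vanishes by
    the identities above.\<close>
  define Xp where "Xp = ckj * X i l * (r * s - (r + s) * e\<^sub>1) - cil * X k j * (r * s - (r + s) * e\<^sub>1)"
  define Yp where "Yp = ckj * Y i l * (e\<^sub>2 * (r - s) - r * s) - cil * Y k j * (e\<^sub>2 * (r - s) - r * s)"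
  define Xr where "Xr = e\<^sub>1 * g * (cki * \<theta> k) * \<epsilon> * \<theta> j * A - r * e\<^sub>1 * g * cki * \<epsilon> * \<theta> i * \<theta> j * A
    + cki * \<theta> i * d * (e\<^sub>1 * (\<theta> j * A - s * \<epsilon> * \<theta> j * A + g * N * \<theta> j * A) + r * s * \<epsilon> * \<theta> j * A)
    - cki * \<theta> i * \<theta> j * A * (1 + \<epsilon> * r) * g * d"
  define Xc where "Xc = e\<^sub>1 * g * (clj * \<theta> l) * \<epsilon> * \<theta> i * B - r * e\<^sub>1 * g * clj * \<epsilon> * \<theta> i * \<theta> j * B
    + clj * \<theta> j * d * (e\<^sub>1 * (\<theta> i * B - s * \<epsilon> * \<theta> i * B + g * N * \<theta> i * B) + r * s * \<epsilon> * \<theta> i * B)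
    - clj * \<theta> j * \<theta> i * B * (1 + \<epsilon> * r) * g * d"
  define Yr where "Yr = cki * \<theta> i * \<epsilon> * (\<theta> l * Ya * (e\<^sub>2 * d - g * d - e\<^sub>2 * g)
    + \<theta> j * Yb * (e\<^sub>2 * (r * g - s * d) - d * r * s + r * d * g))"
  define Yk where "Yk = clj * \<theta> j * \<epsilon> * (\<theta> k * Yc * (e\<^sub>2 * d - g * d - e\<^sub>2 * g)
    + \<theta> i * Yd * (e\<^sub>2 * (r * g - s * d) - d * r * s + r * d * g))"
  define W where "W = w * e\<^sub>1 * e\<^sub>2 * g * \<epsilon> * (clj * (cki * \<theta> k) * \<theta> j - cki * (clj * \<theta> l) * \<theta> i)"
  have zero: "Xp = 0" "Yp = 0" "Xr = 0" "Xc = 0" "Yr = 0" "Yk = 0" "W = 0"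
  proof -
    show "Xp = 0" "Yp = 0" unfolding Xp_def Yp_def K1 K3 by simp_all
    show "Xr = 0" unfolding Xr_def hk using K2 eps_sq by Groebner_Basis.algebra
    show "Xc = 0" unfolding Xc_def hl using K2 eps_sq by Groebner_Basis.algebra
    have "e\<^sub>2 * d - g * d - e\<^sub>2 * g = 0" using K4 by (simp add: algebra_simps)
    then show "Yr = 0" "Yk = 0" unfolding Yr_def Yk_def K5 by simp_all
    show "W = 0" unfolding W_def hk hl by simp
  qed
  show ?thesis
    unfolding R_act_def[of a] correction_rows[OF I(3,4)] correction_columns[OF I(2,1)]
    unfolding card_I N_def[symmetric] divide_inverse inverse_mult_distrib d_def[symmetric] inv[symmetric]
      if_of_bool correction_def sym minus_minus cs th tY_def[symmetric] atoms
    apply (rule iffD1[OF right_minus_eq])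
    apply (rule trans[of _ "Xp + Yp + Xr - Xc + Yr - Yk + W"])
    subgoal unfolding Xp_def Yp_def Xr_def Xc_def Yr_def Yk_def W_def by (simp add: algebra_simps)
    subgoal by (simp add: zero)
    done
qed

end

section \<open>The index sets of ranks N - 2 and N, and their R-matrices\<close>

locale osp_extension = osp_index I \<theta> \<epsilon> \<kappa>
  for I :: "int set" and \<theta> :: "int \<Rightarrow> 'k::field" and \<epsilon> \<kappa> +
  fixes n :: int
  assumes n_pos: "n > 0" and n_notin: "n \<notin> I"
    and theta_n [simp]: "\<theta> n = 1" and theta_minus_n [simp]: "\<theta> (- n) = \<epsilon>"
begin

definition J :: "int set" where "J = insert n (insert (- n) I)"

lemma minus_n_notin: "- n \<notin> I"
  using n_notin neg_I by blast

lemma n_neq_0 [simp]: "n \<noteq> 0"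
  using n_pos by auto

lemma inner_neq [simp]:
  assumes "i \<in> I"
  shows "i \<noteq> n" "i \<noteq> - n" "n \<noteq> i" "- n \<noteq> i" "- i \<noteq> n" "n \<noteq> - i"
  using assms n_notin minus_n_notin by (auto simp: minus_equation_iff)

lemma J_simps [simp]: "n \<in> J" "- n \<in> J" "i \<in> I \<Longrightarrow> i \<in> J"
  by (simp_all add: J_def)

lemma J_cases [consumes 1]:
  assumes "p \<in> J"
  obtains "p = n" | "p = - n" | "p \<in> I"
  using assms by (auto simp: J_def)

lemma sum_J: "(\<Sum>p\<in>J. f p) = f n + f (- n) + (\<Sum>p\<in>I. f p)"
  using n_notin minus_n_notin finite_I n_pos by (simp add: J_def add.assoc)

sublocale outer: osp_index J \<theta> \<epsilon> "\<kappa> + 1"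
proof
  show "finite J" by (simp add: J_def finite_I)
  show "- i \<in> J \<longleftrightarrow> i \<in> J" for i
    by (auto simp: J_def minus_equation_iff)
  show "\<theta> i * \<theta> i = 1" if "i \<in> J" for i
    using that by (auto simp: J_def theta_sq eps_sq)
  show "\<theta> (- i) = \<epsilon> * \<theta> i" if "i \<in> J" for i
    using that by (auto simp: J_def theta_neg eps_sq)
  show "\<epsilon> = 1 \<or> \<epsilon> = - 1" by (rule eps)
  show "of_nat (card J) = 2 * (\<kappa> + 1) + 2 * \<epsilon>"
    using n_notin minus_n_notin finite_I n_pos by (simp add: J_def card_I algebra_simps)
qed

text \<open>The Q terms differ in their pole, \<kappa> + 1 against \<kappa>, and in the range of
  their trace. The value of the outer action at (-n, n) contains the same full trace; eliminating
  the trace between the two values leaves only the pole at \<kappa>.\<close>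

lemma R_act_outer:
  assumes z: "z \<noteq> \<kappa>" "z \<noteq> \<kappa> + 1" and ik: "i \<in> I" "k \<in> I"
  shows "outer.R_act z Y i k = R_act z Y i k
    + (if k = - i then \<theta> i * (Y n (- n) * (1 + \<epsilon> / z) + \<epsilon> * outer.R_act z Y (- n) n) / (z - \<kappa>) else 0)"
proof (cases "k = - i")
  case True
  define T where "T = (\<Sum>p\<in>I. \<theta> p * Y p (- p))"
  define r d e where "r = inverse z" and "d = inverse (z - \<kappa>)" and "e = inverse (z - (\<kappa> + 1))"
  have "(z - \<kappa>) * d = 1" "(z - (\<kappa> + 1)) * e = 1"
    using z by (simp_all add: d_def e_def)
  with eps_sq have "\<theta> i * (Y n (- n) + \<epsilon> * Y (- n) n + T) * e = \<theta> i * T * d +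
      \<theta> i * (Y n (- n) * (1 + \<epsilon> * r) + \<epsilon> * (Y (- n) n - Y n (- n) * r +
        \<epsilon> * (Y n (- n) + \<epsilon> * Y (- n) n + T) * e)) * d"
    by Groebner_Basis.algebra
  then show ?thesis
    unfolding outer.R_act_def R_act_def sum_J divide_inverse T_def[symmetric]
      r_def[symmetric] d_def[symmetric] e_def[symmetric]
    using True by simp
qed (simp add: R_act_def outer.R_act_def)

end

text \<open>\<open>A i j k l\<close> and \<open>C k l i j\<close> are the values of a functional at \<open>s\<^sub>i\<^sub>j(u) s\<^sub>k\<^sub>l(v)\<close> and
  \<open>s\<^sub>k\<^sub>l(v) s\<^sub>i\<^sub>j(u)\<close>, with \<open>a = u - v\<close> and \<open>b = u + v\<close>.\<close>

locale reflection_data = osp_extension I \<theta> \<epsilon> \<kappa> n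
  for I :: "int set" and \<theta> :: "int \<Rightarrow> 'k::field" and \<epsilon> \<kappa> n +
  fixes a b :: 'k and A C :: "int \<Rightarrow> int \<Rightarrow> int \<Rightarrow> int \<Rightarrow> 'k"
  assumes reflection: "\<lbrakk>i \<in> J; k \<in> J; j \<in> J; l \<in> J\<rbrakk> \<Longrightarrow>
      outer.R_act a (\<lambda>i k. outer.middle (b + 1) A i k j l) i k
        = outer.R_act a (\<lambda>j l. outer.middle (b + 1) C k i l j) j l"
    and A_n: "\<lbrakk>i \<in> J; j \<in> J; k \<in> J; k \<noteq> n\<rbrakk> \<Longrightarrow> A i j k n = 0"
    and A_minus_n: "\<lbrakk>i \<in> J; j \<in> J; l \<in> J; l \<noteq> - n\<rbrakk> \<Longrightarrow> A i j (- n) l = 0"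
    and C_n: "\<lbrakk>i \<in> J; j \<in> J; k \<in> J; k \<noteq> n\<rbrakk> \<Longrightarrow> C i j k n = 0"
    and C_minus_n: "\<lbrakk>i \<in> J; j \<in> J; l \<in> J; l \<noteq> - n\<rbrakk> \<Longrightarrow> C i j (- n) l = 0"
    and a_neq: "a \<noteq> 0" "a\<^sup>2 \<noteq> 1" "a \<noteq> \<kappa>" "a \<noteq> - \<kappa>" "a \<noteq> \<kappa> + 1" "a \<noteq> - (\<kappa> + 1)"
    and b_neq: "b \<noteq> 0" "b \<noteq> - 1" "b \<noteq> \<kappa>" "b \<noteq> \<kappa> - 1"
    and ab_neq: "a \<noteq> b" "a \<noteq> - b"
begin

text \<open>Multiplying the equation by R(-a) on the rows and on the columns and cancelling 1 -
  1/a^2 exchanges its sides; conjugation by the flip then restores the order of the tensor factors.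
  Every later fact about A thus yields its counterpart for C.\<close>

lemma swapped: "reflection_data I \<theta> \<epsilon> \<kappa> n (- a) b C A"
proof (unfold_locales, goal_cases)
  case (1 i k j l)
  define M where "M = (\<lambda>i k j l. outer.middle (b + 1) A i k j l)"
  define M' where "M' = (\<lambda>i k j l. outer.middle (b + 1) C k i l j)"
  have uni: "outer.R_act (- a) (outer.R_act a Y) i k = (1 - 1 / a\<^sup>2) * Y i k"
    if "i \<in> J" "k \<in> J" for Y i k
    using that a_neq by (intro outer.R_act_unitary) auto
  have nz: "1 - 1 / a\<^sup>2 \<noteq> 0" using a_neq by (simp add: field_simps)
  have "(1 - 1 / a\<^sup>2) * outer.R_act (- a) (\<lambda>j l. M k i j l) l j
      = outer.R_act (- a) (\<lambda>j l. (1 - 1 / a\<^sup>2) * M k i j l) l j"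
    by (simp add: outer.R_act_scale)
  also have "\<dots> = outer.R_act (- a) (\<lambda>j l. outer.R_act (- a) (\<lambda>i k. outer.R_act a (\<lambda>i k. M i k j l) i k) k i) l j"
    using 1 by (intro outer.R_act_cong) (simp_all add: uni)
  also have "\<dots> = outer.R_act (- a) (\<lambda>j l. outer.R_act (- a) (\<lambda>i k. outer.R_act a (\<lambda>j l. M' i k j l) j l) k i) l j"
    using 1 by (intro outer.R_act_cong) (simp_all add: reflection M_def M'_def)
  also have "\<dots> = outer.R_act (- a) (\<lambda>i k. outer.R_act (- a) (\<lambda>j l. outer.R_act a (\<lambda>j l. M' i k j l) j l) l j) k i"
    by (rule outer.R_act_comm[symmetric])
  also have "\<dots> = outer.R_act (- a) (\<lambda>i k. (1 - 1 / a\<^sup>2) * M' i k l j) k i"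
    using 1 by (intro outer.R_act_cong) (simp_all add: uni)
  also have "\<dots> = (1 - 1 / a\<^sup>2) * outer.R_act (- a) (\<lambda>i k. M' i k l j) k i"
    by (simp add: outer.R_act_scale)
  finally have "outer.R_act (- a) (\<lambda>j l. M k i j l) l j = outer.R_act (- a) (\<lambda>i k. M' i k l j) k i"
    using nz by (simp only: mult_cancel_left) simp
  then show ?case
    using outer.R_act_flip[of k i "- a" "\<lambda>i k. M' i k l j"]
      outer.R_act_flip[of l j "- a" "\<lambda>j l. M k i j l"] 1
    by (simp add: M_def M'_def)
next
  have neg: "- x \<noteq> y" if "x \<noteq> - y" for x y :: 'k
    using that by (metis minus_minus)
  case 8 show ?case using a_neq(4) by (rule neg)
  case 10 show ?case using a_neq(6) by (rule neg)
  case 16 show ?case using ab_neq(2) by (rule neg)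
qed (use A_n A_minus_n C_n C_minus_n a_neq b_neq ab_neq in \<open>simp_all only: neg_equal_iff_equal neg_equal_0_iff_equal power2_minus not_False_eq_True\<close>)

section \<open>Products with s_nn and with the entries of column n\<close>

lemma middle_A_nn: "outer.middle (b + 1) A p q n n = (if q = n then (1 - 1 / (b + 1)) * A p n n n else 0)"
  if "p \<in> J" "q \<in> J"
  using that(2,1)
  by (cases rule: J_cases) (simp_all add: outer.middle_def sum_J A_n A_minus_n left_diff_distrib)

lemma middle_C_nn: "outer.middle (b + 1) C p q n n = (if q = n then (1 - 1 / (b + 1)) * C p n n n else 0)"
  if "p \<in> J" "q \<in> J"
  using reflection_data.middle_A_nn[OF swapped that] .

lemma b_factor_neq_0: "1 - 1 / (b + 1) \<noteq> 0"
  using b_neq by (simp add: field_simps add_eq_0_iff2)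

text \<open>In the coefficient at rows (i, n) and columns (n, n) the right side vanishes, and on the
  left only this product survives, with the factor b/(b + 1). For i = -n the Q term contributes as
  well and multiplies it by (a - \<kappa>)/(a - \<kappa> - 1). This is the part of stability that
  concerns s_nn.\<close>

lemma A_in_nn: "A i n n n = 0" if i: "i \<in> J" "i \<noteq> n"
proof (cases "i = - n")
  case True
  define X where "X = (1 - 1 / (b + 1)) * A (- n) n n n"
  have "X + \<epsilon> * (\<epsilon> * X) / (a - (\<kappa> + 1)) = 0"
    using reflection[of i n n n] i True
    by (simp add: outer.R_act_def sum_J middle_A_nn middle_C_nn X_def)
  then have "X * ((a - \<kappa>) / (a - (\<kappa> + 1))) = 0"
    using a_neq eps by (elim disjE) (simp_all add: field_simps)
  then have "X = 0" using a_neq by simp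
  with b_factor_neq_0 True show ?thesis unfolding X_def by (metis mult_eq_0_iff)
next
  case False
  have "(1 - 1 / (b + 1)) * A i n n n = 0"
    using reflection[of i n n n] i False
    by (simp add: outer.R_act_def sum_J middle_A_nn middle_C_nn del: mult_eq_0_iff)
  with b_factor_neq_0 show ?thesis by (metis mult_eq_0_iff)
qed

lemma C_in_nn: "C i n n n = 0" if i: "i \<in> J" "i \<noteq> n"
  using reflection_data.A_in_nn[OF swapped that] .

text \<open>Both sides carry the same factors b/(b + 1) and 1 - 1/a; the latter is nonzero as a^2
  \<noteq> 1.\<close>

lemma nn_commute: "A n n n n = C n n n n"
proof -
  define f where "f = 1 - 1 / (b + 1)"
  have "f * A n n n n - f * A n n n n / a = f * C n n n n - f * C n n n n / a"
    using reflection[of n n n n]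
    by (simp add: outer.R_act_def sum_J middle_A_nn middle_C_nn f_def)
  then have "f * ((1 - 1 / a) * (A n n n n - C n n n n)) = 0"
    by (simp add: algebra_simps)
  moreover have "1 - 1 / a \<noteq> 0" using a_neq by auto
  ultimately show ?thesis
    using b_factor_neq_0 unfolding f_def by (metis mult_eq_0_iff right_minus_eq)
qed

lemma middle_A_inner:
  assumes "l \<in> I"
  shows "\<lbrakk>i \<in> J; k \<in> J; k \<noteq> n\<rbrakk> \<Longrightarrow> outer.middle (b + 1) A i k n l = A i n k l"
    "i \<in> J \<Longrightarrow> outer.middle (b + 1) A i n n l = A i n n l - (\<Sum>p\<in>J. A i p p l) / (b + 1)"
    "\<lbrakk>i \<in> J; k \<in> J; i \<noteq> n; k \<noteq> n\<rbrakk> \<Longrightarrow> outer.middle (b + 1) A k i l n = 0"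
    "k \<in> J \<Longrightarrow> k \<noteq> - n \<Longrightarrow> outer.middle (b + 1) A k n l n = A k l n n"
    "i \<in> J \<Longrightarrow> i \<noteq> n \<Longrightarrow> outer.middle (b + 1) A n i l n = - (if i = l then A n n n n / (b + 1) else 0)"
  using assms by (auto simp: outer.middle_def A_n A_minus_n sum_J A_in_nn)

lemma middle_C_inner:
  assumes "l \<in> I"
  shows "\<lbrakk>i \<in> J; k \<in> J; k \<noteq> n\<rbrakk> \<Longrightarrow> outer.middle (b + 1) C i k n l = C i n k l"
    "i \<in> J \<Longrightarrow> outer.middle (b + 1) C i n n l = C i n n l - (\<Sum>p\<in>J. C i p p l) / (b + 1)"
    "\<lbrakk>i \<in> J; k \<in> J; i \<noteq> n; k \<noteq> n\<rbrakk> \<Longrightarrow> outer.middle (b + 1) C k i l n = 0"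
    "k \<in> J \<Longrightarrow> k \<noteq> - n \<Longrightarrow> outer.middle (b + 1) C k n l n = C k l n n"
    "i \<in> J \<Longrightarrow> i \<noteq> n \<Longrightarrow> outer.middle (b + 1) C n i l n = - (if i = l then C n n n n / (b + 1) else 0)"
  by (rule reflection_data.middle_A_inner[OF swapped assms]; assumption)+

text \<open>The outer action vanishes at (-n, n), so \<open>R_act_outer\<close> replaces R of rank N
  by R of rank N - 2; on the other side of the equation only the P term survives.\<close>

lemma R_act_A_in:
  assumes i: "i \<in> I" "k \<in> I" and l: "l \<in> I"
  shows "R_act a (\<lambda>i k. A i n k l) i k = - C k n i l / a"
proof -
  have "R_act a (\<lambda>i k. A i n k l) i k = R_act a (\<lambda>i k. outer.middle (b + 1) A i k n l) i k"
    using i l by (intro R_act_cong) (simp_all add: middle_A_inner)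
  moreover have "outer.R_act a (\<lambda>i k. outer.middle (b + 1) A i k n l) (- n) n = 0"
    using l by (subst reflection) (simp_all add: outer.R_act_def middle_C_inner C_minus_n C_n C_in_nn
        outer.middle_def sum_J)
  then have "R_act a (\<lambda>i k. outer.middle (b + 1) A i k n l) i k = outer.R_act a (\<lambda>i k. outer.middle (b + 1) A i k n l) i k"
    using i l a_neq by (simp add: R_act_outer middle_A_inner A_n A_minus_n)
  moreover have "outer.R_act a (\<lambda>i k. outer.middle (b + 1) A i k n l) i k = - C k n i l / a"
    using i l by (simp add: reflection) (simp add: outer.R_act_def middle_C_inner)
  ultimately show ?thesis by simp
qed

lemma R_act_C_in:
  assumes i: "i \<in> I" "k \<in> I" and l: "l \<in> I"
  shows "R_act (- a) (\<lambda>i k. C i n k l) i k = A k n i l / a"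
  using reflection_data.R_act_A_in[OF swapped assms] by simp

text \<open>With F the exchange of i and k, the two preceding relations read R(a) A = -F C/a and
  R(-a) C = F A/a. Applying R(-a) to the first gives (1 - 1/a^2) A = -A/a^2; the terms in 1/a^2
  cancel and leave A = 0.\<close>

lemma A_in_inner:
  assumes i: "i \<in> I" and k: "k \<in> I" and l: "l \<in> I"
  shows "A i n k l = 0"
proof -
  have "(1 - 1 / a\<^sup>2) * A i n k l = R_act (- a) (R_act a (\<lambda>i k. A i n k l)) i k"
    using R_act_unitary[of a i k "\<lambda>i k. A i n k l"] a_neq assms by simp
  also have "\<dots> = R_act (- a) (\<lambda>i k. (- 1 / a) * C k n i l) i k"
    using assms by (intro R_act_cong) (simp_all add: R_act_A_in)
  also have "\<dots> = (- 1 / a) * R_act (- a) (\<lambda>i k. C i n k l) k i"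
    using R_act_flip[of k i "- a" "\<lambda>i k. C i n k l"] assms by (simp only: R_act_scale)
  also have "\<dots> = - A i n k l / a\<^sup>2"
    using assms by (simp add: R_act_C_in power2_eq_square)
  finally show ?thesis
    by (simp add: left_diff_distrib)
qed

lemma A_minus_n_inner:
  assumes k: "k \<in> I" and l: "l \<in> I"
  shows "A (- n) n k l = 0"
  using reflection[of "- n" k n l] assms
  by (simp add: outer.R_act_def middle_A_inner middle_C_inner A_minus_n C_minus_n C_n C_in_nn)

text \<open>The value shared by the coefficients at rows (i, n) and columns (n, l) of A and of C. It
  is fixed by \<open>swapped\<close>, which negates a and exchanges A and C.\<close>

definition h :: "int \<Rightarrow> int \<Rightarrow> 'k" where
  "h i l = A n n i l / a - C n n i l / a - (if i = l then A n n n n / (b + 1) else 0)"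

lemma h_A:
  assumes "i \<in> I" and "l \<in> I"
  shows "A i n n l - (\<Sum>p\<in>J. A i p p l) / (b + 1) = h i l"
proof -
  have "A i n n l - (\<Sum>p\<in>J. A i p p l) / (b + 1) - A n n i l / a
      = - (if i = l then C n n n n / (b + 1) else 0) - C n n i l / a"
    using reflection[of i n n l] assms
    by (simp add: outer.R_act_def middle_A_inner middle_C_inner)
  then show ?thesis by (simp only: h_def nn_commute diff_eq_eq) simp
qed

lemma h_C:
  assumes "i \<in> I" and "l \<in> I"
  shows "C i n n l - (\<Sum>p\<in>J. C i p p l) / (b + 1) = h i l"
proof -
  have "C i n n l - (\<Sum>p\<in>J. C i p p l) / (b + 1)
      = C n n i l / (- a) - A n n i l / (- a) - (if i = l then C n n n n / (b + 1) else 0)"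
    using reflection_data.h_A[OF swapped assms] reflection_data.h_def[OF swapped, of i l] by metis
  then show ?thesis by (simp add: h_def nn_commute)
qed

text \<open>In the coefficient at rows (n, k) and columns (n, l) the P terms are h/a on both sides
  and drop out. So s_nn(u) and s_kl(v) commute on V_+.\<close>

lemma A_nn_commute:
  assumes "k \<in> I" and "l \<in> I"
  shows "A n n k l = C k l n n"
  using reflection[of n k n l] assms h_A[OF assms] h_C[OF assms]
  by (simp add: outer.R_act_def middle_A_inner middle_C_inner)

lemma C_nn_commute:
  assumes "k \<in> I" and "l \<in> I"
  shows "C n n k l = A k l n n"
  using reflection_data.A_nn_commute[OF swapped assms] .

section \<open>The corner coefficient: s_nn against the entry at (-n, -n)\<close>

lemma middle_mn:
  assumes p: "p \<in> J" "q \<in> J"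
  shows "outer.middle (b + 1) A p q (- n) n = (if q = n then A p (- n) n n else 0)
    - (if q = - n then A p n n n / (b + 1) else 0) + \<theta> (- q) * \<epsilon> * A p (- q) n n / (b - \<kappa>)"
  using p(2,1) by (cases rule: J_cases) (simp_all add: outer.middle_def sum_J A_n A_minus_n)

lemma middle_C_mn:
  assumes p: "p \<in> J"
  shows "outer.middle (b + 1) C n (- n) (- p) p = (if p = - n then C n n (- n) (- n) else 0)
    - (if p = n then C n n n n / (b + 1) else 0) + \<theta> (- p) * C n n p p / (b - \<kappa>)"
  using p by (cases p rule: J_cases) (simp_all add: outer.middle_def sum_J C_n C_minus_n C_in_nn)

text \<open>The trace that enters through the value of \<open>R_act_outer\<close> at (-n, n). It has
  to agree with the one in \<open>corner_C\<close>, or the terms with both k = -i and l = -j would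
  not cancel.\<close>

lemma corner_A:
  "(\<Sum>p\<in>J. \<theta> p * outer.middle (b + 1) A p (- p) (- n) n)
     = \<epsilon> * A (- n) (- n) n n - A n n n n / (b + 1) + \<epsilon> * (\<Sum>p\<in>J. A p p n n) / (b - \<kappa>)"
proof -
  have "\<theta> p * outer.middle (b + 1) A p (- p) (- n) n = (if p = - n then \<epsilon> * A (- n) (- n) n n else 0)
      - (if p = n then A n n n n / (b + 1) else 0) + \<epsilon> / (b - \<kappa>) * A p p n n" if "p \<in> J" for p
    using that outer.theta_sq_left[OF that] by (subst middle_mn) (auto simp: algebra_simps minus_equation_iff eps_sq)
  then show ?thesis
    by (simp add: sum.distrib sum_subtractf sum.delta outer.finite_I sum_distrib_left sum_divide_distrib)
qed

lemma corner_C: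
  "(\<Sum>p\<in>J. \<theta> p * outer.middle (b + 1) C n (- n) (- p) p)
     = \<epsilon> * C n n (- n) (- n) - C n n n n / (b + 1) + \<epsilon> * (\<Sum>p\<in>J. C n n p p) / (b - \<kappa>)"
proof -
  have "\<theta> p * outer.middle (b + 1) C n (- n) (- p) p = (if p = - n then \<epsilon> * C n n (- n) (- n) else 0)
      - (if p = n then C n n n n / (b + 1) else 0) + \<epsilon> / (b - \<kappa>) * C n n p p" if "p \<in> J" for p
    using that outer.theta_sq_left[OF that] outer.theta_neg[OF that]
    by (subst middle_C_mn) (auto simp: algebra_simps)
  then show ?thesis
    by (simp add: sum.distrib sum_subtractf sum.delta outer.finite_I sum_distrib_left sum_divide_distrib)
qed

lemma trace_diff:
  "(\<Sum>p\<in>J. A p p n n) - (\<Sum>p\<in>J. C n n p p) = A (- n) (- n) n n - C n n (- n) (- n)"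
  by (simp add: sum_J nn_commute C_nn_commute)

text \<open>For the difference D of the sides, the coefficient at rows and columns (-n, n) leaves D
  (1 + 1/(b - \<kappa>)) (1 + 1/(a - \<kappa> - 1)) = 0. The full traces also differ by D only, by
  \<open>trace_diff\<close>, since the other diagonal entries already commute with s_nn.\<close>

lemma minus_nn_commute: "A (- n) (- n) n n = C n n (- n) (- n)"
proof -
  define D where "D = A (- n) (- n) n n - C n n (- n) (- n)"
  define SA SC where "SA = (\<Sum>p\<in>J. A p p n n)" and "SC = (\<Sum>p\<in>J. C n n p p)"
  define g e w where "g = inverse (b - \<kappa>)" and "e = inverse (a - (\<kappa> + 1))" and "w = inverse (b + 1)"
  have eq: "outer.middle (b + 1) A (- n) n (- n) n - outer.middle (b + 1) A n (- n) (- n) n / a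
      + \<epsilon> * (\<Sum>p\<in>J. \<theta> p * outer.middle (b + 1) A p (- p) (- n) n) / (a - (\<kappa> + 1))
    = outer.middle (b + 1) C n (- n) n (- n) - outer.middle (b + 1) C n (- n) (- n) n / a
      + \<epsilon> * (\<Sum>p\<in>J. \<theta> p * outer.middle (b + 1) C n (- n) (- p) p) / (a - (\<kappa> + 1))"
    using reflection[of "- n" n "- n" n] by (simp add: outer.R_act_def)
  have mA: "outer.middle (b + 1) A (- n) n (- n) n = A (- n) (- n) n n + A (- n) (- n) n n / (b - \<kappa>)"
    "outer.middle (b + 1) A n (- n) (- n) n = \<epsilon> * A n n n n / (b - \<kappa>) - A n n n n / (b + 1)"
    by (simp_all add: middle_mn eps_sq)
  have mC: "outer.middle (b + 1) C n (- n) n (- n) = C n n (- n) (- n) + C n n (- n) (- n) / (b - \<kappa>)"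
    "outer.middle (b + 1) C n (- n) (- n) n = \<epsilon> * A n n n n / (b - \<kappa>) - A n n n n / (b + 1)"
    using middle_C_mn[of "- n"] middle_C_mn[of n] by (simp_all add: nn_commute)
  have "(D + D * g) + \<epsilon> * (\<epsilon> * D + \<epsilon> * (SA - SC) * g) * e = 0"
    using eq unfolding corner_A corner_C mA mC
    by (simp add: nn_commute D_def SA_def SC_def g_def e_def divide_inverse algebra_simps)
  moreover have "SA - SC = D"
    unfolding SA_def SC_def D_def by (rule trace_diff)
  ultimately have "D * (1 + g) * (1 + e) = 0"
    using eps_sq by Groebner_Basis.algebra
  moreover have "1 + g \<noteq> 0" "1 + e \<noteq> 0"
    using a_neq b_neq by (simp_all add: g_def e_def add_eq_0_iff2 field_simps)
  ultimately show ?thesis by (simp add: D_def)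
qed

lemma corner_eq:
  "(\<Sum>p\<in>J. \<theta> p * outer.middle (b + 1) A p (- p) (- n) n)
     = (\<Sum>p\<in>J. \<theta> p * outer.middle (b + 1) C n (- n) (- p) p)"
  using trace_diff by (simp add: corner_A corner_C minus_nn_commute nn_commute)

text \<open>The full trace S contains A i n n l, which \<open>h_A\<close> expresses through S
  itself. Solving S - S/(b + 1) = (inner trace) + h turns the factor 1/(b + 1) into 1/b: this is
  where the P term of R'(u + v) comes from.\<close>

lemma sum_A_inner:
  assumes "i \<in> I" "l \<in> I"
  shows "(\<Sum>p\<in>J. A i p p l) / (b + 1) = ((\<Sum>p\<in>I. A i p p l) + h i l) / b"
proof -
  define S where "S = (\<Sum>p\<in>J. A i p p l)"
  have "S - (\<Sum>p\<in>I. A i p p l) - S / (b + 1) = h i l"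
    using h_A[OF assms] assms by (simp add: S_def sum_J A_minus_n)
  then have "S / (b + 1) = S - (\<Sum>p\<in>I. A i p p l) - h i l" by (simp add: algebra_simps)
  then have "S = (S - (\<Sum>p\<in>I. A i p p l) - h i l) * (b + 1)"
    using b_neq by (simp add: divide_eq_eq add_eq_0_iff2)
  then have "(\<Sum>p\<in>I. A i p p l) + h i l = (S - (\<Sum>p\<in>I. A i p p l) - h i l) * b"
    by (simp add: algebra_simps)
  with \<open>S / (b + 1) = _\<close> show ?thesis
    using b_neq by (simp add: S_def[symmetric] eq_divide_eq)
qed

text \<open>The Q terms agree without change, as b + 1 - (\<kappa> + 1) = b - \<kappa>; only the P
  terms differ.\<close>

lemma middle_outer_A:
  assumes "i \<in> I" "l \<in> I"
  shows "outer.middle (b + 1) A i k j l = middle b A i k j l - (if k = j then h i l / b else 0)"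
  using sum_A_inner[OF assms] by (simp add: outer.middle_def middle_def add_divide_distrib)

lemma h_swapped: "reflection_data.h n (- a) b C A = h"
  by (rule ext)+ (simp add: h_def reflection_data.h_def[OF swapped] nn_commute)

lemma middle_outer_C:
  assumes "i \<in> I" "l \<in> I"
  shows "outer.middle (b + 1) C i k j l = middle b C i k j l - (if k = j then h i l / b else 0)"
  using reflection_data.middle_outer_A[OF swapped assms] by (simp add: h_swapped)

text \<open>\<open>R_act_outer\<close> is applied to the rows and to the columns. The values at (-n,
  n) that it asks for are read off from the opposite side of the reflection equation; their common
  part D cancels by \<open>corner_eq\<close>.\<close>

lemma reflection_inner:
  assumes "i \<in> I" "k \<in> I" "j \<in> I" "l \<in> I"
  shows "R_act a (\<lambda>i k. outer.middle (b + 1) A i k j l) i k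
     + (if k = - i then \<theta> i * (\<theta> j * A n n (- j) l * (1 + \<epsilon> / a)
          + \<epsilon> * (\<theta> l * A (- l) j n n - \<theta> j * A (- j) l n n / a)) / ((b - \<kappa>) * (a - \<kappa>)) else 0)
   = R_act a (\<lambda>j l. outer.middle (b + 1) C k i l j) j l
     + (if l = - j then \<theta> j * (\<theta> i * A n n k (- i) * (1 + \<epsilon> / a)
          + \<epsilon> * (\<theta> k * A i (- k) n n - \<theta> i * A k (- i) n n / a)) / ((b - \<kappa>) * (a - \<kappa>)) else 0)"
proof -
  have mC: "outer.middle (b + 1) C n (- n) q p = \<theta> q * A (- q) p n n / (b - \<kappa>)" if "p \<in> I" "q \<in> I" for p q
    using that by (simp add: outer.middle_def C_minus_n C_nn_commute)
  have mA: "outer.middle (b + 1) A p q (- n) n = \<theta> q * A p (- q) n n / (b - \<kappa>)" if "p \<in> I" "q \<in> I" for p q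
    using that eps_sq by (auto simp: outer.middle_def A_n theta_neg)
  define D where "D = (\<Sum>p\<in>J. \<theta> p * outer.middle (b + 1) C n (- n) (- p) p)"
  have rA: "outer.R_act a (\<lambda>i k. outer.middle (b + 1) A i k j l) (- n) n
      = \<theta> l * A (- l) j n n / (b - \<kappa>) - \<theta> j * A (- j) l n n / (b - \<kappa>) / a
        + (if l = - j then \<theta> j * D / (a - (\<kappa> + 1)) else 0)"
    using assms by (simp add: reflection) (simp add: outer.R_act_def mC D_def)
  have rC: "outer.R_act a (\<lambda>j l. outer.middle (b + 1) C k i l j) (- n) n
      = \<theta> k * A i (- k) n n / (b - \<kappa>) - \<theta> i * A k (- i) n n / (b - \<kappa>) / a
        + (if k = - i then \<theta> i * D / (a - (\<kappa> + 1)) else 0)"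
    using assms by (simp flip: reflection) (simp add: outer.R_act_def mA D_def corner_eq)
  have yA: "outer.middle (b + 1) A n (- n) j l = \<theta> j * A n n (- j) l / (b - \<kappa>)"
    using assms by (simp add: outer.middle_def A_minus_n)
  have yC: "outer.middle (b + 1) C k i (- n) n = \<theta> i * A n n k (- i) / (b - \<kappa>)"
    using assms eps_sq by (auto simp: outer.middle_def C_n theta_neg A_nn_commute)
  have na: "a \<noteq> \<kappa>" "a \<noteq> \<kappa> + 1" using a_neq by auto
  define g d r e where "g = inverse (b - \<kappa>)" and "d = inverse (a - \<kappa>)" and "r = inverse a" and "e = inverse (a - (\<kappa> + 1))"
  show ?thesis
    using reflection[of i k j l] assms R_act_outer[OF na, of i k "\<lambda>i k. outer.middle (b + 1) A i k j l"]
      R_act_outer[OF na, of j l "\<lambda>j l. outer.middle (b + 1) C k i l j"]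
    unfolding rA rC yA yC divide_inverse inverse_mult_distrib g_def[symmetric] d_def[symmetric] r_def[symmetric] e_def[symmetric]
    by (auto simp: algebra_simps)
qed

text \<open>\<open>A'\<close> and \<open>C'\<close> are the products of the corrected entries: with
  a = u - v and b = u + v the denominators are b + a = 2u and b - a = 2v. The equation is the sum of
  \<open>reflection_inner\<close> and \<open>correction_reflection\<close>.\<close>

theorem reflection_reduced:
  assumes A': "\<And>i j k l. \<lbrakk>i \<in> I; j \<in> I; k \<in> I; l \<in> I\<rbrakk> \<Longrightarrow> A' i j k l = A i j k l
        + of_bool (k = l) * A i j n n / (b - a) + of_bool (i = j) * A n n k l / (b + a)
        + of_bool (i = j) * of_bool (k = l) * A n n n n / ((b + a) * (b - a))"
    and C': "\<And>i j k l. \<lbrakk>i \<in> I; j \<in> I; k \<in> I; l \<in> I\<rbrakk> \<Longrightarrow> C' k l i j = C k l i j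
        + of_bool (k = l) * C n n i j / (b - a) + of_bool (i = j) * C k l n n / (b + a)
        + of_bool (i = j) * of_bool (k = l) * C n n n n / ((b + a) * (b - a))"
    and I: "i \<in> I" "k \<in> I" "j \<in> I" "l \<in> I"
  shows "R_act a (\<lambda>i k. middle b A' i k j l) i k = R_act a (\<lambda>j l. middle b C' k i l j) j l"
proof -
  define r s g e\<^sub>1 e\<^sub>2 v where inv: "r = inverse a" "s = inverse b" "g = inverse (b - \<kappa>)"
    "e\<^sub>1 = inverse (b + a)" "e\<^sub>2 = inverse (b - a)" "v = inverse (b + 1)"
  have if_of_bool: "(if P then x else 0) = of_bool P * x" for P and x :: 'k by simp
  define w X Y where "w = A n n n n" and "X = A n n" and "Y = (\<lambda>i j. A i j n n)"
  have mA: "middle b A' i k j l = outer.middle (b + 1) A i k j l + correction r s g e\<^sub>1 e\<^sub>2 v w X Y i k j l"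
    if "i \<in> I" "k \<in> I" "j \<in> I" "l \<in> I" for i j k l
  proof -
    have "(\<Sum>p\<in>I. A' i p p l) = (\<Sum>p\<in>I. A i p p l + (if p = l then Y i l * e\<^sub>2 else 0)
        + (if p = i then X i l * e\<^sub>1 else 0) + (if p = i then of_bool (i = l) * w * e\<^sub>1 * e\<^sub>2 else 0))"
      using that by (intro sum.cong) (auto simp: A' X_def Y_def w_def inv divide_inverse)
    also have "\<dots> = (\<Sum>p\<in>I. A i p p l) + Y i l * e\<^sub>2 + X i l * e\<^sub>1 + of_bool (i = l) * w * e\<^sub>1 * e\<^sub>2"
      using that finite_I by (simp add: sum.distrib sum.delta)
    finally have sum: "(\<Sum>p\<in>I. A' i p p l) = \<dots>" .
    have h: "h i l = r * (X i l - Y i l) - of_bool (i = l) * w * v"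
      using that by (auto simp: h_def X_def Y_def w_def inv divide_inverse C_nn_commute algebra_simps)
    have A'': "A' i j k l = A i j k l + of_bool (k = l) * Y i j * e\<^sub>2 + of_bool (i = j) * X k l * e\<^sub>1
        + of_bool (i = j) * of_bool (k = l) * w * e\<^sub>1 * e\<^sub>2" if "i \<in> I" "j \<in> I" "k \<in> I" "l \<in> I" for i j k l
      using that A'[OF that] by (simp add: X_def Y_def w_def inv divide_inverse)
    have eqs: "i = - k \<longleftrightarrow> k = - i" "- j = l \<longleftrightarrow> l = - j" by auto
    have nI: "- k \<in> I" "- j \<in> I" using that by simp_all
    show ?thesis
      unfolding middle_outer_A[OF that(1,4)] middle_def sum h A''[OF that(1,3,2,4)] A''[OF that(1) nI that(4)]
        divide_inverse inv[symmetric] if_of_bool correction_def eqs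
      by Groebner_Basis.algebra
  qed
  interpret sw: reflection_data I \<theta> \<epsilon> \<kappa> n "- a" b C A by (rule swapped)
  have mC: "middle b C' k i l j = outer.middle (b + 1) C k i l j + correction (- r) s g e\<^sub>2 e\<^sub>1 v w Y X k i l j"
    if "i \<in> I" "k \<in> I" "j \<in> I" "l \<in> I" for i j k l
  proof -
    have "(\<Sum>p\<in>I. C' k p p j) = (\<Sum>p\<in>I. C k p p j + (if p = k then Y k j * e\<^sub>2 else 0)
        + (if p = j then X k j * e\<^sub>1 else 0) + (if p = k then of_bool (k = j) * w * e\<^sub>1 * e\<^sub>2 else 0))"
      using that by (intro sum.cong)
        (auto simp: C' X_def Y_def w_def inv divide_inverse C_nn_commute A_nn_commute nn_commute)
    also have "\<dots> = (\<Sum>p\<in>I. C k p p j) + Y k j * e\<^sub>2 + X k j * e\<^sub>1 + of_bool (k = j) * w * e\<^sub>1 * e\<^sub>2"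
      using that finite_I by (simp add: sum.distrib sum.delta)
    finally have sum: "(\<Sum>p\<in>I. C' k p p j) = \<dots>" .
    have h: "h k j = r * (X k j - Y k j) - of_bool (k = j) * w * v"
      using that by (auto simp: h_def X_def Y_def w_def inv divide_inverse C_nn_commute algebra_simps)
    have eqs: "k = - i \<longleftrightarrow> i = - k" "- l = j \<longleftrightarrow> j = - l" "l = i \<longleftrightarrow> i = l" "j = k \<longleftrightarrow> k = j" "l = k \<longleftrightarrow> k = l" "j = i \<longleftrightarrow> i = j" by auto
    have C'': "C' k l i j = C k l i j + of_bool (k = l) * Y i j * e\<^sub>2 + of_bool (i = j) * X k l * e\<^sub>1
        + of_bool (i = j) * of_bool (k = l) * w * e\<^sub>1 * e\<^sub>2" if "i \<in> I" "j \<in> I" "k \<in> I" "l \<in> I" for i j k l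
      using that C'[OF that] by (simp add: C_nn_commute A_nn_commute nn_commute X_def Y_def w_def inv divide_inverse)
    have nI: "- i \<in> I" "- l \<in> I" using that by simp_all
    show ?thesis
      unfolding middle_outer_C[OF that(2,3)] middle_def sum h C''[OF that(1,3,2,4)] C''[OF nI(2) that(3,2) nI(1)]
        divide_inverse inv[symmetric] if_of_bool correction_def eqs
      by Groebner_Basis.algebra
  qed
  have "R_act a (\<lambda>i k. middle b A' i k j l) i k
      = R_act a (\<lambda>i k. outer.middle (b + 1) A i k j l) i k + R_act a (\<lambda>i k. correction r s g e\<^sub>1 e\<^sub>2 v w X Y i k j l) i k"
    unfolding R_act_add[symmetric] using I by (intro R_act_cong) (simp_all add: mA)
  moreover have "R_act a (\<lambda>j l. middle b C' k i l j) j l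
      = R_act a (\<lambda>j l. outer.middle (b + 1) C k i l j) j l + R_act a (\<lambda>j l. correction (- r) s g e\<^sub>2 e\<^sub>1 v w Y X k i l j) j l"
    unfolding R_act_add[symmetric] using I by (intro R_act_cong) (simp_all add: mC)
  moreover have "a \<noteq> b" "a \<noteq> - b" "a \<noteq> 0" "b \<noteq> 0" "a \<noteq> \<kappa>" "b \<noteq> \<kappa>"
    using a_neq b_neq ab_neq by auto
  note c = correction_reflection[OF this(3,4,5,6,1,2) I inv(1-5), of v w X Y]
  have XY: "A n n p q = X p q" "A p q n n = Y p q" for p q by (simp_all add: X_def Y_def)
  \<comment> \<open>The defects p and q enter the two equations with opposite signs.\<close>
  have add: "x + x' = y + y'" if "x + p = y + q" "x' - p = y' - q" for x x' y y' p q :: 'k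
    using that by Groebner_Basis.algebra
  note add[OF reflection_inner[OF I, unfolded XY] c]
  ultimately show ?thesis by simp
qed

end

section \<open>Substitution into series with central values\<close>

lemma map_fps_nth [simp]: "map_fps h f $ k = h (f $ k)"
  by (simp add: map_fps_def)

lemma map_fls_nth [simp]:
  assumes "h 0 = 0"
  shows "map_fls h f $$ k = h (f $$ k)"
proof -
  have "\<exists>N. \<forall>n<N. h (f $$ n) = 0"
    using assms by (intro exI[of _ "fls_subdegree f"]) simp
  then show ?thesis
    unfolding map_fls_def by (rule nth_Abs_fls_ex_lower_bound)
qed

text \<open>Any lower bounds for the orders may delimit the convolution. This is needed because a
  map on coefficients can raise the order of a series, so that the exact orders of a series and of
  its image do not match.\<close>

lemma fls_times_nth_from:
  fixes f g :: "'a::semiring_0 fls"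
  assumes "\<And>k. k < a \<Longrightarrow> f $$ k = 0" and "\<And>k. k < b \<Longrightarrow> g $$ k = 0"
  shows "(f * g) $$ n = (\<Sum>i=a..n - b. f $$ i * g $$ (n - i))"
proof (cases "f = 0 \<or> g = 0")
  case True
  then show ?thesis by auto
next
  case False
  have "a \<le> fls_subdegree f" "b \<le> fls_subdegree g"
    using assms False by (metis fls_eq0_below_subdegree linorder_not_le nth_fls_subdegree_nonzero)+
  then have "(\<Sum>i=fls_subdegree f..n - fls_subdegree g. f $$ i * g $$ (n - i)) = (\<Sum>i=a..n - b. f $$ i * g $$ (n - i))"
    by (intro sum.mono_neutral_left) (auto simp: fls_eq0_below_subdegree)
  then show ?thesis by (simp add: fls_times_nth(2))
qed

lemma fls_mult_commute:
  fixes f g :: "'a::semiring_0 fls"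
  assumes "\<And>k l. f $$ k * g $$ l = g $$ l * f $$ k"
  shows "f * g = g * f"
proof (rule fls_eqI)
  fix n
  define a b where "a = fls_subdegree f" and "b = fls_subdegree g"
  have v: "\<And>k. k < a \<Longrightarrow> f $$ k = 0" "\<And>k. k < b \<Longrightarrow> g $$ k = 0"
    by (simp_all add: a_def b_def)
  have "(f * g) $$ n = (\<Sum>i=a..n - b. g $$ (n - i) * f $$ i)"
    using fls_times_nth_from[of a f b g n] v assms by simp
  also have "\<dots> = (\<Sum>i=b..n - a. g $$ i * f $$ (n - i))"
    by (rule sum.reindex_bij_witness[of _ "\<lambda>i. n - i" "\<lambda>i. n - i"]) auto
  also have "\<dots> = (g * f) $$ n"
    using fls_times_nth_from[of b g a f n] v by simp
  finally show "(f * g) $$ n = (g * f) $$ n" .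
qed

locale ring_morphism =
  fixes h :: "'a::ring_1 \<Rightarrow> 'b::ring_1"
  assumes add: "h (x + y) = h x + h y" and mult: "h (x * y) = h x * h y" and one: "h 1 = 1"
begin

lemma zero [simp]: "h 0 = 0"
  using add[of 0 0] by simp

lemma uminus: "h (- x) = - h x"
  using add[of x "- x"] by (simp add: eq_neg_iff_add_eq_0 add.commute)

lemma diff: "h (x - y) = h x - h y"
  using add[of x "- y"] by (simp add: uminus)

lemma sum: "h (sum f A) = (\<Sum>a\<in>A. h (f a))"
  by (induction A rule: infinite_finite_induct) (simp_all add: add)

lemma map_fls: "ring_morphism (map_fls h)"
proof
  fix f g :: "'a fls"
  show "map_fls h (f + g) = map_fls h f + map_fls h g"
    by (rule fls_eqI) (simp add: add)
  show "map_fls h 1 = 1"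
    by (rule fls_eqI) (simp add: one)
  show "map_fls h (f * g) = map_fls h f * map_fls h g"
  proof (rule fls_eqI)
    fix n
    define a b where "a = fls_subdegree f" and "b = fls_subdegree g"
    have v: "\<And>k. k < a \<Longrightarrow> f $$ k = 0" "\<And>k. k < b \<Longrightarrow> g $$ k = 0"
      by (simp_all add: a_def b_def)
    have "(map_fls h f * map_fls h g) $$ n = (\<Sum>i=a..n - b. map_fls h f $$ i * map_fls h g $$ (n - i))"
      by (rule fls_times_nth_from) (simp_all add: v)
    then show "map_fls h (f * g) $$ n = (map_fls h f * map_fls h g) $$ n"
      using fls_times_nth_from[of a f b g n] v by (simp add: sum mult)
  qed
qed

lemma map_fps: "ring_morphism (map_fps h)"
proof
  fix f g :: "'a fps"
  show "map_fps h (f + g) = map_fps h f + map_fps h g"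
    by (rule fps_ext) (simp add: add)
  show "map_fps h 1 = 1"
    by (rule fps_ext) (simp add: one)
  show "map_fps h (f * g) = map_fps h f * map_fps h g"
    by (rule fps_ext) (simp add: fps_mult_nth sum mult)
qed

end

lemma ring_morphism_comp: "ring_morphism f \<Longrightarrow> ring_morphism g \<Longrightarrow> ring_morphism (\<lambda>x. f (g x))"
  by (simp add: ring_morphism_def)

lemma ring_morphism_fps_const: "ring_morphism fps_const"
  by (simp add: ring_morphism_def)

lemma ring_morphism_fls_const: "ring_morphism fls_const"
  by (simp add: ring_morphism_def fls_plus_const)

lemma ring_morphism_fps_to_fls: "ring_morphism fps_to_fls"
  by (simp add: ring_morphism_def fls_times_fps_to_fls)

locale central_morphism = ring_morphism \<iota> for \<iota> :: "'c::idom \<Rightarrow> 'a::ring_1" +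
  assumes central: "\<iota> c * x = x * \<iota> c"
begin

lemma map_fls_central: "central_morphism (map_fls \<iota>)"
proof -
  interpret m: ring_morphism "map_fls \<iota>" by (rule map_fls)
  show ?thesis
    by unfold_locales (rule fls_mult_commute, simp add: central)
qed

lemma fps_const_central: "central_morphism (\<lambda>c. fps_const (\<iota> c))"
proof -
  interpret m: ring_morphism "\<lambda>c. fps_const (\<iota> c)"
    by (rule ring_morphism_comp[OF ring_morphism_fps_const]) unfold_locales
  show ?thesis
    by unfold_locales (rule fps_ext, simp add: central)
qed

lemma left_commute: "x * (\<iota> c * y) = \<iota> c * (x * y)"
  by (metis central mult.assoc)

lemma mult_mult: "\<iota> c * x * (\<iota> d * y) = \<iota> (c * d) * (x * y)"
  by (metis central mult mult.assoc)

text \<open>The value of a power series at a topologically nilpotent central element.\<close>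

definition eval :: "'c fps \<Rightarrow> 'a fps \<Rightarrow> 'a fps" where
  "eval \<xi> f = Abs_fps (\<lambda>n. \<Sum>i\<le>n. \<iota> ((\<xi> ^ i) $ n) * f $ i)"

lemma eval_nth:
  assumes "\<xi> $ 0 = 0" and "n \<le> m"
  shows "eval \<xi> f $ n = (\<Sum>i\<le>m. \<iota> ((\<xi> ^ i) $ n) * f $ i)"
proof -
  have "(\<Sum>i\<le>n. \<iota> ((\<xi> ^ i) $ n) * f $ i) = (\<Sum>i\<le>m. \<iota> ((\<xi> ^ i) $ n) * f $ i)"
    using assms startsby_zero_power_prefix[OF assms(1)] by (intro sum.mono_neutral_left) auto
  then show ?thesis by (simp add: eval_def)
qed

lemma eval_compose: "eval \<xi> f = f oo Abs_fps (\<lambda>n. \<iota> (\<xi> $ n))"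
proof -
  have "Abs_fps (\<lambda>n. \<iota> (\<xi> $ n)) = map_fps \<iota> \<xi>" by (simp add: map_fps_def)
  moreover have "map_fps \<iota> \<xi> ^ i = map_fps \<iota> (\<xi> ^ i)" for i
    using map_fps by (induction i) (simp_all add: ring_morphism_def)
  ultimately show ?thesis
    by (intro ext fps_ext) (simp add: eval_def fps_compose_nth atLeast0AtMost central[of _ "_ $ _"])
qed

lemma eval_mult:
  assumes "\<xi> $ 0 = 0"
  shows "eval \<xi> (f * g) = eval \<xi> f * eval \<xi> g"
proof (rule fps_ext)
  fix n
  have z: "(\<xi> ^ k) $ m = 0" if "m < k" for k m
    using startsby_zero_power_prefix[OF assms] that by blast
  have "(eval \<xi> f * eval \<xi> g) $ n
      = (\<Sum>m\<le>n. (\<Sum>i\<le>n. \<iota> ((\<xi> ^ i) $ m) * f $ i) * (\<Sum>j\<le>n. \<iota> ((\<xi> ^ j) $ (n - m)) * g $ j))"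
    by (auto simp: fps_mult_nth atLeast0AtMost eval_nth[OF assms, of _ n] intro!: sum.cong)
  also have "\<dots> = (\<Sum>m\<le>n. \<Sum>i\<le>n. \<Sum>j\<le>n. \<iota> ((\<xi> ^ i) $ m * (\<xi> ^ j) $ (n - m)) * (f $ i * g $ j))"
    by (simp only: sum_product mult_mult)
  also have "\<dots> = (\<Sum>i\<le>n. \<Sum>m\<le>n. \<Sum>j\<le>n. \<iota> ((\<xi> ^ i) $ m * (\<xi> ^ j) $ (n - m)) * (f $ i * g $ j))"
    by (rule sum.swap)
  also have "\<dots> = (\<Sum>i\<le>n. \<Sum>j\<le>n. \<Sum>m\<le>n. \<iota> ((\<xi> ^ i) $ m * (\<xi> ^ j) $ (n - m)) * (f $ i * g $ j))"
    by (intro sum.cong refl sum.swap)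
  also have "\<dots> = (\<Sum>i\<le>n. \<Sum>j\<le>n. \<iota> ((\<xi> ^ (i + j)) $ n) * (f $ i * g $ j))"
    by (simp add: power_add fps_mult_nth atLeast0AtMost sum sum_distrib_right)
  also have "\<dots> = (\<Sum>(i, j) \<in> {..n} \<times> {..n}. \<iota> ((\<xi> ^ (i + j)) $ n) * (f $ i * g $ j))"
    by (simp add: sum.cartesian_product)
  \<comment> \<open>As \<xi> has no constant term, its power i + j starts in degree i + j at the
    earliest and contributes nothing in degree n when i + j > n.\<close>
  also have "\<dots> = (\<Sum>(i, j) \<in> {(i, j). i + j \<le> n}. \<iota> ((\<xi> ^ (i + j)) $ n) * (f $ i * g $ j))"
  proof (intro sum.mono_neutral_right, goal_cases)
    case 3
    have "\<iota> ((\<xi> ^ (i + j)) $ n) = 0" if "\<not> i + j \<le> n" for i j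
      using z[of n "i + j"] that by simp
    then show ?case by (simp add: split_def)
  qed auto
  also have "\<dots> = (\<Sum>k\<le>n. \<Sum>i\<le>k. \<iota> ((\<xi> ^ (i + (k - i))) $ n) * (f $ i * g $ (k - i)))"
    by (rule sum.triangle_reindex_eq)
  also have "\<dots> = eval \<xi> (f * g) $ n"
    unfolding eval_def fps_mult_nth fps_nth_Abs_fps atLeast0AtMost sum_distrib_left
    by (intro sum.cong refl) simp
  finally show "eval \<xi> (f * g) $ n = (eval \<xi> f * eval \<xi> g) $ n" by simp
qed

lemma eval_const: "eval \<xi> (fps_const x) = fps_const x"
proof (rule fps_ext)
  fix n
  have "eval \<xi> (fps_const x) $ n = (\<Sum>i\<le>n. if i = 0 then \<iota> ((\<xi> ^ i) $ n) * x else 0)"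
    unfolding eval_def fps_nth_Abs_fps by (intro sum.cong) auto
  also have "\<dots> = fps_const x $ n" by (simp add: sum.delta one)
  finally show "eval \<xi> (fps_const x) $ n = fps_const x $ n" .
qed

lemma eval_fps_X: "eval fps_X f = f"
proof (rule fps_ext)
  fix n
  have "eval fps_X f $ n = (\<Sum>i\<le>n. if i = n then f $ i else 0)"
    unfolding eval_def fps_nth_Abs_fps by (intro sum.cong) (auto simp: fps_X_power_nth one)
  then show "eval fps_X f $ n = f $ n" by (simp add: sum.delta)
qed

lemma eval_morphism:
  assumes "\<xi> $ 0 = 0"
  shows "ring_morphism (eval \<xi>)"
proof
  show "eval \<xi> (f + g) = eval \<xi> f + eval \<xi> g" for f g
    by (rule fps_ext) (simp add: eval_def distrib_left sum.distrib)
  show "eval \<xi> 1 = 1"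
    using eval_const[of \<xi> 1] by simp
qed (rule eval_mult[OF assms])

lemma eval_eval:
  assumes "\<xi> $ 0 = 0" "\<eta> $ 0 = 0"
  shows "eval \<eta> (eval \<xi> f) = eval (\<xi> oo \<eta>) f"
proof -
  have pow: "(\<xi> oo \<eta>) ^ i = \<xi> ^ i oo \<eta>" for i
    by (rule fps_compose_power[OF assms(2)])
  show ?thesis
  proof (rule fps_ext)
    fix n
    have "eval \<eta> (eval \<xi> f) $ n = (\<Sum>m\<le>n. \<iota> ((\<eta> ^ m) $ n) * (\<Sum>i\<le>n. \<iota> ((\<xi> ^ i) $ m) * f $ i))"
      by (simp add: eval_def[of \<eta>] eval_nth[OF assms(1), of _ n])
    also have "\<dots> = (\<Sum>i\<le>n. \<Sum>m\<le>n. \<iota> ((\<eta> ^ m) $ n * (\<xi> ^ i) $ m) * f $ i)"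
      by (subst sum.swap) (simp add: sum_distrib_left mult mult.assoc)
    also have "\<dots> = eval (\<xi> oo \<eta>) f $ n"
      by (simp add: eval_def pow fps_compose_nth atLeast0AtMost sum sum_distrib_right mult.commute)
    finally show "eval \<eta> (eval \<xi> f) $ n = eval (\<xi> oo \<eta>) f $ n" .
  qed
qed

lemma eval_map_fps: "\<xi> $ 0 = 0 \<Longrightarrow> eval \<xi> (map_fps \<iota> g) = map_fps \<iota> (g oo \<xi>)"
  by (rule fps_ext) (simp add: eval_def fps_compose_nth atLeast0AtMost sum mult[symmetric] mult.commute)

lemma eval_X:
  assumes "\<xi> $ 0 = 0"
  shows "eval \<xi> fps_X = map_fps \<iota> \<xi>"
proof (rule fps_ext)
  fix n
  have "eval \<xi> fps_X $ n = (\<Sum>i\<le>Suc n. if i = 1 then \<iota> ((\<xi> ^ i) $ n) else 0)"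
    unfolding eval_nth[OF assms le_SucI[OF order_refl]] by (intro sum.cong) auto
  also have "\<dots> = map_fps \<iota> \<xi> $ n" by (simp add: sum.delta)
  finally show "eval \<xi> fps_X $ n = map_fps \<iota> \<xi> $ n" .
qed

end

lemma letters_zero [simp]: "letters 0 = []"
  by (simp add: zero_fword_def)

lemma sum_single_keys: "(\<Sum>w\<in>Poly_Mapping.keys f. Poly_Mapping.single w (Poly_Mapping.lookup f w)) = f"
  by (rule poly_mapping_eqI) (auto simp: lookup_sum lookup_single when_def sum.delta' in_keys_iff)

lemma central_scal: "central_morphism scal"
proof
  fix c d :: complex and x :: "'a free"
  show "scal (c + d) = (scal c + scal d :: 'a free)" by (simp add: scal_def single_add)
  show "scal (c * d) = (scal c * scal d :: 'a free)" by (simp add: scal_def mult_single)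
  show "scal 1 = (1 :: 'a free)" by (simp add: scal_def)
  have "scal c * (\<Sum>w\<in>Poly_Mapping.keys x. Poly_Mapping.single w (Poly_Mapping.lookup x w)) =
      (\<Sum>w\<in>Poly_Mapping.keys x. Poly_Mapping.single w (Poly_Mapping.lookup x w)) * scal c"
    by (simp add: scal_def sum_distrib_left sum_distrib_right mult_single mult.commute)
  then show "scal c * x = x * scal c" by (simp add: sum_single_keys)
qed

interpretation scal: central_morphism scal
  by (rule central_scal)

interpretation scal2: central_morphism "\<lambda>c. fps_const (scal c)"
  by (rule scal.fps_const_central)

definition sc1 :: "complex fls \<Rightarrow> 'g free fls" where
  "sc1 = map_fls scal"

interpretation sc1: central_morphism sc1
  unfolding sc1_def by (rule scal.map_fls_central)

definition sc2 :: "complex fls fls \<Rightarrow> 'g free fls fls" where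
  "sc2 = map_fls (map_fls scal)"

interpretation sc2: central_morphism sc2
  unfolding sc2_def by (rule sc1.map_fls_central[unfolded sc1_def])

section \<open>Left ideals, their lifts to series, and separation by functionals\<close>

locale left_ideal =
  fixes J :: "'a::ring_1 set"
  assumes zero [simp]: "0 \<in> J" and add: "x \<in> J \<Longrightarrow> y \<in> J \<Longrightarrow> x + y \<in> J"
    and mult_left: "x \<in> J \<Longrightarrow> a * x \<in> J"
begin

lemma uminus: "x \<in> J \<Longrightarrow> - x \<in> J"
  using mult_left[of x "- 1"] by simp

lemma diff: "x \<in> J \<Longrightarrow> y \<in> J \<Longrightarrow> x - y \<in> J"
  using add[of x "- y"] uminus by simp

lemma sum: "(\<And>a. a \<in> A \<Longrightarrow> f a \<in> J) \<Longrightarrow> sum f A \<in> J"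
  by (induction A rule: infinite_finite_induct) (simp_all add: add)

lemma lift_fls: "left_ideal {f. \<forall>k. f $$ k \<in> J}"
proof
  fix f g :: "'a fls"
  assume f: "f \<in> {f. \<forall>k. f $$ k \<in> J}"
  then show "g * f \<in> {f. \<forall>k. f $$ k \<in> J}"
    by (auto simp: fls_times_nth(2) intro!: sum mult_left)
  assume "g \<in> {f. \<forall>k. f $$ k \<in> J}"
  with f show "f + g \<in> {f. \<forall>k. f $$ k \<in> J}" by (simp add: add)
qed simp

end

locale two_sided_ideal = left_ideal +
  assumes mult_right: "x \<in> J \<Longrightarrow> x * a \<in> J"
begin

lemma lift_fls_two_sided: "two_sided_ideal {f. \<forall>k. f $$ k \<in> J}"
proof -
  interpret l: left_ideal "{f. \<forall>k. f $$ k \<in> J}" by (rule lift_fls)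
  show ?thesis
    by unfold_locales (auto simp: fls_times_nth(2) intro!: sum mult_right)
qed

end

text \<open>A left ideal is a linear subspace because the scalars act by left multiplication with
  \<iota> c. A basis of J stays independent after adding x, so a linear f can be 0 on the basis and
  1 at x. It respects the scalars only, not the multiplication of the ring.\<close>

lemma subspace_separation:
  fixes \<iota> :: "'c::field \<Rightarrow> 'a::ring_1"
  assumes "central_morphism \<iota>" and "left_ideal J" and "x \<notin> J"
  obtains f where "\<And>y z. f (y + z) = f y + f z" "\<And>c y. f (\<iota> c * y) = c * f y"
    "\<And>y. y \<in> J \<Longrightarrow> f y = (0 :: 'c)" "f x \<noteq> 0"
proof -
  interpret \<iota>: central_morphism \<iota> by fact
  interpret J: left_ideal J by fact
  interpret vs: vector_space "\<lambda>c y. \<iota> c * y"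
    by unfold_locales (simp_all add: \<iota>.add \<iota>.mult \<iota>.one distrib_left distrib_right mult.assoc)
  interpret pair: vector_space_pair "\<lambda>c y. \<iota> c * y" "(*) :: 'c \<Rightarrow> 'c \<Rightarrow> 'c"
    by unfold_locales (simp_all add: algebra_simps)
  have sub: "vs.subspace J"
    unfolding vs.subspace_def using J.add J.mult_left J.zero by blast
  obtain B where B: "B \<subseteq> J" "vs.independent B" "J \<subseteq> vs.span B"
    using vs.maximal_independent_subset[of J] by metis
  have "vs.span B \<subseteq> J"
    using B(1) sub by (rule vs.span_minimal)
  with assms(3) have "vs.independent (insert x B)"
    using B by (intro vs.independent_insertI) auto
  then obtain f where f: "Vector_Spaces.linear (\<lambda>c y. \<iota> c * y) (*) f" "\<forall>y\<in>insert x B. f y = (if y = x then 1 else 0)"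
    using pair.linear_independent_extend[of "insert x B" "\<lambda>y. if y = x then 1 else 0"] by blast
  interpret f: Vector_Spaces.linear "\<lambda>c y. \<iota> c * y" "(*)" f by (rule f(1))
  have fB: "f y = 0" if "y \<in> B" for y
    using that f(2) B(1) assms(3) by (metis insertI2 subsetD)
  have "f y = 0" if "y \<in> vs.span B" for y
    using pair.linear_eq_0_on_span[OF f(1) fB] that by blast
  with B(3) have "\<And>y. y \<in> J \<Longrightarrow> f y = 0" by blast
  then show ?thesis
    using that[of f] f(2) f.add f.scale by (metis insertI1 zero_neq_one)
qed

text \<open>Power series in two variables have u^-1 outside and v^-1 inside; \<open>bi_u\<close>
  puts a series into the outer variable and \<open>fps_const\<close> puts it into the inner one.
  Unlike iterated Laurent series they admit substitution.\<close>

definition bi_u :: "'a::zero fps \<Rightarrow> 'a fps fps" where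
  "bi_u f = map_fps fps_const f"

definition bi_subst :: "complex fps \<Rightarrow> complex fps \<Rightarrow> 'g free fps fps \<Rightarrow> 'g free fps fps" where
  "bi_subst \<xi> \<eta> c = scal2.eval \<xi> (map_fps (scal.eval \<eta>) c)"

lemma bi_subst_morphism:
  assumes "\<xi> $ 0 = 0" "\<eta> $ 0 = 0"
  shows "ring_morphism (bi_subst \<xi> \<eta>)"
  unfolding bi_subst_def[abs_def]
  using scal2.eval_morphism[OF assms(1)] ring_morphism.map_fps[OF scal.eval_morphism[OF assms(2)]]
  by (rule ring_morphism_comp)

lemma scal_eval_0: "scal.eval \<eta> 0 = 0"
  using scal.eval_const[of \<eta> 0] by simp

lemma bi_subst_u: "bi_subst \<xi> \<eta> (bi_u f) = bi_u (scal.eval \<xi> f)"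
proof -
  have "map_fps (scal.eval \<eta>) (bi_u f) = bi_u f"
    by (rule fps_ext) (simp add: bi_u_def scal.eval_const)
  then show ?thesis
    by (intro fps_ext)
      (simp add: bi_subst_def bi_u_def scal2.eval_def scal.eval_def ring_morphism.sum[OF ring_morphism_fps_const])
qed

lemma bi_subst_v: "bi_subst \<xi> \<eta> (fps_const f) = fps_const (scal.eval \<eta> f)"
proof -
  have "map_fps (scal.eval \<eta>) (fps_const f) = fps_const (scal.eval \<eta> f)"
    by (rule fps_ext) (simp add: scal_eval_0)
  then show ?thesis
    by (simp add: bi_subst_def scal2.eval_const)
qed

lemma (in left_ideal) eval_mem:
  assumes "central_morphism \<iota>" and "\<And>k. f $ k \<in> J"
  shows "central_morphism.eval \<iota> \<xi> f $ n \<in> J"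
proof -
  note mem = sum mult_left
  interpret central_morphism \<iota> by fact
  show ?thesis using assms(2) by (auto simp: eval_def intro!: mem)
qed

text \<open>Each coefficient of the result is a finite combination of coefficients of c with scalars
  on the left, so relations survive substitution.\<close>

lemma bi_subst_mem:
  assumes "left_ideal I" "\<And>k l. c $ k $ l \<in> I"
  shows "bi_subst \<xi> \<eta> c $ m $ n \<in> I"
proof -
  interpret left_ideal I by fact
  have "map_fps (scal.eval \<eta>) c $ i $ n \<in> I" for i n
    using assms(2) eval_mem[OF central_scal] by simp
  then show ?thesis
    by (auto simp: bi_subst_def scal2.eval_def fps_sum_nth intro!: sum mult_left)
qed

definition bi_fls :: "'a::zero fps fps \<Rightarrow> 'a fls fls" where
  "bi_fls c = fps_to_fls (map_fps fps_to_fls c)"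

lemma bi_fls_nth: "bi_fls c $$ k $$ l = (if k < 0 \<or> l < 0 then 0 else c $ nat k $ nat l)"
  by (simp add: bi_fls_def)

lemma bi_fls_morphism: "ring_morphism bi_fls"
  unfolding bi_fls_def[abs_def]
  using ring_morphism_fps_to_fls ring_morphism.map_fps[OF ring_morphism_fps_to_fls]
  by (rule ring_morphism_comp)

lemma bi_fls_u: "bi_fls (bi_u f) = at_u f"
  by (intro fls_eqI) (simp add: bi_fls_nth bi_u_def at_u_def)

lemma bi_fls_v: "bi_fls (fps_const f) = at_v f"
  by (intro fls_eqI) (simp add: bi_fls_nth at_v_def)

text \<open>Specialization of both variables to the same one.\<close>

definition bi_diag :: "'a::comm_monoid_add fps fps \<Rightarrow> 'a fps" where
  "bi_diag c = Abs_fps (\<lambda>n. \<Sum>i\<le>n. c $ i $ (n - i))"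

lemma bi_diag_u: "bi_diag (bi_u f) = f"
proof (rule fps_ext)
  fix n
  have "bi_diag (bi_u f) $ n = (\<Sum>i\<le>n. if i = n then f $ n else 0)"
    unfolding bi_diag_def fps_nth_Abs_fps by (intro sum.cong) (auto simp: bi_u_def)
  then show "bi_diag (bi_u f) $ n = f $ n" by (simp add: sum.delta)
qed

lemma bi_diag_v: "bi_diag (fps_const f) = f"
proof (rule fps_ext)
  fix n
  have "bi_diag (fps_const f) $ n = (\<Sum>i\<le>n. if i = 0 then f $ n else 0)"
    unfolding bi_diag_def fps_nth_Abs_fps by (intro sum.cong) auto
  then show "bi_diag (fps_const f) $ n = f $ n" by (simp add: sum.delta)
qed

lemma bi_diag_morphism: "ring_morphism (bi_diag :: 'a::ring_1 fps fps \<Rightarrow> 'a fps)"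
proof
  show "bi_diag (f + g) = bi_diag f + bi_diag g" for f g :: "'a fps fps"
    by (rule fps_ext) (simp add: bi_diag_def sum.distrib)
  show "bi_diag 1 = (1 :: 'a fps)"
    using bi_diag_v[of 1] by simp
  show "bi_diag (f * g) = bi_diag f * bi_diag g" for f g :: "'a fps fps"
  proof (rule fps_ext)
    fix n
    have "bi_diag (f * g) $ n = (\<Sum>k\<le>n. \<Sum>i\<le>k. \<Sum>p\<le>n - k. f $ i $ p * g $ (k - i) $ (n - k - p))"
      by (simp add: bi_diag_def fps_mult_nth fps_sum_nth atLeast0AtMost)
    also have "\<dots> = (\<Sum>k\<le>n. \<Sum>(i, p) \<in> {..k} \<times> {..n - k}. f $ i $ p * g $ (k - i) $ (n - k - p))"
      by (intro sum.cong refl sum.cartesian_product)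
    also have "\<dots> = (\<Sum>(k, i, p) \<in> (SIGMA k:{..n}. {..k} \<times> {..n - k}). f $ i $ p * g $ (k - i) $ (n - k - p))"
      by (rule sum.Sigma) auto
    also have "\<dots> = (\<Sum>(m, i, j) \<in> (SIGMA m:{..n}. {..m} \<times> {..n - m}). f $ i $ (m - i) * g $ j $ (n - m - j))"
    \<comment> \<open>m = i + p is the total degree of the factor from f, and j = k - i is the outer
      degree of the factor from g.\<close>
    proof (rule sum.reindex_bij_witness[of _ "\<lambda>(m, i, j). (i + j, i, m - i)" "\<lambda>(k, i, p). (i + p, i, k - i)"], goal_cases)
      case (5 a)
      obtain k i p where a: "a = (k, i, p)" by (cases a)
      with 5 have "i \<le> k" by auto
      then have "i + p + (k - i) = k + p" by simp
      then show ?case by (simp add: a add.commute)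
    qed auto
    also have "\<dots> = (\<Sum>m\<le>n. \<Sum>(i, j) \<in> {..m} \<times> {..n - m}. f $ i $ (m - i) * g $ j $ (n - m - j))"
      by (rule sum.Sigma[symmetric]) auto
    also have "\<dots> = (\<Sum>m\<le>n. bi_diag f $ m * bi_diag g $ (n - m))"
      by (intro sum.cong refl) (simp only: bi_diag_def fps_nth_Abs_fps sum_product sum.cartesian_product)
    finally show "bi_diag (f * g) $ n = (bi_diag f * bi_diag g) $ n"
      by (simp only: fps_mult_nth atLeast0AtMost)
  qed
qed

section \<open>From the RTT relation to the reflection equation\<close>

lemma finite_Idx: "finite (Idx N)"
proof (rule finite_subset)
  show "Idx N \<subseteq> {- rank N..rank N}" by (auto simp: Idx_def)
qed simp

lemma mult2_assoc: "mult2 N (mult2 N A B) C = mult2 N A (mult2 N B C)"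
  unfolding mult2_def
  by (intro ext) (simp add: sum_distrib_left sum_distrib_right mult.assoc, rule sum.swap)

lemma sum_pairs:
  "(\<Sum>y\<in>Idx N \<times> Idx N. f y) = (\<Sum>p\<in>Idx N. \<Sum>q\<in>Idx N. f (p, q))"
  by (simp add: sum.cartesian_product)

lemma sum_delta_mult:
  fixes f :: "'i \<Rightarrow> 'b::semiring_0"
  assumes "finite S" "a \<in> S"
  shows "(\<Sum>p\<in>S. (if p = a then g p else 0) * f p) = g a * f a"
    and "(\<Sum>p\<in>S. (if a = p then g p else 0) * f p) = g a * f a"
    and "(\<Sum>p\<in>S. f p * (if p = a then g p else 0)) = f a * g a"
    and "(\<Sum>p\<in>S. f p * (if a = p then g p else 0)) = f a * g a"
proof -
  have "(\<Sum>p\<in>S. (if p = a then g p else 0) * f p) = (\<Sum>p\<in>S. if p = a then g p * f p else 0)"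
    "(\<Sum>p\<in>S. (if a = p then g p else 0) * f p) = (\<Sum>p\<in>S. if p = a then g p * f p else 0)"
    "(\<Sum>p\<in>S. f p * (if p = a then g p else 0)) = (\<Sum>p\<in>S. if p = a then f p * g p else 0)"
    "(\<Sum>p\<in>S. f p * (if a = p then g p else 0)) = (\<Sum>p\<in>S. if p = a then f p * g p else 0)"
    by (auto intro!: sum.cong)
  with assms show "(\<Sum>p\<in>S. (if p = a then g p else 0) * f p) = g a * f a"
    "(\<Sum>p\<in>S. (if a = p then g p else 0) * f p) = g a * f a"
    "(\<Sum>p\<in>S. f p * (if p = a then g p else 0)) = f a * g a"
    "(\<Sum>p\<in>S. f p * (if a = p then g p else 0)) = f a * g a"
    by (simp_all add: sum.delta)
qed

lemma mult2_in_first: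
  fixes X :: "'b::semiring_0 mat1"
  assumes "i \<in> Idx N" "k \<in> Idx N"
  shows "mult2 N (in_first X) Z (i, k) z = (\<Sum>p\<in>Idx N. X i p * Z (p, k) z)"
    and "mult2 N Z (in_first X) z (i, k) = (\<Sum>p\<in>Idx N. Z z (p, k) * X p i)"
    and "mult2 N (in_second X) Z (i, k) z = (\<Sum>p\<in>Idx N. X k p * Z (i, p) z)"
    and "mult2 N Z (in_second X) z (i, k) = (\<Sum>p\<in>Idx N. Z z (i, p) * X p k)"
  using assms
  by (simp_all add: mult2_def sum_pairs in_first_def in_second_def sum_delta_mult finite_Idx)
    (simp_all add: sum.swap[of _ "Idx N" "Idx N"] sum_delta_mult finite_Idx)

lemma mult2_first_second:
  fixes X Y :: "'b::semiring_0 mat1"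
  assumes "i \<in> Idx N" "k \<in> Idx N" "j \<in> Idx N" "l \<in> Idx N"
  shows "mult2 N (in_first X) (in_second Y) (i, k) (j, l) = X i j * Y k l"
    and "mult2 N (in_second Y) (in_first X) (i, k) (j, l) = Y k l * X i j"
  using assms by (simp_all add: mult2_in_first)
    (simp_all add: in_first_def in_second_def sum_delta_mult finite_Idx)

section \<open>R-matrices and RTT relations with entries in a noncommutative ring\<close>

locale R_ring = sc: central_morphism sc + osp_index "Idx N" \<theta> \<epsilon> \<kappa>
  for sc :: "'k::field \<Rightarrow> 'b::ring_1" and N and \<theta> :: "int \<Rightarrow> 'k" and \<epsilon> \<kappa> :: 'k
begin

definition R :: "'k \<Rightarrow> 'b mat2" where
  "R z = (\<lambda>(i, k) (j, l). sc ((if i = j \<and> k = l then 1 else 0) - (if i = l \<and> k = j then 1 / z else 0)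
     + (if k = - i \<and> l = - j then \<theta> i * \<theta> j / (z - \<kappa>) else 0)))"

lemma sc_mult_left: "sc a * (sc b * x) = sc (a * b) * x"
  by (simp only: sc.mult mult.assoc)

lemma R_left:
  assumes "i \<in> Idx N" "k \<in> Idx N"
  shows "mult2 N (R z) Y (i, k) c = Y (i, k) c - sc (1 / z) * Y (k, i) c
    + (if k = - i then sc (\<theta> i / (z - \<kappa>)) * (\<Sum>p\<in>Idx N. sc (\<theta> p) * Y (p, - p) c) else 0)"
proof -
  have "mult2 N (R z) Y (i, k) c = (\<Sum>p\<in>Idx N. \<Sum>q\<in>Idx N.
      (if q = k then if p = i then Y (p, q) c else 0 else 0)
      - (if q = i then if p = k then sc (1 / z) * Y (p, q) c else 0 else 0)
      + (if q = - p then if k = - i then sc (\<theta> i * \<theta> p / (z - \<kappa>)) * Y (p, q) c else 0 else 0))"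
    unfolding mult2_def sum_pairs R_def
    by (intro sum.cong refl) (auto simp: sc.add sc.diff sc.one algebra_simps)
  also have "\<dots> = Y (i, k) c - sc (1 / z) * Y (k, i) c
      + (if k = - i then \<Sum>p\<in>Idx N. sc (\<theta> i * \<theta> p / (z - \<kappa>)) * Y (p, - p) c else 0)"
    using assms by (simp add: sum.distrib sum_subtractf sum.delta finite_Idx)
  also have "(\<Sum>p\<in>Idx N. sc (\<theta> i * \<theta> p / (z - \<kappa>)) * Y (p, - p) c)
      = sc (\<theta> i / (z - \<kappa>)) * (\<Sum>p\<in>Idx N. sc (\<theta> p) * Y (p, - p) c)"
    by (simp add: sum_distrib_left sc_mult_left)
  finally show ?thesis .
qed

lemma R_central: "R z x y * w = w * R z x y"
  by (cases x; cases y; simp only: R_def split_conv; rule sc.central)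

lemma R_sym: "R z x y = R z y x"
proof (cases x; cases y)
  fix i k j l assume xy: "x = (i, k)" "y = (j, l)"
  have "j = i \<and> l = k \<longleftrightarrow> i = j \<and> k = l" "j = k \<and> l = i \<longleftrightarrow> i = l \<and> k = j"
    "l = - j \<and> k = - i \<longleftrightarrow> k = - i \<and> l = - j"
    by auto
  then show ?thesis
    by (simp only: xy R_def split_conv mult.commute)
qed

text \<open>R is a symmetric matrix with central entries, so multiplying by it from the right is
  multiplying the transposed matrix from the left.\<close>

lemma R_right:
  assumes "j \<in> Idx N" "l \<in> Idx N"
  shows "mult2 N Y (R z) c (j, l) = Y c (j, l) - sc (1 / z) * Y c (l, j)
    + (if l = - j then sc (\<theta> j / (z - \<kappa>)) * (\<Sum>p\<in>Idx N. sc (\<theta> p) * Y c (p, - p)) else 0)"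
proof -
  have "mult2 N Y (R z) c (j, l) = mult2 N (R z) (\<lambda>x y. Y y x) (j, l) c"
    unfolding mult2_def by (intro sum.cong refl) (metis R_central R_sym)
  then show ?thesis using assms by (simp add: R_left)
qed

text \<open>Between the two factors P contracts their adjacent indices, while Q carries -k into the
  first factor and -j into the second. These are the terms of \<open>middle\<close>.\<close>

lemma R_middle:
  assumes "i \<in> Idx N" "k \<in> Idx N" "j \<in> Idx N" "l \<in> Idx N"
  shows "mult2 N (mult2 N (in_first X) (R z)) (in_second Y) (i, k) (j, l) =
      X i j * Y k l - (if k = j then sc (1 / z) * (\<Sum>p\<in>Idx N. X i p * Y p l) else 0)
      + sc (\<theta> (- k) * \<theta> j / (z - \<kappa>)) * (X i (- k) * Y (- j) l)" (is ?A)
    and "mult2 N (mult2 N (in_second Y) (R z)) (in_first X) (i, k) (j, l) =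
      Y k l * X i j - (if i = l then sc (1 / z) * (\<Sum>p\<in>Idx N. Y k p * X p j) else 0)
      + sc (\<theta> (- i) * \<theta> l / (z - \<kappa>)) * (Y k (- i) * X (- l) j)" (is ?B)
proof -
  have 1: "mult2 N (R z) (in_second Y) (p, k) (j, l) = (if p = j then Y k l else 0)
      - (if k = j then sc (1 / z) * Y p l else 0) + (if p = - k then sc (\<theta> (- k) * \<theta> j / (z - \<kappa>)) * Y (- j) l else 0)"
    if "p \<in> Idx N" for p
  proof -
    have "(\<Sum>q\<in>Idx N. sc (\<theta> q) * in_second Y (q, - q) (j, l)) = (\<Sum>q\<in>Idx N. if q = j then sc (\<theta> j) * Y (- j) l else 0)"
      by (intro sum.cong) (auto simp: in_second_def)
    then show ?thesis
      using that assms
      by (auto simp: R_left) (auto simp: in_second_def sum.delta finite_Idx sc_mult_left)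
  qed
  have 2: "mult2 N (R z) (in_first X) (i, q) (j, l) = (if q = l then X i j else 0)
      - (if i = l then sc (1 / z) * X q j else 0) + (if q = - i then sc (\<theta> (- i) * \<theta> l / (z - \<kappa>)) * X (- l) j else 0)"
    if "q \<in> Idx N" for q
  proof -
    have "(\<Sum>q\<in>Idx N. sc (\<theta> q) * in_first X (q, - q) (j, l)) = (\<Sum>q\<in>Idx N. if q = - l then sc (\<theta> (- l)) * X (- l) j else 0)"
      by (intro sum.cong) (auto simp: in_first_def)
    then show ?thesis
      using that assms theta_neg[of i] theta_neg[of l]
      by (auto simp: R_left) (auto simp: in_first_def sum.delta finite_Idx sc_mult_left mult_ac eps_sq_left)
  qed
  have "mult2 N (in_first X) (mult2 N (R z) (in_second Y)) (i, k) (j, l)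
      = (\<Sum>p\<in>Idx N. (if p = j then X i j * Y k l else 0) - (if k = j then sc (1 / z) * (X i p * Y p l) else 0)
         + (if p = - k then sc (\<theta> (- k) * \<theta> j / (z - \<kappa>)) * (X i (- k) * Y (- j) l) else 0))"
    using assms unfolding mult2_in_first(1)[OF assms(1,2)]
    by (intro sum.cong refl) (auto simp: 1 algebra_simps sc.left_commute)
  then show ?A
    using assms by (simp add: mult2_assoc sum.distrib sum_subtractf sum.delta finite_Idx sum_distrib_left)
  have "mult2 N (in_second Y) (mult2 N (R z) (in_first X)) (i, k) (j, l)
      = (\<Sum>q\<in>Idx N. (if q = l then Y k l * X i j else 0) - (if i = l then sc (1 / z) * (Y k q * X q j) else 0)
         + (if q = - i then sc (\<theta> (- i) * \<theta> l / (z - \<kappa>)) * (Y k (- i) * X (- l) j) else 0))"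
    using assms unfolding mult2_in_first(3)[OF assms(1,2)]
    by (intro sum.cong refl) (auto simp: 2 algebra_simps sc.left_commute)
  then show ?B
    using assms by (simp add: mult2_assoc sum.distrib sum_subtractf sum.delta finite_Idx sum_distrib_left)
qed

text \<open>In this entrywise form every scalar coefficient is explicit, as is needed for clearing
  denominators; \<open>rtt_iff\<close> ties it to the matrix relation.\<close>

definition rtt :: "'b set \<Rightarrow> 'k \<Rightarrow> 'b mat1 \<Rightarrow> 'b mat1 \<Rightarrow> bool" where
  "rtt J a T T' \<longleftrightarrow> (\<forall>i\<in>Idx N. \<forall>k\<in>Idx N. \<forall>j\<in>Idx N. \<forall>l\<in>Idx N.
     T i j * T' k l - T' k l * T i j - sc (1 / a) * (T k j * T' i l - T' k j * T i l)
     + ((if k = - i then sc (\<theta> i / (a - \<kappa>)) * (\<Sum>p\<in>Idx N. sc (\<theta> p) * (T p j * T' (- p) l)) else 0)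
       - (if l = - j then sc (\<theta> j / (a - \<kappa>)) * (\<Sum>p\<in>Idx N. sc (\<theta> p) * (T' k (- p) * T i p)) else 0)) \<in> J)"

definition meq :: "'b set \<Rightarrow> 'b mat2 \<Rightarrow> 'b mat2 \<Rightarrow> bool" where
  "meq J X Y \<longleftrightarrow> (\<forall>x\<in>Idx N \<times> Idx N. \<forall>y\<in>Idx N \<times> Idx N. X x y - Y x y \<in> J)"

abbreviation mm :: "'b mat2 \<Rightarrow> 'b mat2 \<Rightarrow> 'b mat2" (infixr "\<bullet>" 70) where
  "X \<bullet> Y \<equiv> mult2 N X Y"

lemma rtt_iff: "rtt J a T T' \<longleftrightarrow>
    meq J (R a \<bullet> in_first T \<bullet> in_second T') (in_second T' \<bullet> in_first T \<bullet> R a)"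
proof -
  have "(R a \<bullet> in_first T \<bullet> in_second T') (i, k) (j, l) - (in_second T' \<bullet> in_first T \<bullet> R a) (i, k) (j, l)
    = T i j * T' k l - T' k l * T i j - sc (1 / a) * (T k j * T' i l - T' k j * T i l)
     + ((if k = - i then sc (\<theta> i / (a - \<kappa>)) * (\<Sum>p\<in>Idx N. sc (\<theta> p) * (T p j * T' (- p) l)) else 0)
       - (if l = - j then sc (\<theta> j / (a - \<kappa>)) * (\<Sum>p\<in>Idx N. sc (\<theta> p) * (T' k (- p) * T i p)) else 0))"
    if "i \<in> Idx N" "k \<in> Idx N" "j \<in> Idx N" "l \<in> Idx N" for i k j l
    using that
    by (simp add: R_left mult2_assoc[symmetric, of _ _ _ "R a"] R_right mult2_first_second right_diff_distrib
        cong: sum.cong)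
  then show ?thesis by (simp add: rtt_def meq_def)
qed

definition tr :: "'b mat1 \<Rightarrow> 'b mat1" where
  "tr T i j = sc (\<theta> i * \<theta> j) * T (- j) (- i)"

text \<open>Transposing the first tensor factor exchanges P and Q, hence turns R(\<kappa> - z) into
  R(z). The RTT relation at \<kappa> - z thereby becomes one with R(z) in the middle, the form that
  occurs between the two factors of the reflection equation.\<close>

lemma transposed_first:
  assumes J: "left_ideal J" and rtt: "rtt J (\<kappa> - z) t T"
  shows "meq J (in_first (tr t) \<bullet> R z \<bullet> in_second T) (in_second T \<bullet> R z \<bullet> in_first (tr t))"
  unfolding meq_def
proof (clarify, unfold mult2_assoc[symmetric])
  fix i k j l assume I: "i \<in> Idx N" "k \<in> Idx N" "j \<in> Idx N" "l \<in> Idx N"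
  define s1 where "s1 = (\<Sum>p\<in>Idx N. sc (\<theta> p) * (t p (- i) * T (- p) l))"
  define s2 where "s2 = (\<Sum>p\<in>Idx N. sc (\<theta> p) * (T k (- p) * t (- j) p))"
  define x1 y1 x2 y2 where "x1 = t (- j) (- i) * T k l" and "y1 = T k l * t (- j) (- i)"
    and "x2 = t k (- i) * T (- j) l" and "y2 = T k (- i) * t (- j) l"
  have s1: "(\<Sum>p\<in>Idx N. tr t i p * T p l) = sc (\<theta> i * \<epsilon>) * s1"
    unfolding s1_def sum_neg[symmetric, of "\<lambda>p. tr t i p * T p l"] sum_distrib_left
    by (intro sum.cong refl) (simp add: tr_def theta_neg sc_mult_left mult.assoc)
  have s2: "(\<Sum>p\<in>Idx N. T k p * tr t p j) = sc (\<theta> j * \<epsilon>) * s2"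
    unfolding s2_def sum_neg[symmetric, of "\<lambda>p. T k p * tr t p j"] sum_distrib_left
    by (intro sum.cong refl) (simp add: tr_def theta_neg sc_mult_left sc.left_commute[of "T _ _"] mult_ac)
  have "x1 - y1 - sc (1 / (\<kappa> - z)) * (x2 - y2) + ((if k = j then sc (\<theta> (- j) / (- z)) * s1 else 0)
      - (if i = l then sc (\<theta> (- i) / (- z)) * s2 else 0)) \<in> J" (is "?r \<in> J")
  proof -
    \<comment> \<open>At the chosen indices the deltas of P and Q terms change places, and so do the
      poles, since (\<kappa> - z) - \<kappa> = -z.\<close>
    have e: "l = - (- i) \<longleftrightarrow> i = l" "k = - (- j) \<longleftrightarrow> k = j" "\<kappa> - z - \<kappa> = - z" by auto
    then show ?thesis
      using rtt[unfolded rtt_def, rule_format, of "- j" k "- i" l] I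
      by (simp only: s1_def s2_def x1_def y1_def x2_def y2_def neg_I e)
  qed
  \<comment> \<open>The factor \<theta> i * \<theta> j turns the entry of t at (-j, -i) into the
    entry of \<open>tr t\<close> at (i, j).\<close>
  then have "sc (\<theta> i * \<theta> j) * ?r \<in> J" by (rule left_ideal.mult_left[OF J])
  also have "sc (\<theta> i * \<theta> j) * ?r =
    sc (\<theta> i * \<theta> j) * x1 - (if k = j then sc (1 / z) * (sc (\<theta> i * \<epsilon>) * s1) else 0)
      + sc (\<theta> (- k) * \<theta> j / (z - \<kappa>)) * (sc (\<theta> i * \<theta> (- k)) * x2)
    - (sc (\<theta> i * \<theta> j) * y1 - (if i = l then sc (1 / z) * (sc (\<theta> j * \<epsilon>) * s2) else 0)
      + sc (\<theta> (- i) * \<theta> l / (z - \<kappa>)) * (sc (\<theta> (- l) * \<theta> j) * y2))"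
  proof -
    have th: "\<theta> i * \<theta> j * (1 / (\<kappa> - z)) = - (\<theta> (- k) * \<theta> j / (z - \<kappa>) * (\<theta> i * \<theta> (- k)))"
      "\<theta> i * \<theta> j * (1 / (\<kappa> - z)) = - (\<theta> (- i) * \<theta> l / (z - \<kappa>) * (\<theta> (- l) * \<theta> j))"
    proof -
      have d: "1 / (\<kappa> - z) = - inverse (z - \<kappa>)" by (metis inverse_eq_divide inverse_minus_eq minus_diff_eq)
      have tk: "\<theta> (- k) * \<theta> (- k) = 1" and tl: "\<theta> l * \<theta> l = 1"
        using I theta_sq[of "- k"] theta_sq[of l] by simp_all
      have tn: "\<theta> (- i) = \<epsilon> * \<theta> i" "\<theta> (- l) = \<epsilon> * \<theta> l" using I theta_neg by auto
      have h1: "x * y * (- w) = - (t * y * w * (x * t))" if "t * t = 1" for x y w t :: 'k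
      proof -
        have "t * y * w * (x * t) = t * t * (x * y * w)" by (simp only: mult_ac)
        then show ?thesis by (simp only: that) simp
      qed
      have h2: "x * y * (- w) = - (e * x * t * w * (e * t * y))" if "t * t = 1" "e * e = 1" for x y w t e :: 'k
      proof -
        have "e * x * t * w * (e * t * y) = (t * t) * (e * e) * (x * y * w)" by (simp only: mult_ac)
        then show ?thesis by (simp only: that) simp
      qed
      show "\<theta> i * \<theta> j * (1 / (\<kappa> - z)) = - (\<theta> (- k) * \<theta> j / (z - \<kappa>) * (\<theta> i * \<theta> (- k)))"
        unfolding d divide_inverse[of _ "z - \<kappa>"] by (rule h1[OF tk])
      show "\<theta> i * \<theta> j * (1 / (\<kappa> - z)) = - (\<theta> (- i) * \<theta> l / (z - \<kappa>) * (\<theta> (- l) * \<theta> j))"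
        unfolding d divide_inverse[of _ "z - \<kappa>"] tn by (rule h2[OF tl eps_sq])
    qed
    have th': "k = j \<Longrightarrow> \<theta> i * \<theta> j * (\<theta> (- j) / (- z)) = - (1 / z * (\<theta> i * \<epsilon>))"
      "i = l \<Longrightarrow> \<theta> i * \<theta> j * (\<theta> (- i) / (- z)) = - (1 / z * (\<theta> j * \<epsilon>))"
      using I theta_neg[of j] theta_neg[of i] theta_sq_left[of j] theta_sq_left[of i] by (simp_all add: mult_ac)
    have e12: "sc (\<theta> i * \<theta> j) * (sc (1 / (\<kappa> - z)) * x2) = - (sc (\<theta> (- k) * \<theta> j / (z - \<kappa>)) * (sc (\<theta> i * \<theta> (- k)) * x2))"
      "sc (\<theta> i * \<theta> j) * (sc (1 / (\<kappa> - z)) * y2) = - (sc (\<theta> (- i) * \<theta> l / (z - \<kappa>)) * (sc (\<theta> (- l) * \<theta> j) * y2))"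
      unfolding sc_mult_left by (subst th(1), simp add: sc.uminus) (subst th(2), simp add: sc.uminus)
    have "k = j \<Longrightarrow> sc (\<theta> i * \<theta> j) * (sc (\<theta> (- j) / (- z)) * s1) = - (sc (1 / z) * (sc (\<theta> i * \<epsilon>) * s1))"
      "i = l \<Longrightarrow> sc (\<theta> i * \<theta> j) * (sc (\<theta> (- i) / (- z)) * s2) = - (sc (1 / z) * (sc (\<theta> j * \<epsilon>) * s2))"
      unfolding sc_mult_left by (subst th'(1), assumption, simp add: sc.uminus) (subst th'(2), assumption, simp add: sc.uminus)
    then have e34: "sc (\<theta> i * \<theta> j) * (if k = j then sc (\<theta> (- j) / (- z)) * s1 else 0)
        = - (if k = j then sc (1 / z) * (sc (\<theta> i * \<epsilon>) * s1) else 0)"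
      "sc (\<theta> i * \<theta> j) * (if i = l then sc (\<theta> (- i) / (- z)) * s2 else 0)
        = - (if i = l then sc (1 / z) * (sc (\<theta> j * \<epsilon>) * s2) else 0)"
      by (simp_all only: if_distrib[of "\<lambda>x. sc (\<theta> i * \<theta> j) * x"] if_distrib[of uminus] mult_zero_right minus_zero cong: if_cong)
    show ?thesis
      unfolding right_diff_distrib distrib_left e12 e34 by simp
  qed
  also have "\<dots> = mult2 N (mult2 N (in_first (tr t)) (R z)) (in_second T) (i, k) (j, l)
      - mult2 N (mult2 N (in_second T) (R z)) (in_first (tr t)) (i, k) (j, l)"
    unfolding R_middle[OF I] s1 s2
    by (simp add: tr_def x1_def x2_def y1_def y2_def mult.assoc sc.left_commute[of "T _ _"])
  finally show "mult2 N (mult2 N (in_first (tr t)) (R z)) (in_second T) (i, k) (j, l)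
      - mult2 N (mult2 N (in_second T) (R z)) (in_first (tr t)) (i, k) (j, l) \<in> J" .
qed

text \<open>Conjugation by the flip: in entries, i is exchanged with k and j with l, and the two
  sides change places.\<close>

lemma transposed_second:
  assumes J: "left_ideal J" and rtt: "rtt J (\<kappa> - z) t T"
  shows "meq J (in_first T \<bullet> R z \<bullet> in_second (tr t)) (in_second (tr t) \<bullet> R z \<bullet> in_first T)"
  unfolding meq_def
proof (clarify, unfold mult2_assoc[symmetric])
  fix i k j l assume I: "i \<in> Idx N" "k \<in> Idx N" "j \<in> Idx N" "l \<in> Idx N"
  have "mult2 N (mult2 N (in_first (tr t)) (R z)) (in_second T) (k, i) (l, j)
      - mult2 N (mult2 N (in_second T) (R z)) (in_first (tr t)) (k, i) (l, j) \<in> J"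
    using transposed_first[OF assms] I by (simp add: meq_def mult2_assoc)
  then have "- (mult2 N (mult2 N (in_first (tr t)) (R z)) (in_second T) (k, i) (l, j)
      - mult2 N (mult2 N (in_second T) (R z)) (in_first (tr t)) (k, i) (l, j)) \<in> J"
    by (rule left_ideal.uminus[OF J])
  then show "mult2 N (mult2 N (in_first T) (R z)) (in_second (tr t)) (i, k) (j, l)
      - mult2 N (mult2 N (in_second (tr t)) (R z)) (in_first T) (i, k) (j, l) \<in> J"
    using I by (simp only: R_middle minus_diff_eq eq_commute[of k] eq_commute[of i])
qed

text \<open>R is fixed by transposing both tensor factors, and the transposition moves it to the
  other side of the product. The flip then restores the shape of the relation, with the two series
  exchanged.\<close>

lemma transposed_both:
  assumes J: "left_ideal J" and rtt: "rtt J a t' t"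
  shows "rtt J a (tr t) (tr t')"
  unfolding rtt_def
proof (intro ballI)
  fix i k j l assume I: "i \<in> Idx N" "k \<in> Idx N" "j \<in> Idx N" "l \<in> Idx N"
  define s1 where "s1 = (\<Sum>p\<in>Idx N. sc (\<theta> p) * (t' p (- k) * t (- p) (- i)))"
  define s2 where "s2 = (\<Sum>p\<in>Idx N. sc (\<theta> p) * (t (- j) (- p) * t' (- l) p))"
  define c where "c = \<theta> i * \<theta> j * \<theta> k * \<theta> l"
  define x1 y1 x2 y2 where "x1 = t' (- l) (- k) * t (- j) (- i)" and "y1 = t (- j) (- i) * t' (- l) (- k)"
    and "x2 = t' (- j) (- k) * t (- l) (- i)" and "y2 = t (- j) (- k) * t' (- l) (- i)"
  have tt: "tr t p q * tr t' r s = sc (\<theta> p * \<theta> q * \<theta> r * \<theta> s) * (t (- q) (- p) * t' (- s) (- r))"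
    "tr t' r s * tr t p q = sc (\<theta> p * \<theta> q * \<theta> r * \<theta> s) * (t' (- s) (- r) * t (- q) (- p))" for p q r s
    by (simp_all add: tr_def sc.mult_mult) (simp_all only: mult_ac)
  have s1: "(\<Sum>p\<in>Idx N. sc (\<theta> p) * (tr t' k (- p) * tr t i p)) = sc (\<theta> i * \<theta> k * \<epsilon>) * s1"
  proof -
    have "(\<Sum>p\<in>Idx N. sc (\<theta> p) * (tr t' k (- p) * tr t i p)) = sc (\<theta> i * \<theta> k) * (\<Sum>p\<in>Idx N. sc (\<theta> (- p)) * (t' p (- k) * t (- p) (- i)))"
      unfolding tt sum_distrib_left sc_mult_left
    proof (intro sum.cong refl)
      fix p assume p: "p \<in> Idx N"
      have "\<theta> p * (\<theta> i * \<theta> p * \<theta> k * \<theta> (- p)) = (\<theta> p * \<theta> p) * (\<theta> i * \<theta> k * \<theta> (- p))" by (simp only: mult_ac)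
      also have "\<dots> = \<theta> i * \<theta> k * \<theta> (- p)" using theta_sq[OF p] by simp
      finally show "sc (\<theta> p * (\<theta> i * \<theta> p * \<theta> k * \<theta> (- p))) * (t' (- (- p)) (- k) * t (- p) (- i))
        = sc (\<theta> i * \<theta> k * \<theta> (- p)) * (t' p (- k) * t (- p) (- i))" by (simp only: minus_minus)
    qed
    then show ?thesis by (simp add: s1_def theta_neg sum_distrib_left sc_mult_left mult_ac cong: sum.cong)
  qed
  have s2: "(\<Sum>p\<in>Idx N. sc (\<theta> p) * (tr t p j * tr t' (- p) l)) = sc (\<theta> j * \<theta> l * \<epsilon>) * s2"
    unfolding tt s2_def sum_distrib_left sc_mult_left
  proof (intro sum.cong refl)
    fix p assume p: "p \<in> Idx N"
    have "\<theta> p * (\<theta> p * \<theta> j * \<theta> (- p) * \<theta> l) = (\<theta> p * \<theta> p) * (\<theta> j * \<theta> l * \<theta> (- p))" by (simp only: mult_ac)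
    also have "\<dots> = \<theta> j * \<theta> l * \<epsilon> * \<theta> p" using theta_sq[OF p] theta_neg[OF p] by simp
    finally show "sc (\<theta> p * (\<theta> p * \<theta> j * \<theta> (- p) * \<theta> l)) * (t (- j) (- p) * t' (- l) (- (- p)))
      = sc (\<theta> j * \<theta> l * \<epsilon> * \<theta> p) * (t (- j) (- p) * t' (- l) p)" by (simp only: minus_minus)
  qed
  have "x1 - y1 - sc (1 / a) * (x2 - y2) + ((if l = - j then sc (\<theta> (- l) / (a - \<kappa>)) * s1 else 0)
      - (if k = - i then sc (\<theta> (- k) / (a - \<kappa>)) * s2 else 0)) \<in> J" (is "?r \<in> J")
  proof -
    have e: "- j = - (- l) \<longleftrightarrow> l = - j" "- i = - (- k) \<longleftrightarrow> k = - i" by auto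
    show ?thesis
      using rtt[unfolded rtt_def, rule_format, of "- l" "- j" "- k" "- i"] I
      by (simp only: s1_def s2_def x1_def y1_def x2_def y2_def neg_I e)
  qed
  then have "- (sc c * ?r) \<in> J" by (intro left_ideal.uminus[OF J] left_ideal.mult_left[OF J])
  also have "- (sc c * ?r) = sc c * y1 - sc c * x1 - sc (1 / a) * (sc c * y2 - sc c * x2)
      + ((if k = - i then sc (\<theta> i / (a - \<kappa>)) * (sc (\<theta> j * \<theta> l * \<epsilon>) * s2) else 0)
       - (if l = - j then sc (\<theta> j / (a - \<kappa>)) * (sc (\<theta> i * \<theta> k * \<epsilon>) * s1) else 0))"
  proof -
    have f: "l = - j \<Longrightarrow> c * (\<theta> (- l) / (a - \<kappa>)) = \<theta> j / (a - \<kappa>) * (\<theta> i * \<theta> k * \<epsilon>)"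
      "k = - i \<Longrightarrow> c * (\<theta> (- k) / (a - \<kappa>)) = \<theta> i / (a - \<kappa>) * (\<theta> j * \<theta> l * \<epsilon>)"
      using I theta_neg[of j] theta_sq_left[of j] theta_neg[of i] theta_sq_left[of i] by (simp_all add: c_def mult_ac)
    have "l = - j \<Longrightarrow> sc c * (sc (\<theta> (- l) / (a - \<kappa>)) * s1) = sc (\<theta> j / (a - \<kappa>)) * (sc (\<theta> i * \<theta> k * \<epsilon>) * s1)"
      "k = - i \<Longrightarrow> sc c * (sc (\<theta> (- k) / (a - \<kappa>)) * s2) = sc (\<theta> i / (a - \<kappa>)) * (sc (\<theta> j * \<theta> l * \<epsilon>) * s2)"
      unfolding sc_mult_left by (subst f(1), assumption, rule refl) (subst f(2), assumption, rule refl)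
    then have e: "sc c * (if l = - j then sc (\<theta> (- l) / (a - \<kappa>)) * s1 else 0)
        = (if l = - j then sc (\<theta> j / (a - \<kappa>)) * (sc (\<theta> i * \<theta> k * \<epsilon>) * s1) else 0)"
      "sc c * (if k = - i then sc (\<theta> (- k) / (a - \<kappa>)) * s2 else 0)
        = (if k = - i then sc (\<theta> i / (a - \<kappa>)) * (sc (\<theta> j * \<theta> l * \<epsilon>) * s2) else 0)"
      by (simp_all only: if_distrib[of "\<lambda>x. sc c * x"] mult_zero_right cong: if_cong)
    show ?thesis
      unfolding right_diff_distrib distrib_left e sc_mult_left mult.commute[of c "1 / a"] by simp
  qed
  also have "\<dots> = tr t i j * tr t' k l - tr t' k l * tr t i j - sc (1 / a) * (tr t k j * tr t' i l - tr t' k j * tr t i l)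
     + ((if k = - i then sc (\<theta> i / (a - \<kappa>)) * (\<Sum>p\<in>Idx N. sc (\<theta> p) * (tr t p j * tr t' (- p) l)) else 0)
       - (if l = - j then sc (\<theta> j / (a - \<kappa>)) * (\<Sum>p\<in>Idx N. sc (\<theta> p) * (tr t' k (- p) * tr t i p)) else 0))"
    unfolding s1 s2
    unfolding tt x1_def x2_def y1_def y2_def c_def by (simp add: mult_ac)
  finally show "tr t i j * tr t' k l - tr t' k l * tr t i j - sc (1 / a) * (tr t k j * tr t' i l - tr t' k j * tr t i l)
     + ((if k = - i then sc (\<theta> i / (a - \<kappa>)) * (\<Sum>p\<in>Idx N. sc (\<theta> p) * (tr t p j * tr t' (- p) l)) else 0)
       - (if l = - j then sc (\<theta> j / (a - \<kappa>)) * (\<Sum>p\<in>Idx N. sc (\<theta> p) * (tr t' k (- p) * tr t i p)) else 0)) \<in> J" .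
qed

lemma meq_trans: "left_ideal J \<Longrightarrow> meq J X Y \<Longrightarrow> meq J Y Z \<Longrightarrow> meq J X Z"
  unfolding meq_def by (metis (no_types, lifting) diff_add_cancel add_diff_eq left_ideal.add)

lemma meq_left:
  assumes "left_ideal J" "meq J X Y"
  shows "meq J (Z \<bullet> X) (Z \<bullet> Y)"
  unfolding meq_def
proof (intro ballI)
  fix x y assume "x \<in> Idx N \<times> Idx N" "y \<in> Idx N \<times> Idx N"
  then have "(\<Sum>w\<in>Idx N \<times> Idx N. Z x w * (X w y - Y w y)) \<in> J"
    using assms(2) by (intro left_ideal.sum[OF assms(1)] left_ideal.mult_left[OF assms(1)]) (auto simp: meq_def)
  then show "(Z \<bullet> X) x y - (Z \<bullet> Y) x y \<in> J"
    by (simp add: mult2_def right_diff_distrib sum_subtractf)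
qed

lemma meq_right:
  assumes "two_sided_ideal J" "meq J X Y"
  shows "meq J (X \<bullet> Z) (Y \<bullet> Z)"
  unfolding meq_def
proof (intro ballI)
  interpret two_sided_ideal J by fact
  fix x y assume "x \<in> Idx N \<times> Idx N" "y \<in> Idx N \<times> Idx N"
  then have "(\<Sum>w\<in>Idx N \<times> Idx N. (X x w - Y x w) * Z w y) \<in> J"
    using assms(2) by (intro sum mult_right) (auto simp: meq_def)
  then show "(X \<bullet> Z) x y - (Y \<bullet> Z) x y \<in> J"
    by (simp add: mult2_def left_diff_distrib sum_subtractf)
qed

lemma meq_middle:
  assumes "two_sided_ideal J" "meq J (A \<bullet> B \<bullet> C) (A' \<bullet> B' \<bullet> C')"
  shows "meq J (A \<bullet> B \<bullet> C \<bullet> Z) (A' \<bullet> B' \<bullet> C' \<bullet> Z)"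
  using meq_right[OF assms, of Z] by (simp add: mult2_assoc)

lemma meq_middle2:
  assumes "two_sided_ideal J" "meq J (A \<bullet> B) (A' \<bullet> B')"
  shows "meq J (A \<bullet> B \<bullet> Z) (A' \<bullet> B' \<bullet> Z)"
  using meq_right[OF assms, of Z] by (simp add: mult2_assoc)

lemma commuting_first_second:
  assumes J: "left_ideal J"
    and "\<And>i j k l. \<lbrakk>i \<in> Idx N; j \<in> Idx N; k \<in> Idx N; l \<in> Idx N\<rbrakk> \<Longrightarrow> X i j * Y k l = Y k l * X i j"
  shows "meq J (in_first X \<bullet> in_second Y) (in_second Y \<bullet> in_first X)"
    "meq J (in_second Y \<bullet> in_first X) (in_first X \<bullet> in_second Y)"
  using assms by (auto simp: meq_def mult2_first_second left_ideal.zero)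

definition diag :: "(int \<Rightarrow> 'k) \<Rightarrow> 'b mat1" where
  "diag g i j = (if i = j then sc (g i) else 0)"

lemma in_first_product:
  assumes "left_ideal J"
  shows "meq J (in_first (\<lambda>i j. \<Sum>p\<in>Idx N. X i p * sc (g p) * Y p j)) (in_first X \<bullet> in_first (diag g) \<bullet> in_first Y)"
    "meq J (in_second (\<lambda>i j. \<Sum>p\<in>Idx N. X i p * sc (g p) * Y p j)) (in_second X \<bullet> in_second (diag g) \<bullet> in_second Y)"
proof -
  have d: "(in_first (diag g) \<bullet> Z) (p, k) z = sc (g p) * Z (p, k) z"
    "(in_second (diag g) \<bullet> Z) (k, p) z = sc (g p) * Z (k, p) z" if "p \<in> Idx N" "k \<in> Idx N" for p k Z z
    using that by (simp_all add: mult2_in_first diag_def sum_delta_mult finite_Idx)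
  have "(in_first X \<bullet> in_first (diag g) \<bullet> in_first Y) (i, k) (j, l)
      = in_first (\<lambda>i j. \<Sum>p\<in>Idx N. X i p * sc (g p) * Y p j) (i, k) (j, l)"
    "(in_second X \<bullet> in_second (diag g) \<bullet> in_second Y) (k, i) (l, j)
      = in_second (\<lambda>i j. \<Sum>p\<in>Idx N. X i p * sc (g p) * Y p j) (k, i) (l, j)"
    if "i \<in> Idx N" "k \<in> Idx N" for i k j l
  proof -
    have "(in_first X \<bullet> in_first (diag g) \<bullet> in_first Y) (i, k) (j, l)
      = (\<Sum>p\<in>Idx N. X i p * (sc (g p) * in_first Y (p, k) (j, l)))"
      "(in_second X \<bullet> in_second (diag g) \<bullet> in_second Y) (k, i) (l, j)
      = (\<Sum>p\<in>Idx N. X i p * (sc (g p) * in_second Y (k, p) (l, j)))"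
      using that by (simp_all add: mult2_in_first(1,3)[of _ _ _ X] d cong: sum.cong)
    then show "(in_first X \<bullet> in_first (diag g) \<bullet> in_first Y) (i, k) (j, l)
      = in_first (\<lambda>i j. \<Sum>p\<in>Idx N. X i p * sc (g p) * Y p j) (i, k) (j, l)"
      "(in_second X \<bullet> in_second (diag g) \<bullet> in_second Y) (k, i) (l, j)
      = in_second (\<lambda>i j. \<Sum>p\<in>Idx N. X i p * sc (g p) * Y p j) (k, i) (l, j)"
      by (auto simp: in_first_def in_second_def mult.assoc)
  qed
  then show "meq J (in_first (\<lambda>i j. \<Sum>p\<in>Idx N. X i p * sc (g p) * Y p j)) (in_first X \<bullet> in_first (diag g) \<bullet> in_first Y)"
    "meq J (in_second (\<lambda>i j. \<Sum>p\<in>Idx N. X i p * sc (g p) * Y p j)) (in_second X \<bullet> in_second (diag g) \<bullet> in_second Y)"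
    by (auto simp: meq_def left_ideal.zero[OF assms])
qed

text \<open>R(z) separates S from \<open>S'\<close>. Exchanging the transposed factor of S with
  \<open>T'\<close> across it brings T next to \<open>T'\<close> and the two transposes next to each
  other. Then R(a) passes T and \<open>T'\<close>, the diagonal matrices and the transposes in turn,
  and the exchanges are undone on the other side.\<close>

theorem reflection_from_rtt:
  assumes J: "two_sided_ideal J"
    and TT: "rtt J a T T'" and tT: "rtt J (\<kappa> - z) t T'" and t'T: "rtt J (\<kappa> - z) t' T" and t't: "rtt J a t' t"
    and G: "meq J (R a \<bullet> in_first (diag g) \<bullet> R z \<bullet> in_second (diag g'))
        (in_second (diag g') \<bullet> R z \<bullet> in_first (diag g) \<bullet> R a)"
    and S: "S = (\<lambda>i j. \<Sum>p\<in>Idx N. T i p * sc (g p) * tr t p j)"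
    and S': "S' = (\<lambda>i j. \<Sum>p\<in>Idx N. T' i p * sc (g' p) * tr t' p j)"
  shows "meq J (R a \<bullet> in_first S \<bullet> R z \<bullet> in_second S') (in_second S' \<bullet> R z \<bullet> in_first S \<bullet> R a)"
proof -
  interpret two_sided_ideal J by fact
  note l = left_ideal_axioms
  note meq_trans' [trans] = meq_trans[OF l]
  note ml = meq_left[OF l]
  note m2 = meq_middle2[OF J] and m3 = meq_middle[OF J]
  note cs = commuting_first_second[OF l]
  let ?T = "in_first T" and ?T' = "in_second T'" and ?t = "in_first (tr t)" and ?t' = "in_second (tr t')"
    and ?G = "in_first (diag g)" and ?G' = "in_second (diag g')"
  have diag_comm: "X i j * diag f k l = diag f k l * X i j" "diag f k l * X i j = X i j * diag f k l" for X :: "'b mat1" and f i j k l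
    by (simp_all add: diag_def sc.central)
  have FS: "meq J (in_first S) (?T \<bullet> ?G \<bullet> ?t)" unfolding S by (rule in_first_product[OF l])
  have FS': "meq J (in_second S') (?T' \<bullet> ?G' \<bullet> ?t')" unfolding S' by (rule in_first_product[OF l])
  have sym: "meq J Y X" if "meq J X Y" for X Y
    using that uminus unfolding meq_def by (metis minus_diff_eq)
  have "meq J (R a \<bullet> in_first S \<bullet> R z \<bullet> in_second S') (R a \<bullet> ?T \<bullet> ?G \<bullet> ?t \<bullet> R z \<bullet> in_second S')"
    using ml[OF meq_right[OF J FS, of "R z \<bullet> in_second S'"], of "R a"] by (simp add: mult2_assoc)
  also have "meq J \<dots> (R a \<bullet> ?T \<bullet> ?G \<bullet> ?t \<bullet> R z \<bullet> ?T' \<bullet> ?G' \<bullet> ?t')"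
    by (intro ml FS')
  also have "meq J \<dots> (R a \<bullet> ?T \<bullet> ?G \<bullet> ?T' \<bullet> R z \<bullet> ?t \<bullet> ?G' \<bullet> ?t')"
    by (intro ml m3 transposed_first[OF l tT])
  also have "meq J \<dots> (R a \<bullet> ?T \<bullet> ?T' \<bullet> ?G \<bullet> R z \<bullet> ?t \<bullet> ?G' \<bullet> ?t')"
    by (intro ml m2 cs diag_comm)
  also have "meq J \<dots> (R a \<bullet> ?T \<bullet> ?T' \<bullet> ?G \<bullet> R z \<bullet> ?G' \<bullet> ?t \<bullet> ?t')"
    by (intro ml m2 cs diag_comm)
  also have "meq J \<dots> (?T' \<bullet> ?T \<bullet> R a \<bullet> ?G \<bullet> R z \<bullet> ?G' \<bullet> ?t \<bullet> ?t')"
    by (intro m3 TT[unfolded rtt_iff])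
  also have "meq J \<dots> (?T' \<bullet> ?T \<bullet> ?G' \<bullet> R z \<bullet> ?G \<bullet> R a \<bullet> ?t \<bullet> ?t')"
    using ml[OF ml[OF meq_right[OF J G, of "?t \<bullet> ?t'"]], of ?T' ?T] by (simp add: mult2_assoc)
  also have "meq J \<dots> (?T' \<bullet> ?T \<bullet> ?G' \<bullet> R z \<bullet> ?G \<bullet> ?t' \<bullet> ?t \<bullet> R a)"
    by (intro ml transposed_both[OF l t't, unfolded rtt_iff])
  also have "meq J \<dots> (?T' \<bullet> ?G' \<bullet> ?T \<bullet> R z \<bullet> ?G \<bullet> ?t' \<bullet> ?t \<bullet> R a)"
    by (intro ml m2 cs diag_comm)
  also have "meq J \<dots> (?T' \<bullet> ?G' \<bullet> ?T \<bullet> R z \<bullet> ?t' \<bullet> ?G \<bullet> ?t \<bullet> R a)"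
    by (intro ml m2 cs diag_comm)
  also have "meq J \<dots> (?T' \<bullet> ?G' \<bullet> ?t' \<bullet> R z \<bullet> ?T \<bullet> ?G \<bullet> ?t \<bullet> R a)"
    by (intro ml m3 transposed_second[OF l t'T])
  also have "meq J \<dots> (in_second S' \<bullet> R z \<bullet> ?T \<bullet> ?G \<bullet> ?t \<bullet> R a)"
    using meq_right[OF J sym[OF FS'], of "R z \<bullet> ?T \<bullet> ?G \<bullet> ?t \<bullet> R a"] by (simp add: mult2_assoc)
  also have "meq J \<dots> (in_second S' \<bullet> R z \<bullet> in_first S \<bullet> R a)"
    using ml[OF ml[OF meq_right[OF J sym[OF FS], of "R a"]], of "in_second S'" "R z"] by (simp add: mult2_assoc)
  finally show ?thesis .
qed

end

section \<open>Diagonal solutions of the reflection equation\<close>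

context osp_index
begin

definition diag2 :: "(int \<Rightarrow> 'k) \<Rightarrow> (int \<Rightarrow> 'k) \<Rightarrow> int \<Rightarrow> int \<Rightarrow> int \<Rightarrow> int \<Rightarrow> 'k" where
  "diag2 g g' i j k l = of_bool (i = j) * of_bool (k = l) * g i * g' k"

lemma middle_diag2:
  assumes "i \<in> I" "l \<in> I"
  shows "middle z (diag2 g g') i k j l = of_bool (i = j) * of_bool (k = l) * g i * g' k
    - of_bool (k = j) * of_bool (i = l) * g i * g' i * inverse z
    + of_bool (k = - i) * of_bool (l = - j) * \<theta> (- k) * \<theta> j * g i * g' l * inverse (z - \<kappa>)"
proof -
  have "(\<Sum>p\<in>I. diag2 g g' i p p l) = (\<Sum>p\<in>I. if p = i then of_bool (i = l) * g i * g' i else 0)"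
    by (intro sum.cong refl) (auto simp: diag2_def)
  then show ?thesis
    using assms finite_I by (auto simp: middle_def diag2_def sum.delta divide_inverse)
qed

lemma middle_diag2_trace:
  assumes "j \<in> I" "l \<in> I"
  shows "(\<Sum>p\<in>I. \<theta> p * middle z (diag2 g g') p (- p) j l) = of_bool (l = - j) * (\<theta> j * g j * g' l
    - \<theta> (- j) * g l * g' l * inverse z + \<theta> j * (\<Sum>p\<in>I. g p) * g' l * inverse (z - \<kappa>))"
proof -
  have "(\<Sum>p\<in>I. \<theta> p * middle z (diag2 g g') p (- p) j l) = (\<Sum>p\<in>I.
      (if p = j then of_bool (l = - j) * \<theta> j * g j * g' l else 0)
      - (if p = - j then of_bool (l = - j) * \<theta> (- j) * g l * g' l * inverse z else 0)
      + of_bool (l = - j) * \<theta> j * g p * g' l * inverse (z - \<kappa>))"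
    using assms
    by (intro sum.cong refl) (auto simp: middle_diag2 algebra_simps theta_sq_left minus_equation_iff)
  also have "\<dots> = of_bool (l = - j) * (\<theta> j * g j * g' l
    - \<theta> (- j) * g l * g' l * inverse z + \<theta> j * (\<Sum>p\<in>I. g p) * g' l * inverse (z - \<kappa>))"
    using assms finite_I
    by (simp add: sum.distrib sum_subtractf sum.delta algebra_simps sum_distrib_left[symmetric] sum_distrib_right[symmetric])
  finally show ?thesis .
qed

lemma middle_diag2_flip:
  assumes "i \<in> I" "k \<in> I" "j \<in> I" "l \<in> I"
  shows "(\<Sum>p\<in>I. \<theta> p * middle z (diag2 g' g) k i (- p) p) = of_bool (k = - i) * (\<theta> i * g i * g' k
    - \<theta> (- i) * g k * g' k * inverse z + \<theta> i * (\<Sum>p\<in>I. g p) * g' k * inverse (z - \<kappa>))"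
proof -
  have "(\<Sum>p\<in>I. \<theta> p * middle z (diag2 g' g) k i (- p) p) = (\<Sum>p\<in>I.
      (if p = i then of_bool (k = - i) * \<theta> i * g i * g' k else 0)
      - (if p = - i then of_bool (k = - i) * \<theta> (- i) * g k * g' k * inverse z else 0)
      + of_bool (k = - i) * \<theta> i * g p * g' k * inverse (z - \<kappa>))"
    using assms
    by (intro sum.cong refl)
      (auto simp: middle_diag2 algebra_simps theta_sq_left theta_neg eps_sq eps_sq_left minus_equation_iff)
  also have "\<dots> = of_bool (k = - i) * (\<theta> i * g i * g' k
    - \<theta> (- i) * g k * g' k * inverse z + \<theta> i * (\<Sum>p\<in>I. g p) * g' k * inverse (z - \<kappa>))"
    using assms finite_I
    by (simp add: sum.distrib sum_subtractf sum.delta algebra_simps sum_distrib_left[symmetric] sum_distrib_right[symmetric])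
  finally show ?thesis .
qed

text \<open>These are the conditions that the reflection equation puts on two diagonal matrices: the
  first compares the terms with i = l and k = j, the second those with k = -i and l = -j after
  division by \<theta> i * \<theta> j. The terms with i = j and k = l are the same on both
  sides.\<close>

definition K_matrix_pair where
  "K_matrix_pair a z g g' \<longleftrightarrow>
     (\<forall>i\<in>I. \<forall>k\<in>I. (g k * g' k - g i * g' i) * inverse z = (g k * g' i - g i * g' k) * inverse a) \<and>
     (\<forall>i\<in>I. \<forall>j\<in>I.
        g i * g' (- j) * inverse (z - \<kappa>) - inverse a * \<epsilon> * g (- i) * g' (- j) * inverse (z - \<kappa>)
        + inverse (a - \<kappa>) * (g j * g' (- j) - \<epsilon> * g (- j) * g' (- j) * inverse z + (\<Sum>p\<in>I. g p) * g' (- j) * inverse (z - \<kappa>))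
      = g' (- i) * g j * inverse (z - \<kappa>) - inverse a * \<epsilon> * g' (- i) * g (- j) * inverse (z - \<kappa>)
        + inverse (a - \<kappa>) * (g' (- i) * g i - \<epsilon> * g' (- i) * g (- i) * inverse z + (\<Sum>p\<in>I. g p) * g' (- i) * inverse (z - \<kappa>)))"

lemma reflection_diag2:
  assumes K: "K_matrix_pair a z g g'"
    and I: "i \<in> I" "k \<in> I" "j \<in> I" "l \<in> I"
  shows "R_act a (\<lambda>i k. middle z (diag2 g g') i k j l) i k = R_act a (\<lambda>j l. middle z (diag2 g' g) k i l j) j l"
proof -
  define L where "L i j = g i * g' (- j) * inverse (z - \<kappa>) - inverse a * \<epsilon> * g (- i) * g' (- j) * inverse (z - \<kappa>)
        + inverse (a - \<kappa>) * (g j * g' (- j) - \<epsilon> * g (- j) * g' (- j) * inverse z + (\<Sum>p\<in>I. g p) * g' (- j) * inverse (z - \<kappa>))" for i j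
  define L' where "L' i j = g' (- i) * g j * inverse (z - \<kappa>) - inverse a * \<epsilon> * g' (- i) * g (- j) * inverse (z - \<kappa>)
        + inverse (a - \<kappa>) * (g' (- i) * g i - \<epsilon> * g' (- i) * g (- i) * inverse z + (\<Sum>p\<in>I. g p) * g' (- i) * inverse (z - \<kappa>))" for i j
  have th: "\<theta> (- i) = \<epsilon> * \<theta> i" "\<theta> (- j) = \<epsilon> * \<theta> j" using I theta_neg by auto
  define M M' where "M = middle z (diag2 g g')" and "M' = middle z (diag2 g' g)"
  define s w r where "s = inverse z" and "w = inverse (z - \<kappa>)" and "r = inverse a"
  define cij ckl ckj cil q where "cij = (of_bool (i = j) :: 'k)" and "ckl = (of_bool (k = l) :: 'k)" and "ckj = (of_bool (k = j) :: 'k)"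
    and "cil = (of_bool (i = l) :: 'k)" and "q = (of_bool (k = - i) :: 'k) * of_bool (l = - j)"
  have eqs: "i = - k \<longleftrightarrow> k = - i" "j = - l \<longleftrightarrow> l = - j" "l = i \<longleftrightarrow> i = l" "j = k \<longleftrightarrow> k = j" "l = k \<longleftrightarrow> k = l" "j = i \<longleftrightarrow> i = j"
    by auto
  have q: "q * (x k l) = q * x (- i) (- j)" for x :: "int \<Rightarrow> int \<Rightarrow> 'k"
    by (simp add: q_def)
  have M: "M i k j l = cij * ckl * g i * g' k - ckj * cil * g i * g' i * s + q * \<theta> (- k) * \<theta> j * g i * g' l * w"
    "M k i j l = ckj * cil * g k * g' i - cij * ckl * g k * g' k * s + q * \<theta> (- i) * \<theta> j * g k * g' l * w"
    "M' k i l j = cij * ckl * g i * g' k - cil * ckj * g k * g' k * s + q * \<theta> (- i) * \<theta> l * g j * g' k * w"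
    "M' k i j l = ckj * cil * g i * g' k - cij * ckl * g k * g' k * s + q * \<theta> (- i) * \<theta> j * g l * g' k * w"
    using I by (simp_all add: M_def M'_def middle_diag2 cij_def ckl_def ckj_def cil_def q_def s_def w_def eqs)
  have A: "R_act a (\<lambda>i k. M i k j l) i k = cij * ckl * (g i * g' k + g k * g' k * s * r)
      - cil * ckj * (g i * g' i * s + g k * g' i * r) + q * (\<theta> i * \<theta> j * L i j)"
  proof -
    have "R_act a (\<lambda>i k. M i k j l) i k = M i k j l - M k i j l * r + of_bool (k = - i) * \<theta> i * (\<Sum>p\<in>I. \<theta> p * M p (- p) j l) * inverse (a - \<kappa>)"
      by (simp add: R_act_def divide_inverse r_def)
    also have "\<dots> = cij * ckl * (g i * g' k + g k * g' k * s * r) - cil * ckj * (g i * g' i * s + g k * g' i * r)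
      + q * (\<theta> (- k) * \<theta> j * g i * g' l * w - \<theta> (- i) * \<theta> j * g k * g' l * w * r + \<theta> i * inverse (a - \<kappa>) *
         (\<theta> j * g j * g' l - \<theta> (- j) * g l * g' l * s + \<theta> j * (\<Sum>p\<in>I. g p) * g' l * w))"
      unfolding M using I by (simp add: M_def middle_diag2_trace q_def s_def[symmetric] w_def[symmetric] algebra_simps)
    also have "q * (\<theta> (- k) * \<theta> j * g i * g' l * w - \<theta> (- i) * \<theta> j * g k * g' l * w * r + \<theta> i * inverse (a - \<kappa>) *
         (\<theta> j * g j * g' l - \<theta> (- j) * g l * g' l * s + \<theta> j * (\<Sum>p\<in>I. g p) * g' l * w)) = q * (\<theta> i * \<theta> j * L i j)"
      unfolding q[of "\<lambda>k l. (\<theta> (- k) * \<theta> j * g i * g' l * w - \<theta> (- i) * \<theta> j * g k * g' l * w * r + \<theta> i * inverse (a - \<kappa>) *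
         (\<theta> j * g j * g' l - \<theta> (- j) * g l * g' l * s + \<theta> j * (\<Sum>p\<in>I. g p) * g' l * w))"]
      by (simp add: L_def th s_def w_def r_def algebra_simps)
    finally show ?thesis .
  qed
  have B: "R_act a (\<lambda>j l. M' k i l j) j l = cij * ckl * (g i * g' k + g k * g' k * s * r)
      - cil * ckj * (g k * g' k * s + g i * g' k * r) + q * (\<theta> i * \<theta> j * L' i j)"
  proof -
    have "R_act a (\<lambda>j l. M' k i l j) j l = M' k i l j - M' k i j l * r + of_bool (l = - j) * \<theta> j * (\<Sum>p\<in>I. \<theta> p * M' k i (- p) p) * inverse (a - \<kappa>)"
      by (simp add: R_act_def divide_inverse r_def)
    also have "\<dots> = cij * ckl * (g i * g' k + g k * g' k * s * r) - cil * ckj * (g k * g' k * s + g i * g' k * r)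
      + q * (\<theta> (- i) * \<theta> l * g j * g' k * w - \<theta> (- i) * \<theta> j * g l * g' k * w * r + \<theta> j * inverse (a - \<kappa>) *
         (\<theta> i * g i * g' k - \<theta> (- i) * g k * g' k * s + \<theta> i * (\<Sum>p\<in>I. g p) * g' k * w))"
      unfolding M using I by (simp add: M'_def middle_diag2_flip q_def s_def[symmetric] w_def[symmetric] algebra_simps)
    also have "q * (\<theta> (- i) * \<theta> l * g j * g' k * w - \<theta> (- i) * \<theta> j * g l * g' k * w * r + \<theta> j * inverse (a - \<kappa>) *
         (\<theta> i * g i * g' k - \<theta> (- i) * g k * g' k * s + \<theta> i * (\<Sum>p\<in>I. g p) * g' k * w)) = q * (\<theta> i * \<theta> j * L' i j)"
      unfolding q[of "\<lambda>k l. (\<theta> (- i) * \<theta> l * g j * g' k * w - \<theta> (- i) * \<theta> j * g l * g' k * w * r + \<theta> j * inverse (a - \<kappa>) *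
         (\<theta> i * g i * g' k - \<theta> (- i) * g k * g' k * s + \<theta> i * (\<Sum>p\<in>I. g p) * g' k * w))"]
      by (simp add: L'_def th s_def w_def r_def algebra_simps eps_sq_left)
    finally show ?thesis .
  qed
  have move: "x * p + y * q = v * p + w * q" if "(v - x) * p = (y - w) * q" for x y v w p q :: 'k
    using that by (simp add: algebra_simps)
  have "g i * g' i * inverse z + g k * g' i * inverse a = g k * g' k * inverse z + g i * g' k * inverse a"
    using K I unfolding K_matrix_pair_def by (intro move) blast
  moreover have "L i j = L' i j"
    using K I unfolding K_matrix_pair_def L_def L'_def by blast
  ultimately show ?thesis
    using A B by (simp only: M_def M'_def s_def r_def)
qed

lemma K_matrix_pair_const: "K_matrix_pair a z (\<lambda>i. x) (\<lambda>i. x')"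
  by (simp add: K_matrix_pair_def mult.commute)

text \<open>The trace term is zero and the squares d i * d i are 1, which makes the two sides of
  each condition equal. The sign \<delta> is -1 for CI and DIII and 1 for CII and DI(a) with p =
  q.\<close>

lemma K_matrix_pair_traceless:
  assumes "\<And>i. i \<in> I \<Longrightarrow> d i * d i = 1" and "\<And>i. i \<in> I \<Longrightarrow> d (- i) = \<delta> * d i" and "\<delta> * \<delta> = 1"
    and "(\<Sum>i\<in>I. d i) = 0"
  shows "K_matrix_pair a z (\<lambda>i. x * d i) (\<lambda>i. x' * d i)"
  unfolding K_matrix_pair_def
proof (intro conjI ballI)
  fix i k assume "i \<in> I" "k \<in> I"
  then have "d i * d i = 1" "d k * d k = 1" using assms(1) by auto
  moreover have "x * d k * (x' * d k) - x * d i * (x' * d i) = x * x' * (d k * d k - d i * d i)"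
    by (simp add: algebra_simps)
  ultimately have e: "x * d k * (x' * d k) - x * d i * (x' * d i) = 0" "x * d k * (x' * d i) - x * d i * (x' * d k) = 0"
    by simp_all
  show "(x * d k * (x' * d k) - x * d i * (x' * d i)) * inverse z = (x * d k * (x' * d i) - x * d i * (x' * d k)) * inverse a"
    by (simp only: e mult_zero_left)
next
  fix i j assume I: "i \<in> I" "j \<in> I"
  have s: "(\<Sum>p\<in>I. x * d p) = 0" using assms(4) by (simp flip: sum_distrib_left)
  have d: "d i * d i = 1" "d j * d j = 1" "\<delta> * \<delta> = 1" using assms I by auto
  define w r b where "w = inverse (z - \<kappa>)" and "r = inverse a" and "b = inverse (a - \<kappa>)"
  show "x * d i * (x' * d (- j)) * inverse (z - \<kappa>) - inverse a * \<epsilon> * (x * d (- i)) * (x' * d (- j)) * inverse (z - \<kappa>)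
        + inverse (a - \<kappa>) * (x * d j * (x' * d (- j)) - \<epsilon> * (x * d (- j)) * (x' * d (- j)) * inverse z + (\<Sum>p\<in>I. x * d p) * (x' * d (- j)) * inverse (z - \<kappa>))
      = x' * d (- i) * (x * d j) * inverse (z - \<kappa>) - inverse a * \<epsilon> * (x' * d (- i)) * (x * d (- j)) * inverse (z - \<kappa>)
        + inverse (a - \<kappa>) * (x' * d (- i) * (x * d i) - \<epsilon> * (x' * d (- i)) * (x * d (- i)) * inverse z + (\<Sum>p\<in>I. x * d p) * (x' * d (- i)) * inverse (z - \<kappa>))"
  proof -
    have "x * d j * (x' * (\<delta> * d j)) = x * x' * \<delta> * (d j * d j)" "x' * (\<delta> * d i) * (x * d i) = x * x' * \<delta> * (d i * d i)"
      "x * (\<delta> * d j) * (x' * (\<delta> * d j)) = x * x' * (\<delta> * \<delta>) * (d j * d j)"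
      "x' * (\<delta> * d i) * (x * (\<delta> * d i)) = x * x' * (\<delta> * \<delta>) * (d i * d i)"
      by (simp_all only: mult_ac)
    then have e: "x * d j * (x' * (\<delta> * d j)) = x * x' * \<delta>" "x' * (\<delta> * d i) * (x * d i) = x * x' * \<delta>"
      "x * (\<delta> * d j) * (x' * (\<delta> * d j)) = x * x'" "x' * (\<delta> * d i) * (x * (\<delta> * d i)) = x * x'"
      by (simp_all only: d mult_1_right)
    have e': "\<epsilon> * (x * (\<delta> * d j)) * (x' * (\<delta> * d j)) = \<epsilon> * (x * x')" "\<epsilon> * (x' * (\<delta> * d i)) * (x * (\<delta> * d i)) = \<epsilon> * (x * x')"
      by (simp_all only: mult.assoc[of \<epsilon>] e)
    show ?thesis
      unfolding s assms(2)[OF I(1)] assms(2)[OF I(2)] e e'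
      by (simp add: mult_ac)
  qed
qed

text \<open>The hypothesis \<open>tr\<close> expresses c = 4/(p - q). It makes the trace equal to x
  (N - 4 u), and the second condition reduces to (a - \<kappa>) (a - \<epsilon>) - (z - \<kappa>) (z
  - \<epsilon>) = (N - 4 u) v. This holds because a^2 - z^2 = -4 u v.\<close>

lemma K_matrix_pair_linear:
  assumes d: "\<And>i. i \<in> I \<Longrightarrow> d (- i) = d i" "\<And>i. i \<in> I \<Longrightarrow> d i * d i = 1"
    and tr: "c * (\<Sum>i\<in>I. d i) = 4"
    and az: "a = u - v" "z = u + v" and nz: "a \<noteq> 0" "z \<noteq> 0" "a \<noteq> \<kappa>" "z \<noteq> \<kappa>"
  shows "K_matrix_pair a z (\<lambda>i. x * (1 - c * u * d i)) (\<lambda>i. x' * (1 - c * v * d i))"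
  unfolding K_matrix_pair_def
proof (intro conjI ballI)
  define w r b s where "w = inverse (z - \<kappa>)" and "r = inverse a" and "b = inverse (a - \<kappa>)" and "s = inverse z"
  have inv: "(u + v - \<kappa>) * w = 1" "(u - v) * r = 1" "(u - v - \<kappa>) * b = 1" "(u + v) * s = 1"
    using nz unfolding w_def r_def b_def s_def az by simp_all
  {
    fix i k assume "i \<in> I" "k \<in> I"
    then have dd: "d i * d i = 1" "d k * d k = 1" using d(2) by auto
    show "(x * (1 - c * u * d k) * (x' * (1 - c * v * d k)) - x * (1 - c * u * d i) * (x' * (1 - c * v * d i))) * inverse z
        = (x * (1 - c * u * d k) * (x' * (1 - c * v * d i)) - x * (1 - c * u * d i) * (x' * (1 - c * v * d k))) * inverse a"
    proof -
      have "(u + v) * s = (u - v) * r" using inv by simp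
      moreover have "x * (1 - c * u * d k) * (x' * (1 - c * v * d k)) - x * (1 - c * u * d i) * (x' * (1 - c * v * d i))
          = x * x' * c * (c * u * v * (d k * d k - d i * d i) - (u + v) * (d k - d i))"
        "x * (1 - c * u * d k) * (x' * (1 - c * v * d i)) - x * (1 - c * u * d i) * (x' * (1 - c * v * d k))
          = - (x * x' * c * ((u - v) * (d k - d i)))"
        by (simp_all add: algebra_simps)
      ultimately show ?thesis
        unfolding s_def[symmetric] r_def[symmetric] dd by (simp add: mult_ac)
    qed
  next
    fix i j assume I: "i \<in> I" "j \<in> I"
    define N where "N = 2 * \<kappa> + 2 * \<epsilon>"
    have s: "(\<Sum>p\<in>I. x * (1 - c * u * d p)) = x * (N - 4 * u)"
    proof -
      have "(\<Sum>p\<in>I. x * (1 - c * u * d p)) = x * (of_nat (card I) - u * (c * (\<Sum>p\<in>I. d p)))"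
        by (simp add: sum_subtractf sum_distrib_left[symmetric] mult_ac)
      then show ?thesis by (simp add: tr card_I N_def mult.commute)
    qed
    have dd: "d i * d i = 1" "d j * d j = 1" using d I by auto
    define X where "X = x * x'"
    have key: "(1 - c * u * p) * (1 - c * v * q) * w - r * \<epsilon> * (1 - c * u * p) * (1 - c * v * q) * w
        + b * ((1 - c * u * q) * (1 - c * v * q) - \<epsilon> * (1 - c * u * q) * (1 - c * v * q) * s + (N - 4 * u) * (1 - c * v * q) * w)
      = (1 - c * v * p) * (1 - c * u * q) * w - r * \<epsilon> * (1 - c * v * p) * (1 - c * u * q) * w
        + b * ((1 - c * v * p) * (1 - c * u * p) - \<epsilon> * (1 - c * v * p) * (1 - c * u * p) * s + (N - 4 * u) * (1 - c * v * p) * w)"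
      (is "?L p q = ?R p q") if "p * p = 1" "q * q = 1" for p q
    proof -
      have K: "w * ((u - v) - \<epsilon>) - b * ((u + v) - \<epsilon>) - b * w * (N - 4 * u) * v = 0"
      proof -
        have f: "w * ((u - v) - \<epsilon>) = w * b * ((u - v - \<kappa>) * ((u - v) - \<epsilon>))"
          "b * ((u + v) - \<epsilon>) = w * b * ((u + v - \<kappa>) * ((u + v) - \<epsilon>))"
          using inv by (metis mult.assoc mult.commute mult.right_neutral)+
        show ?thesis unfolding N_def by (subst f(1), subst f(2)) (simp add: algebra_simps)
      qed
      have e: "(u - v) * (1 - r * \<epsilon>) = (u - v) - \<epsilon>" "(u + v) * (1 - \<epsilon> * s) = (u + v) - \<epsilon>"
        using inv by (simp_all add: right_diff_distrib mult.assoc[symmetric] mult.commute[of \<epsilon>])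
      \<comment> \<open>The difference of the sides splits into a multiple of q - p, which vanishes
        by \<open>K\<close>, and a multiple of q^2 - p^2, which vanishes because both squares are
        1.\<close>
      have "?L p q - ?R p q = c * (q - p) * (w * ((u - v) * (1 - r * \<epsilon>)) - b * ((u + v) * (1 - \<epsilon> * s)) - b * w * (N - 4 * u) * v)
          + b * (1 - \<epsilon> * s) * c * c * u * v * (q * q - p * p)"
        by (simp add: algebra_simps)
      also have "\<dots> = 0" by (simp only: e K that) simp
      finally show ?thesis by simp
    qed
    show "x * (1 - c * u * d i) * (x' * (1 - c * v * d (- j))) * inverse (z - \<kappa>) - inverse a * \<epsilon> * (x * (1 - c * u * d (- i))) * (x' * (1 - c * v * d (- j))) * inverse (z - \<kappa>)
        + inverse (a - \<kappa>) * (x * (1 - c * u * d j) * (x' * (1 - c * v * d (- j))) - \<epsilon> * (x * (1 - c * u * d (- j))) * (x' * (1 - c * v * d (- j))) * inverse z + (\<Sum>p\<in>I. x * (1 - c * u * d p)) * (x' * (1 - c * v * d (- j))) * inverse (z - \<kappa>))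
      = x' * (1 - c * v * d (- i)) * (x * (1 - c * u * d j)) * inverse (z - \<kappa>) - inverse a * \<epsilon> * (x' * (1 - c * v * d (- i))) * (x * (1 - c * u * d (- j))) * inverse (z - \<kappa>)
        + inverse (a - \<kappa>) * (x' * (1 - c * v * d (- i)) * (x * (1 - c * u * d i)) - \<epsilon> * (x' * (1 - c * v * d (- i))) * (x * (1 - c * u * d (- i))) * inverse z + (\<Sum>p\<in>I. x * (1 - c * u * d p)) * (x' * (1 - c * v * d (- i))) * inverse (z - \<kappa>))"
    proof -
      have "x * x' * ((1 - c * u * d i) * (1 - c * v * d j) * w - r * \<epsilon> * (1 - c * u * d i) * (1 - c * v * d j) * w
        + b * ((1 - c * u * d j) * (1 - c * v * d j) - \<epsilon> * (1 - c * u * d j) * (1 - c * v * d j) * s + (N - 4 * u) * (1 - c * v * d j) * w))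
      = x * x' * ((1 - c * v * d i) * (1 - c * u * d j) * w - r * \<epsilon> * (1 - c * v * d i) * (1 - c * u * d j) * w
        + b * ((1 - c * v * d i) * (1 - c * u * d i) - \<epsilon> * (1 - c * v * d i) * (1 - c * u * d i) * s + (N - 4 * u) * (1 - c * v * d i) * w))"
        by (simp only: key[OF dd])
      note k = this
      show ?thesis
        unfolding s d(1)[OF I(1)] d(1)[OF I(2)] w_def[symmetric] r_def[symmetric] b_def[symmetric] s_def[symmetric]
        by (rule trans[OF _ trans[OF k]]) (simp_all add: algebra_simps)
    qed
  }
qed

text \<open>In the application g is taken at u, \<open>g'\<close> at \<kappa> - u, and a = 2 u -
  \<kappa>. The second and third summand come from the P and the Q term of R(a); the factor c may
  depend on u but not on k.\<close>

definition K_symmetric :: "'k \<Rightarrow> (int \<Rightarrow> 'k) \<Rightarrow> (int \<Rightarrow> 'k) \<Rightarrow> bool" where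
  "K_symmetric a g g' \<longleftrightarrow> (\<exists>c. \<forall>k\<in>I. g k - \<epsilon> / a * g (- k) + (\<Sum>p\<in>I. g p) / (a - \<kappa>) = c * g' (- k))"

lemma K_symmetric_const: "x' \<noteq> 0 \<Longrightarrow> K_symmetric a (\<lambda>i. x) (\<lambda>i. x')"
  unfolding K_symmetric_def by (metis nonzero_divide_eq_eq)

lemma K_symmetric_traceless:
  assumes "\<And>i. i \<in> I \<Longrightarrow> d (- i) = \<delta> * d i" and "\<delta> * \<delta> = 1" and "(\<Sum>i\<in>I. d i) = 0" and "x' \<noteq> 0"
  shows "K_symmetric a (\<lambda>i. x * d i) (\<lambda>i. x' * d i)"
  unfolding K_symmetric_def
proof (intro exI ballI)
  fix k assume "k \<in> I"
  have "(\<Sum>p\<in>I. x * d p) = 0" using assms(3) by (simp flip: sum_distrib_left)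
  moreover have "x * (1 - \<epsilon> / a * \<delta>) / x' * \<delta> * (x' * (\<delta> * d k)) = x * (1 - \<epsilon> / a * \<delta>) * (\<delta> * \<delta>) * (x' / x') * d k"
    by (simp only: divide_inverse mult_ac)
  then have "x * (1 - \<epsilon> / a * \<delta>) / x' * \<delta> * (x' * (\<delta> * d k)) = x * d k - \<epsilon> / a * (x * (\<delta> * d k))"
    using assms(4) by (simp add: assms(2) algebra_simps)
  ultimately show "x * d k - \<epsilon> / a * (x * d (- k)) + (\<Sum>p\<in>I. x * d p) / (a - \<kappa>) = x * (1 - \<epsilon> / a * \<delta>) / x' * \<delta> * (x' * d (- k))"
    using assms(1)[OF \<open>k \<in> I\<close>] by simp
qed

text \<open>The trace term is -x (\<kappa> + \<epsilon> - 2 u)/(\<kappa> - u), and \<kappa> +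
  \<epsilon> - 2 u = (1 - \<epsilon>/a) (\<kappa> - 2 u) because a = 2 u - \<kappa>. So 1 -
  \<epsilon>/a is a common factor, and 1 - c u D - (\<kappa> - 2 u)/(\<kappa> - u) is u/(\<kappa> -
  u) times 1 - c (\<kappa> - u) D.\<close>

lemma K_symmetric_linear:
  assumes d: "\<And>i. i \<in> I \<Longrightarrow> d (- i) = d i"
    and tr: "c * (\<Sum>i\<in>I. d i) = 4" and a: "a = 2 * u - \<kappa>"
    and nz: "a \<noteq> 0" "u \<noteq> \<kappa>" "x' \<noteq> 0" "(2 :: 'k) \<noteq> 0"
  shows "K_symmetric a (\<lambda>i. x * (1 - c * u * d i)) (\<lambda>i. x' * (1 - c * (\<kappa> - u) * d i))"
  unfolding K_symmetric_def
proof (intro exI ballI)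
  fix k assume k: "k \<in> I"
  have s: "(\<Sum>p\<in>I. x * (1 - c * u * d p)) = x * (2 * \<kappa> + 2 * \<epsilon> - 4 * u)"
  proof -
    have "(\<Sum>p\<in>I. x * (1 - c * u * d p)) = x * (of_nat (card I) - u * (c * (\<Sum>p\<in>I. d p)))"
      by (simp add: sum_subtractf sum_distrib_left[symmetric] mult_ac)
    then show ?thesis by (simp add: tr card_I mult.commute)
  qed
  define r w e where "r = inverse a" and "w = inverse (\<kappa> - u)" and "e = inverse x'"
  have ak: "a - \<kappa> = - (2 * (\<kappa> - u))" by (simp add: a)
  have half: "x * (2 * \<kappa> + 2 * \<epsilon> - 4 * u) / (a - \<kappa>) = - (x * (\<kappa> + \<epsilon> - 2 * u) * w)"
    using nz unfolding ak w_def by (simp add: field_simps)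
  have inv: "(2 * u - \<kappa>) * r = 1" "(\<kappa> - u) * w = 1" "x' * e = 1"
    using nz by (auto simp: r_def w_def e_def a)
  define D where "D = d k"
  have "x * (1 - c * u * D) - \<epsilon> * r * (x * (1 - c * u * D)) - x * (\<kappa> + \<epsilon> - 2 * u) * w
      = x * u * (1 - \<epsilon> * r) * w * e * (x' * (1 - c * (\<kappa> - u) * D))"
  proof -
    define m where "m = 1 - \<epsilon> * r"
    have "m * (\<kappa> - 2 * u) = (\<kappa> - 2 * u) + \<epsilon> * ((2 * u - \<kappa>) * r)"
      by (simp add: m_def algebra_simps)
    then have f: "\<kappa> + \<epsilon> - 2 * u = m * (\<kappa> - 2 * u)" by (simp add: inv)
    have "x * u * m * w * e * (x' * (1 - c * (\<kappa> - u) * D)) = x * u * m * (x' * e) * (w - c * ((\<kappa> - u) * w) * D)"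
      by (simp add: algebra_simps)
    also have "\<dots> = x * u * m * (w - c * D)" by (simp add: inv)
    also have "\<dots> = x * m * ((\<kappa> - u) * w) - x * (m * (\<kappa> - 2 * u)) * w - x * m * c * u * D"
      by (simp add: algebra_simps)
    also have "\<dots> = x * m - x * (\<kappa> + \<epsilon> - 2 * u) * w - x * m * c * u * D"
      by (simp add: inv f)
    finally show ?thesis by (simp add: m_def algebra_simps)
  qed
  then show "x * (1 - c * u * d k) - \<epsilon> / a * (x * (1 - c * u * d (- k))) + (\<Sum>p\<in>I. x * (1 - c * u * d p)) / (a - \<kappa>)
      = x * u * (1 - \<epsilon> * r) * w * e * (x' * (1 - c * (\<kappa> - u) * d (- k)))"
    unfolding s half d[OF k] by (simp add: D_def r_def divide_inverse)
qed

end

context R_ring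
begin

text \<open>The RTT relation with column indices k and -k, weighted by \<theta> k * g k and summed
  over k, produces entries of T G \<open>tr T'\<close>. \<open>K_symmetric\<close> recombines the
  reordered products into an entry of \<open>T'\<close> G' \<open>tr T\<close>. Since i \<noteq> j,
  the Q term over the rows does not occur.\<close>

lemma symmetry:
  assumes J: "left_ideal J" and rtt: "rtt J a T T'" and ij: "i \<in> Idx N" "j \<in> Idx N" "i \<noteq> j"
    and K: "K_symmetric a g g'"
  shows "\<exists>c c'. (\<Sum>k\<in>Idx N. T i k * sc (g k) * tr T' k j)
      - sc c * (\<Sum>k\<in>Idx N. T (- j) k * sc (g k) * tr T' k (- i))
      - sc c' * (\<Sum>k\<in>Idx N. T' (- j) k * sc (g' k) * tr T k (- i)) \<in> J"
proof -
  obtain c where c: "\<And>k. k \<in> Idx N \<Longrightarrow> g k - \<epsilon> / a * g (- k) + (\<Sum>p\<in>Idx N. g p) / (a - \<kappa>) = c * g' (- k)"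
    using K unfolding K_symmetric_def by blast
  define A A' B where "A k = T i k * T' (- j) (- k)" and "A' k = T (- j) k * T' i (- k)"
    and "B k = T' (- j) (- k) * T i k" for k
  define SB where "SB = (\<Sum>p\<in>Idx N. sc (\<theta> p) * B p)"
  have "A k - B k - sc (1 / a) * (A' k - B (- k)) - sc (\<theta> k / (a - \<kappa>)) * SB \<in> J" if "k \<in> Idx N" for k
    using rtt[unfolded rtt_def, rule_format, of i "- j" k "- k"] ij that
    by (simp add: A_def A'_def B_def SB_def)
  then have "sc (\<theta> j) * (\<Sum>k\<in>Idx N. sc (\<theta> k * g k) * (A k - B k - sc (1 / a) * (A' k - B (- k)) - sc (\<theta> k / (a - \<kappa>)) * SB)) \<in> J"
    by (intro left_ideal.mult_left[OF J] left_ideal.sum[OF J])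
  moreover have "(\<Sum>k\<in>Idx N. sc (\<theta> k * g k) * (A k - B k - sc (1 / a) * (A' k - B (- k)) - sc (\<theta> k / (a - \<kappa>)) * SB))
     = (\<Sum>k\<in>Idx N. sc (\<theta> k * g k) * A k) - sc (1 / a) * (\<Sum>k\<in>Idx N. sc (\<theta> k * g k) * A' k)
       - (\<Sum>k\<in>Idx N. sc (c * \<theta> k * g' (- k)) * B k)"
  proof -
    have neg: "(\<Sum>k\<in>Idx N. sc (\<theta> k * g k) * (sc (1 / a) * B (- k))) = (\<Sum>k\<in>Idx N. sc (\<theta> k * (\<epsilon> / a * g (- k))) * B k)"
      unfolding sum_neg[symmetric, of "\<lambda>k. sc (\<theta> k * g k) * (sc (1 / a) * B (- k))"]
      by (intro sum.cong refl) (simp add: sc_mult_left theta_neg mult_ac)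
    have tr: "(\<Sum>k\<in>Idx N. sc (\<theta> k * g k) * (sc (\<theta> k / (a - \<kappa>)) * SB)) = (\<Sum>k\<in>Idx N. sc (\<theta> k * ((\<Sum>p\<in>Idx N. g p) / (a - \<kappa>))) * B k)"
    proof -
      have "(\<Sum>k\<in>Idx N. sc (\<theta> k * g k) * (sc (\<theta> k / (a - \<kappa>)) * SB)) = (\<Sum>k\<in>Idx N. sc (g k / (a - \<kappa>)) * SB)"
      proof (intro sum.cong refl)
        fix k assume "k \<in> Idx N"
        then have "\<theta> k * g k * (\<theta> k / (a - \<kappa>)) = g k / (a - \<kappa>)"
          using theta_sq_left[of k] by (simp add: mult_ac)
        then show "sc (\<theta> k * g k) * (sc (\<theta> k / (a - \<kappa>)) * SB) = sc (g k / (a - \<kappa>)) * SB"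
          by (simp only: sc_mult_left)
      qed
      also have "\<dots> = sc ((\<Sum>p\<in>Idx N. g p) / (a - \<kappa>)) * SB"
        by (simp only: sum_divide_distrib sc.sum sum_distrib_right)
      also have "\<dots> = (\<Sum>k\<in>Idx N. sc (\<theta> k * ((\<Sum>p\<in>Idx N. g p) / (a - \<kappa>))) * B k)"
        unfolding SB_def by (simp only: sum_distrib_left sc_mult_left mult.commute)
      finally show ?thesis .
    qed
    have "(\<Sum>k\<in>Idx N. sc (c * \<theta> k * g' (- k)) * B k) = (\<Sum>k\<in>Idx N. sc (\<theta> k * g k) * B k)
        - (\<Sum>k\<in>Idx N. sc (\<theta> k * (\<epsilon> / a * g (- k))) * B k) + (\<Sum>k\<in>Idx N. sc (\<theta> k * ((\<Sum>p\<in>Idx N. g p) / (a - \<kappa>))) * B k)"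
    proof -
      have "c * \<theta> k * g' (- k) = \<theta> k * g k - \<theta> k * (\<epsilon> / a * g (- k)) + \<theta> k * ((\<Sum>p\<in>Idx N. g p) / (a - \<kappa>))" if "k \<in> Idx N" for k
        using arg_cong[OF c[OF that], of "\<lambda>x. \<theta> k * x"] by (simp only: right_diff_distrib distrib_left mult_ac)
      then show ?thesis
        by (simp add: sum.distrib[symmetric] sum_subtractf[symmetric] sc.diff sc.add left_diff_distrib distrib_right cong: sum.cong)
    qed
    then show ?thesis
      using neg tr by (simp add: right_diff_distrib sum_subtractf sum_distrib_left sc_mult_left mult.commute)
  qed
  moreover have S: "(\<Sum>k\<in>Idx N. T i k * sc (g k) * tr T' k j) = sc (\<theta> j) * (\<Sum>k\<in>Idx N. sc (\<theta> k * g k) * A k)"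
    "(\<Sum>k\<in>Idx N. T (- j) k * sc (g k) * tr T' k (- i)) = sc (\<theta> (- i)) * (\<Sum>k\<in>Idx N. sc (\<theta> k * g k) * A' k)"
    unfolding sum_distrib_left sc_mult_left A_def A'_def tr_def minus_minus
    by (intro sum.cong refl, simp only: mult.assoc sc.left_commute[of "T _ _"] sc_mult_left mult_ac)+
  moreover have S': "(\<Sum>k\<in>Idx N. T' (- j) k * sc (g' k) * tr T k (- i)) = sc (\<theta> (- i) * \<epsilon>) * (\<Sum>k\<in>Idx N. sc (\<theta> k * g' (- k)) * B k)"
    unfolding sum_neg[symmetric, of "\<lambda>k. T' (- j) k * sc (g' k) * tr T k (- i)"]
    unfolding sum_distrib_left sc_mult_left B_def tr_def minus_minus
    by (intro sum.cong refl) (simp add: mult.assoc sc.left_commute[of "T' _ _"] sc_mult_left theta_neg mult_ac)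
  ultimately have "(\<Sum>k\<in>Idx N. T i k * sc (g k) * tr T' k j)
      - sc (\<theta> j) * (sc (1 / a) * (\<Sum>k\<in>Idx N. sc (\<theta> k * g k) * A' k))
      - sc (\<theta> j) * (\<Sum>k\<in>Idx N. sc (c * \<theta> k * g' (- k)) * B k) \<in> J"
    by (simp only: right_diff_distrib)
  moreover have "sc (\<theta> j) * (sc (1 / a) * (\<Sum>k\<in>Idx N. sc (\<theta> k * g k) * A' k))
      = sc (\<theta> j / a * \<theta> (- i)) * (\<Sum>k\<in>Idx N. T (- j) k * sc (g k) * tr T' k (- i))"
  proof -
    have "\<theta> j / a * \<theta> (- i) * \<theta> (- i) = \<theta> j * (1 / a)"
      using theta_sq[of "- i"] ij by (simp add: mult.assoc)
    then show ?thesis by (simp only: S sc_mult_left)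
  qed
  moreover have "sc (\<theta> j) * (\<Sum>k\<in>Idx N. sc (c * \<theta> k * g' (- k)) * B k)
      = sc (\<theta> j * c * \<theta> (- i) * \<epsilon>) * (\<Sum>k\<in>Idx N. T' (- j) k * sc (g' k) * tr T k (- i))"
  proof -
    have "\<theta> j * c * \<theta> (- i) * \<epsilon> * (\<theta> (- i) * \<epsilon>) = \<theta> j * c * ((\<theta> (- i) * \<theta> (- i)) * (\<epsilon> * \<epsilon>))"
      by (simp only: mult_ac)
    then have "\<theta> j * c * \<theta> (- i) * \<epsilon> * (\<theta> (- i) * \<epsilon>) = \<theta> j * c"
      using theta_sq[of "- i"] ij by (simp only: eps_sq neg_I mult_1_right)
    then have "sc (\<theta> j * c * \<theta> (- i) * \<epsilon>) * (\<Sum>k\<in>Idx N. T' (- j) k * sc (g' k) * tr T k (- i))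
        = sc (\<theta> j * c) * (\<Sum>k\<in>Idx N. sc (\<theta> k * g' (- k)) * B k)"
      by (simp only: S' sc_mult_left)
    also have "\<dots> = sc (\<theta> j) * (\<Sum>k\<in>Idx N. sc (c * \<theta> k * g' (- k)) * B k)"
      by (simp only: sum_distrib_left sc_mult_left mult.assoc)
    finally show ?thesis by (rule sym)
  qed
  ultimately have "(\<Sum>k\<in>Idx N. T i k * sc (g k) * tr T' k j)
      - sc (\<theta> j / a * \<theta> (- i)) * (\<Sum>k\<in>Idx N. T (- j) k * sc (g k) * tr T' k (- i))
      - sc (\<theta> j * c * \<theta> (- i) * \<epsilon>) * (\<Sum>k\<in>Idx N. T' (- j) k * sc (g' k) * tr T k (- i)) \<in> J"
    by (simp only:)
  then show ?thesis by (intro exI)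
qed

end

section \<open>Free algebras and presentations\<close>

definition subst :: "('g \<Rightarrow> 'h free) \<Rightarrow> 'g free \<Rightarrow> 'h free" where
  "subst h f = (\<Sum>w\<in>Poly_Mapping.keys f. scal (Poly_Mapping.lookup f w) * prod_list (map h (letters w)))"

lemma letters_plus [simp]: "letters (v + w) = letters v @ letters w"
  by (simp add: plus_fword_def)

lemma subst_superset:
  assumes "finite S" "Poly_Mapping.keys f \<subseteq> S"
  shows "subst h f = (\<Sum>w\<in>S. scal (Poly_Mapping.lookup f w) * prod_list (map h (letters w)))"
  unfolding subst_def using assms by (intro sum.mono_neutral_left) (auto simp: in_keys_iff)

lemma subst_add: "subst h (f + g) = subst h f + subst h g"
proof -
  let ?S = "Poly_Mapping.keys f \<union> Poly_Mapping.keys g"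
  have "Poly_Mapping.keys (f + g) \<subseteq> ?S" by (rule Poly_Mapping.keys_add)
  then show ?thesis
    by (simp add: subst_superset[of ?S] lookup_add scal.add distrib_right sum.distrib)
qed

lemma subst_sum: "subst h (sum f A) = (\<Sum>a\<in>A. subst h (f a))"
  by (induction A rule: infinite_finite_induct) (simp_all add: subst_add, simp_all add: subst_def)

lemma subst_single: "subst h (Poly_Mapping.single w c) = scal c * prod_list (map h (letters w))"
  by (cases "c = 0") (simp_all add: subst_def)

lemma subst_mult: "subst h (f * g) = subst h f * subst h g"
proof -
  let ?s = "\<lambda>f w. Poly_Mapping.single w (Poly_Mapping.lookup f w)"
  have "subst h ((\<Sum>v\<in>Poly_Mapping.keys f. ?s f v) * (\<Sum>w\<in>Poly_Mapping.keys g. ?s g w))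
      = (\<Sum>v\<in>Poly_Mapping.keys f. subst h (?s f v)) * (\<Sum>w\<in>Poly_Mapping.keys g. subst h (?s g w))"
    unfolding sum_product subst_sum by (simp add: mult_single subst_single scal.mult_mult)
  then show ?thesis by (simp add: sum_single_keys flip: subst_sum)
qed

lemma subst_scal [simp]: "subst h (scal c) = scal c"
  using subst_single[of h 0 c] by (simp add: scal_def)

lemma subst_gen [simp]: "subst h (gen x) = h x"
  by (simp add: gen_def subst_single scal.one)

lemma subst_morphism: "ring_morphism (subst h)"
  using subst_scal[of h 1] by unfold_locales (simp_all add: subst_add subst_mult scal.one)

interpretation subst: ring_morphism "subst h" for h
  by (rule subst_morphism)

lemma prod_list_gen: "prod_list (map gen xs) = Poly_Mapping.single (FWord xs) 1"
proof (induction xs)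
  case Nil
  have "FWord [] = (0 :: 'a fword)" by (simp add: zero_fword_def)
  then show ?case by simp
next
  case (Cons x xs)
  then show ?case by (simp add: gen_def mult_single plus_fword_def)
qed

text \<open>A retraction onto the free ring on X. Ideals of \<open>free_ring X\<close> live on a
  carrier, whereas the calculus of series needs ideals of a whole type; pulling back along
  \<open>restr\<close> turns the former into the latter.\<close>

definition restr :: "'g set \<Rightarrow> 'g free \<Rightarrow> 'g free" where
  "restr X = subst (\<lambda>x. if x \<in> X then gen x else 0)"

lemma restr_morphism: "ring_morphism (restr X)"
  unfolding restr_def by (rule subst_morphism)

interpretation restr: ring_morphism "restr X" for X
  by (rule restr_morphism)

lemma restr_scal [simp]: "restr X (scal c) = scal c"
  by (simp add: restr_def)

lemma restr_gen [simp]: "x \<in> X \<Longrightarrow> restr X (gen x) = gen x"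
  by (simp add: restr_def)

abbreviation fcar :: "'g set \<Rightarrow> 'g free set" where
  "fcar X \<equiv> carrier (free_ring X)"

lemma fcar_closed:
  "f \<in> fcar X \<Longrightarrow> g \<in> fcar X \<Longrightarrow> f + g \<in> fcar X"
  "f \<in> fcar X \<Longrightarrow> g \<in> fcar X \<Longrightarrow> f * g \<in> fcar X"
  "0 \<in> fcar X" "1 \<in> fcar X" "scal c \<in> fcar X" "x \<in> X \<Longrightarrow> gen x \<in> fcar X"
proof -
  interpret ring "free_ring X" by (rule ring_free_ring)
  show "f \<in> fcar X \<Longrightarrow> g \<in> fcar X \<Longrightarrow> f + g \<in> fcar X"
    "f \<in> fcar X \<Longrightarrow> g \<in> fcar X \<Longrightarrow> f * g \<in> fcar X" "0 \<in> fcar X" "1 \<in> fcar X"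
    using add.m_closed m_closed zero_closed one_closed by (simp_all only: free_ring_simps(2-5))
  show "scal c \<in> fcar X" "x \<in> X \<Longrightarrow> gen x \<in> fcar X"
    by (simp_all add: free_ring_simps scal_def gen_def)
qed

lemma fcar_sum: "(\<And>a. a \<in> A \<Longrightarrow> f a \<in> fcar X) \<Longrightarrow> sum f A \<in> fcar X"
  by (induction A rule: infinite_finite_induct) (simp_all add: fcar_closed)

lemma subst_in_fcar:
  assumes "\<And>x. h x \<in> fcar X"
  shows "subst h f \<in> fcar X"
proof -
  have "prod_list (map h xs) \<in> fcar X" for xs
    by (induction xs) (simp_all add: fcar_closed assms)
  then show ?thesis unfolding subst_def by (intro fcar_sum fcar_closed)
qed

lemma restr_in_fcar: "restr X f \<in> fcar X"
  unfolding restr_def by (rule subst_in_fcar) (simp add: fcar_closed)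

lemma restr_eq:
  assumes "f \<in> fcar X"
  shows "restr X f = f"
proof -
  have "scal (Poly_Mapping.lookup f w) * prod_list (map (\<lambda>x. if x \<in> X then gen x else 0) (letters w))
      = Poly_Mapping.single w (Poly_Mapping.lookup f w)" if "w \<in> Poly_Mapping.keys f" for w
  proof -
    have "map (\<lambda>x. if x \<in> X then gen x else 0) (letters w) = map gen (letters w)"
      using that assms by (auto simp: free_ring_simps)
    then have "prod_list (map (\<lambda>x. if x \<in> X then gen x else 0) (letters w)) = Poly_Mapping.single w 1"
      by (simp only: prod_list_gen fword.collapse)
    then show ?thesis by (simp add: scal_def mult_single)
  qed
  then show ?thesis
    unfolding restr_def subst_def using sum_single_keys[of f] by simp
qed

lemma restr_eq_iff: "restr X f = f \<longleftrightarrow> f \<in> fcar X"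
  using restr_eq restr_in_fcar by metis

locale presentation =
  fixes X :: "'g set" and Rel :: "'g free set"
  assumes Rel: "Rel \<subseteq> fcar X"
begin

sublocale fr: ring "free_ring X" by (rule ring_free_ring)

lemma ideal_rel: "ideal (rel_ideal X Rel) (free_ring X)"
  unfolding rel_ideal_def by (rule fr.genideal_ideal[OF Rel])

sublocale rel: ideal "rel_ideal X Rel" "free_ring X" by (rule ideal_rel)

definition full_ideal :: "'g free set" where
  "full_ideal = {f. restr X f \<in> rel_ideal X Rel}"

lemma two_sided_full_ideal: "two_sided_ideal full_ideal"
proof
  show "0 \<in> full_ideal"
    using rel.zero_closed by (simp add: full_ideal_def free_ring_simps)
  show "x + y \<in> full_ideal" if "x \<in> full_ideal" "y \<in> full_ideal" for x y
    using rel.a_closed that by (simp add: full_ideal_def restr.add free_ring_simps(5))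
  show "a * x \<in> full_ideal" "x * a \<in> full_ideal" if "x \<in> full_ideal" for a x
    using rel.I_l_closed[of "restr X x" "restr X a"] rel.I_r_closed[of "restr X x" "restr X a"] that restr_in_fcar[of X a]
    by (simp_all add: full_ideal_def restr.mult free_ring_simps(2))
qed

lemma Rel_full_ideal: "r \<in> Rel \<Longrightarrow> r \<in> full_ideal"
  using fr.genideal_self[OF Rel] Rel restr_eq[of r X] by (auto simp: full_ideal_def rel_ideal_def)

lemma full_ideal_iff: "f \<in> fcar X \<Longrightarrow> f \<in> full_ideal \<longleftrightarrow> f \<in> rel_ideal X Rel"
  by (simp add: full_ideal_def restr_eq)

abbreviation "cls \<equiv> presented_class X Rel"
abbreviation "alg \<equiv> presented_algebra X Rel"

lemma alg_simps:
  "carrier alg = {cls f | f. f \<in> fcar X}"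
  "\<lbrakk>f \<in> fcar X; g \<in> fcar X\<rbrakk> \<Longrightarrow> cls f \<oplus>\<^bsub>alg\<^esub> cls g = cls (f + g)"
  "\<lbrakk>f \<in> fcar X; g \<in> fcar X\<rbrakk> \<Longrightarrow> cls f \<otimes>\<^bsub>alg\<^esub> cls g = cls (f * g)"
  "\<one>\<^bsub>alg\<^esub> = cls 1"
  "f \<in> fcar X \<Longrightarrow> c \<odot>\<^bsub>alg\<^esub> cls f = cls (scal c * f)"
proof -
  have fields: "carrier alg = carrier (free_ring X Quot rel_ideal X Rel)"
    "monoid.mult alg = monoid.mult (free_ring X Quot rel_ideal X Rel)"
    "monoid.one alg = monoid.one (free_ring X Quot rel_ideal X Rel)"
    "ring.add alg = ring.add (free_ring X Quot rel_ideal X Rel)"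
    "module.smult alg = (\<lambda>c a. cls (scal c) \<otimes>\<^bsub>free_ring X Quot rel_ideal X Rel\<^esub> a)"
    by (simp_all add: presented_algebra_def Let_def presented_class_def ring.defs module.defs)
  show "carrier alg = {cls f | f. f \<in> fcar X}"
    by (auto simp: fields FactRing_def A_RCOSETS_def' presented_class_def)
  show add: "cls f \<oplus>\<^bsub>alg\<^esub> cls g = cls (f + g)" if "f \<in> fcar X" "g \<in> fcar X"
    using rel.a_rcos_sum[OF that] by (simp add: fields FactRing_def presented_class_def free_ring_simps(5))
  show mult: "cls f \<otimes>\<^bsub>alg\<^esub> cls g = cls (f * g)" if "f \<in> fcar X" "g \<in> fcar X" for f g
    using rel.rcoset_mult_add[OF that] by (simp add: fields FactRing_def presented_class_def free_ring_simps(2))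
  show "\<one>\<^bsub>alg\<^esub> = cls 1"
    by (simp add: fields FactRing_def presented_class_def free_ring_simps(3))
  show "c \<odot>\<^bsub>alg\<^esub> cls f = cls (scal c * f)" if "f \<in> fcar X"
    using mult[OF fcar_closed(5) that] by (simp add: fields)
qed

lemma cls_eq:
  assumes "f \<in> fcar X" "g \<in> fcar X" "f - g \<in> full_ideal"
  shows "cls f = cls g"
proof -
  have "f \<ominus>\<^bsub>free_ring X\<^esub> g = f - g"
  proof -
    have "- g \<in> fcar X" using assms(2) by (simp add: free_ring_simps)
    moreover have "\<ominus>\<^bsub>free_ring X\<^esub> g = - g"
      using calculation assms(2) by (intro fr.minus_equality) (simp_all add: free_ring_simps(4,5))
    ultimately show ?thesis by (simp add: a_minus_def free_ring_simps(5))
  qed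
  moreover have "f - g \<in> fcar X"
    using assms(1,2) restr_eq_iff restr.diff by metis
  ultimately show ?thesis
    using fr.quotient_eq_iff_same_a_r_cos[OF ideal_rel assms(1,2)] assms(3) full_ideal_iff
    by (simp add: presented_class_def)
qed

end

section \<open>The extended Yangian at shifted spectral parameters\<close>

fun th :: "lie_type \<Rightarrow> int \<Rightarrow> complex" where
  "th Orth i = 1"
| "th Sympl i = of_int (sgn i)"

fun ep :: "lie_type \<Rightarrow> complex" where
  "ep Orth = 1"
| "ep Sympl = - 1"

lemma theta_th: "theta F i j = th F i * th F j"
  by (cases F) simp_all

lemma neg_Idx: "- i \<in> Idx N \<longleftrightarrow> i \<in> Idx N"
  by (simp add: Idx_def)

lemma card_Idx: "card (Idx N) = N"
proof (cases "even N")
  case True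
  then obtain m where m: "N = 2 * m" by (elim evenE)
  then have "Idx N = {- int m..int m} - {0}" by (auto simp: Idx_def rank_def)
  then show ?thesis by (simp add: m nat_add_distrib nat_mult_distrib)
next
  case False
  then obtain m where m: "N = 2 * m + 1" by (elim oddE)
  then have "Idx N = {- int m..int m}" by (auto simp: Idx_def rank_def)
  then show ?thesis by (simp add: m nat_add_distrib nat_mult_distrib)
qed

lemma osp_index_Idx:
  fixes c :: "complex \<Rightarrow> 'k::field"
  assumes "ring_morphism c" and "F = Sympl \<Longrightarrow> even N"
  shows "osp_index (Idx N) (\<lambda>i. c (th F i)) (c (ep F)) (c (kappa F N))"
proof -
  interpret c: ring_morphism c by fact
  have of_nat: "c (of_nat m) = of_nat m" for m
    by (induction m) (simp_all add: c.add c.one)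
  have two: "c 2 = 2" using of_nat[of 2] by simp
  show ?thesis
  proof
    show "finite (Idx N)" by (rule finite_Idx)
    show "- i \<in> Idx N \<longleftrightarrow> i \<in> Idx N" for i by (rule neg_Idx)
    show "c (th F i) * c (th F i) = 1" if "i \<in> Idx N" for i
      using that assms(2) by (cases F) (auto simp: c.one Idx_def sgn_if c.mult[symmetric])
    show "c (th F (- i)) = c (ep F) * c (th F i)" for i
      by (cases F) (simp_all add: sgn_minus c.mult[symmetric])
    show "c (ep F) = 1 \<or> c (ep F) = - 1"
      by (cases F) (simp_all add: c.one c.uminus)
    have "of_nat N = 2 * kappa F N + 2 * ep F" by (cases F) (simp_all add: field_simps)
    then have "c (of_nat N) = c (2 * kappa F N + 2 * ep F)" by simp
    then show "of_nat (card (Idx N)) = 2 * c (kappa F N) + 2 * c (ep F)"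
      by (simp add: card_Idx of_nat c.add c.mult two)
  qed
qed

lemma const2_morphism: "ring_morphism const2"
  unfolding const2_def[abs_def] by (rule ring_morphism_comp[OF ring_morphism_fls_const ring_morphism_fls_const])

interpretation const2: ring_morphism const2
  by (rule const2_morphism)

interpretation fls_const: ring_morphism fls_const
  by (rule ring_morphism_fls_const)

lemma P_op_eq:
  assumes "i \<in> Idx N" "j \<in> Idx N"
  shows "P_op N (i, k) (j, l) = (if i = l \<and> k = j then 1 else 0)"
proof -
  have "P_op N (i, k) (j, l) = (\<Sum>p\<in>Idx N. \<Sum>q\<in>Idx N. if q = j then if p = i then if i = l \<and> k = j then 1 else 0 else 0 else 0)"
    unfolding P_op_def tensor_def E_def by (intro sum.cong refl) auto
  then show ?thesis using assms finite_Idx by (simp add: sum.delta)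
qed

lemma Q_op_eq:
  assumes "i \<in> Idx N" "j \<in> Idx N"
  shows "Q_op F N (i, k) (j, l) = (if k = - i \<and> l = - j then th F i * th F j else 0)"
proof -
  have "Q_op F N (i, k) (j, l) = (\<Sum>p\<in>Idx N. \<Sum>q\<in>Idx N. if q = j then if p = i then if k = - i \<and> l = - j then theta F i j else 0 else 0 else 0)"
    unfolding Q_op_def tensor_def E_def by (intro sum.cong refl) auto
  then show ?thesis using assms finite_Idx by (simp add: sum.delta theta_th)
qed

text \<open>The expansion of the inverse of \<alpha> u + \<beta> in powers of u^-1, which is the
  point where u^-1 is sent when u becomes \<alpha> u + \<beta>.\<close>

definition pt :: "complex \<Rightarrow> complex \<Rightarrow> complex fps" where
  "pt \<alpha> \<beta> = fps_X / (fps_const \<alpha> + fps_const \<beta> * fps_X)"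

lemma subst_affine_eval: "subst_affine \<alpha> \<beta> f = scal.eval (pt \<alpha> \<beta>) f"
  by (simp add: subst_affine_def scal.eval_compose pt_def map_fps_def)

lemma pt_mult:
  assumes "\<alpha> \<noteq> 0"
  shows "pt \<alpha> \<beta> * (fps_const \<alpha> + fps_const \<beta> * fps_X) = fps_X"
  using assms by (simp add: pt_def fps_divide_unit mult.assoc inverse_mult_eq_1)

lemma pt_0: "\<alpha> \<noteq> 0 \<Longrightarrow> pt \<alpha> \<beta> $ 0 = 0"
  using arg_cong[OF pt_mult[of \<alpha> \<beta>], of "\<lambda>f. f $ 0"] by simp

lemma pt_unique:
  assumes "\<alpha> \<noteq> 0" "f * (fps_const \<alpha> + fps_const \<beta> * fps_X) = fps_X"
  shows "f = pt \<alpha> \<beta>"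
proof -
  have "fps_const \<alpha> + fps_const \<beta> * fps_X \<noteq> 0"
    using assms(1) by (auto dest: arg_cong[of _ _ "\<lambda>f. f $ 0"])
  with assms pt_mult[OF assms(1), of \<beta>] show ?thesis by (metis mult_right_cancel)
qed

text \<open>Putting \<alpha>' u + \<beta>' for u in \<alpha> u + \<beta> gives the new coefficients;
  \<open>pt_unique\<close> allows checking this after clearing the denominator.\<close>

lemma pt_compose:
  assumes "\<alpha> \<noteq> 0" "\<alpha>' \<noteq> 0"
  shows "pt \<alpha> \<beta> oo pt \<alpha>' \<beta>' = pt (\<alpha> * \<alpha>') (\<alpha> * \<beta>' + \<beta>)"
proof (rule pt_unique)
  define h p where "h = pt \<alpha> \<beta> oo pt \<alpha>' \<beta>'" and "p = pt \<alpha>' \<beta>'"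
  have p0: "p $ 0 = 0" unfolding p_def by (rule pt_0[OF assms(2)])
  have p: "p * (fps_const \<alpha>' + fps_const \<beta>' * fps_X) = fps_X"
    unfolding p_def by (rule pt_mult[OF assms(2)])
  have "(pt \<alpha> \<beta> * (fps_const \<alpha> + fps_const \<beta> * fps_X)) oo p = p"
    unfolding pt_mult[OF assms(1)] using p0 by (rule fps_X_fps_compose_startby0)
  then have h: "h * (fps_const \<alpha> + fps_const \<beta> * p) = p"
    using p0 unfolding h_def p_def[symmetric] by (simp add: fps_compose_mult_distrib fps_compose_add_distrib)
  define q where "q = fps_const \<alpha>' + fps_const \<beta>' * fps_X"
  have "h * (fps_const \<alpha> * q + fps_const \<beta> * (p * q)) = (h * (fps_const \<alpha> + fps_const \<beta> * p)) * q"
    by (simp add: algebra_simps)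
  also have "\<dots> = fps_X" using h p by (simp only: q_def)
  finally have "h * (fps_const \<alpha> * q + fps_const \<beta> * fps_X) = fps_X" using p by (simp only: q_def)
  moreover have "fps_const \<alpha> * q + fps_const \<beta> * fps_X = fps_const (\<alpha> * \<alpha>') + fps_const (\<alpha> * \<beta>' + \<beta>) * fps_X"
    unfolding q_def fps_const_mult[symmetric] fps_const_add[symmetric] by (simp only: distrib_left distrib_right mult.assoc add.assoc)
  ultimately show "(pt \<alpha> \<beta> oo pt \<alpha>' \<beta>') * (fps_const (\<alpha> * \<alpha>') + fps_const (\<alpha> * \<beta>' + \<beta>) * fps_X) = fps_X"
    by (simp only: h_def)
qed (use assms in simp)

definition cu :: "complex fps \<Rightarrow> complex fls fls" where
  "cu f = map_fls fls_const (fps_to_fls f)"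

definition cv :: "complex fps \<Rightarrow> complex fls fls" where
  "cv f = fls_const (fps_to_fls f)"

lemma cu_morphism: "ring_morphism cu"
  unfolding cu_def[abs_def]
  by (rule ring_morphism_comp[OF ring_morphism.map_fls[OF ring_morphism_fls_const] ring_morphism_fps_to_fls])

lemma cv_morphism: "ring_morphism cv"
  unfolding cv_def[abs_def] by (rule ring_morphism_comp[OF ring_morphism_fls_const ring_morphism_fps_to_fls])

interpretation cu: ring_morphism cu by (rule cu_morphism)
interpretation cv: ring_morphism cv by (rule cv_morphism)
interpretation c1: ring_morphism fps_to_fls by (rule ring_morphism_fps_to_fls)

lemma fls_X_inv_X: "fls_X_inv * fls_X = (1 :: 'a::comm_ring_1 fls)"
  by (simp add: fls_X_inv_times_conv_shift)

lemma cu_simps: "cu (fps_const c) = const2 c" "cu fps_X = 1 / var_u"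
proof -
  show "cu (fps_const c) = const2 c" by (rule fls_eqI) (simp add: cu_def const2_def)
  have "cu fps_X = fls_X" by (rule fls_eqI) (auto simp: cu_def)
  then have "cu fps_X * var_u = 1"
    by (simp add: var_u_def mult.commute[of fls_X] fls_X_inv_X)
  then show "cu fps_X = 1 / var_u"
    by (metis eq_divide_eq mult_zero_right zero_neq_one)
qed

lemma cv_simps: "cv (fps_const c) = const2 c" "cv fps_X = 1 / var_v"
proof -
  show "cv (fps_const c) = const2 c" by (rule fls_eqI) (simp add: cv_def const2_def)
  have "cv fps_X * var_v = 1"
    by (simp add: cv_def var_v_def mult.commute[of fls_X] fls_X_inv_X)
  then show "cv fps_X = 1 / var_v"
    by (metis eq_divide_eq mult_zero_right zero_neq_one)
qed

lemma affine_value: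
  fixes e :: "complex fps \<Rightarrow> 'k::field"
  assumes "ring_morphism e" and "e fps_X = 1 / x" and "x \<noteq> 0" and "\<alpha> \<noteq> 0"
  shows "e (pt \<alpha> \<beta>) = 1 / (e (fps_const \<alpha>) * x + e (fps_const \<beta>))"
    and "e (fps_const \<alpha>) * x + e (fps_const \<beta>) \<noteq> 0"
proof -
  interpret e: ring_morphism e by fact
  have "e (pt \<alpha> \<beta>) * (e (fps_const \<alpha>) + e (fps_const \<beta>) * (1 / x)) = 1 / x"
    using arg_cong[OF pt_mult[OF assms(4), of \<beta>], of e] by (simp add: e.mult e.add assms(2))
  then have *: "e (pt \<alpha> \<beta>) * (e (fps_const \<alpha>) * x + e (fps_const \<beta>)) = 1"
    using assms(3) by (simp add: field_simps)
  then show "e (fps_const \<alpha>) * x + e (fps_const \<beta>) \<noteq> 0" by auto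
  with * show "e (pt \<alpha> \<beta>) = 1 / (e (fps_const \<alpha>) * x + e (fps_const \<beta>))"
    by (simp add: eq_divide_eq)
qed

text \<open>The RTT relation has the outer variable in its first factor. Exchanging the variables
  gives the relations whose first factor is taken at v.\<close>

definition bi_swap :: "'a fps fps \<Rightarrow> 'a fps fps" where
  "bi_swap c = Abs_fps (\<lambda>l. Abs_fps (\<lambda>k. c $ k $ l))"

lemma bi_swap_morphism: "ring_morphism (bi_swap :: 'a::ring_1 fps fps \<Rightarrow> 'a fps fps)"
proof
  show "bi_swap (f + g) = bi_swap f + bi_swap g" for f g :: "'a fps fps"
    by (intro fps_ext) (simp add: bi_swap_def)
  show "bi_swap 1 = (1 :: 'a fps fps)"
    by (intro fps_ext) (auto simp: bi_swap_def)
  show "bi_swap (f * g) = bi_swap f * bi_swap g" for f g :: "'a fps fps"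
    by (intro fps_ext) (simp add: bi_swap_def fps_mult_nth fps_sum_nth, rule sum.swap)
qed

lemma bi_swap_u: "bi_swap (bi_u f) = fps_const f"
  by (intro fps_ext) (auto simp: bi_swap_def bi_u_def)

lemma bi_swap_v: "bi_swap (fps_const f) = bi_u f"
  by (intro fps_ext) (auto simp: bi_swap_def bi_u_def)

lemma bi_u_X: "bi_u fps_X = (fps_X :: 'a::ring_1 fps fps)"
  by (intro fps_ext) (auto simp: bi_u_def)

lemma bi_u_const: "bi_u (fps_const x) = fps_const (fps_const x)"
  by (intro fps_ext) (auto simp: bi_u_def)

lemma sc2_nth: "(sc2 f :: 'a free fls fls) $$ k $$ l = scal (f $$ k $$ l)"
proof -
  have "map_fls scal 0 = (0 :: 'a free fls)" by (rule fls_eqI) simp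
  then show ?thesis by (simp add: sc2_def)
qed

lemma at_u_scal: "at_u (map_fps scal f) = sc2 (cu f)"
  by (intro fls_eqI) (auto simp: at_u_def sc2_nth cu_def)

lemma at_v_scal: "at_v (map_fps scal f) = sc2 (cv f)"
  by (intro fls_eqI) (auto simp: at_v_def sc2_nth cv_def)

lemma fps_to_fls_scal: "fps_to_fls (map_fps scal f) = sc1 (fps_to_fls f)"
  by (intro fls_eqI) (simp add: sc1_def)

lemma at_u_morphism: "ring_morphism at_u"
  unfolding at_u_def[abs_def]
  by (rule ring_morphism_comp[OF ring_morphism.map_fls[OF ring_morphism_fls_const] ring_morphism_fps_to_fls])

lemma at_v_morphism: "ring_morphism at_v"
  unfolding at_v_def[abs_def] by (rule ring_morphism_comp[OF ring_morphism_fls_const ring_morphism_fps_to_fls])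

text \<open>The defining relation multiplied by \<open>(u v)\<^sup>-\<^sup>2 (u - v) (u - v - \<kappa>)\<close>, which makes it polynomial in
  \<open>u\<^sup>-\<^sup>1\<close> and \<open>v\<^sup>-\<^sup>1\<close>.\<close>

definition rtt_cleared :: "lie_type \<Rightarrow> nat \<Rightarrow> int \<Rightarrow> int \<Rightarrow> int \<Rightarrow> int \<Rightarrow> idx free fps fps" where
  "rtt_cleared F N i k j l =
    (let X = fps_X; Y = fps_const fps_X; C = (\<lambda>c. fps_const (fps_const (scal c)));
         T = (\<lambda>i j. bi_u (gen_series i j)); T' = (\<lambda>i j. fps_const (gen_series i j));
         D = Y - X - C (kappa F N) * X * Y
     in (Y - X) * D * (T i j * T' k l - T' k l * T i j) - X * Y * D * (T k j * T' i l - T' k j * T i l)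
        + X * Y * (Y - X) * ((if k = - i then C (th F i) * (\<Sum>p\<in>Idx N. C (th F p) * (T p j * T' (- p) l)) else 0)
          - (if l = - j then C (th F j) * (\<Sum>p\<in>Idx N. C (th F p) * (T' k (- p) * T i p)) else 0)))"

text \<open>After any specialization the cleared relation is the relation itself times the scalar
  \<rho> = (\<xi> \<eta>)^2 a (a - \<kappa>), which is invertible away from the two poles. So the
  relation can be carried from the original variables to other points.\<close>

lemma rtt_cleared_image:
  fixes sc :: "'k::field \<Rightarrow> 'b::ring_1"
  assumes \<Phi>: "ring_morphism \<Phi>" and R: "R_ring sc N (\<lambda>i. c (th F i)) e (c (kappa F N))"
    and X: "\<Phi> fps_X = sc \<xi>" and Y: "\<Phi> (fps_const fps_X) = sc \<eta>"
    and C: "\<And>x. \<Phi> (fps_const (fps_const (scal x))) = sc (c x)"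
    and nz: "\<xi> \<noteq> 0" "\<eta> \<noteq> 0" "1 / \<xi> - 1 / \<eta> \<noteq> 0" "1 / \<xi> - 1 / \<eta> \<noteq> c (kappa F N)"
    and J: "left_ideal J"
  shows "R_ring.rtt sc N (\<lambda>i. c (th F i)) (c (kappa F N)) J (1 / \<xi> - 1 / \<eta>)
        (\<lambda>i j. \<Phi> (bi_u (gen_series i j))) (\<lambda>i j. \<Phi> (fps_const (gen_series i j)))
     \<longleftrightarrow> (\<forall>i\<in>Idx N. \<forall>k\<in>Idx N. \<forall>j\<in>Idx N. \<forall>l\<in>Idx N. \<Phi> (rtt_cleared F N i k j l) \<in> J)"
proof -
  interpret \<Phi>: ring_morphism \<Phi> by fact
  interpret R: R_ring sc N "\<lambda>i. c (th F i)" e "c (kappa F N)" by fact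
  define a \<kappa> where "a = 1 / \<xi> - 1 / \<eta>" and "\<kappa> = c (kappa F N)"
  define \<rho> where "\<rho> = (\<eta> - \<xi>) * (\<eta> - \<xi> - \<kappa> * \<xi> * \<eta>)"
  have a: "a * (\<xi> * \<eta>) = \<eta> - \<xi>" "(a - \<kappa>) * (\<xi> * \<eta>) = \<eta> - \<xi> - \<kappa> * \<xi> * \<eta>"
    using nz(1,2) by (simp_all add: a_def field_simps)
  have nz': "a \<noteq> 0" "a - \<kappa> \<noteq> 0" "\<xi> * \<eta> \<noteq> 0" using nz by (simp_all add: a_def \<kappa>_def)
  have rho: "\<rho> = (a * (\<xi> * \<eta>)) * ((a - \<kappa>) * (\<xi> * \<eta>))" by (simp only: \<rho>_def a)
  have \<rho>0: "\<rho> \<noteq> 0" using nz' by (simp add: rho)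
  have \<rho>a: "\<xi> * \<eta> * (\<eta> - \<xi> - \<kappa> * \<xi> * \<eta>) = \<rho> * (1 / a)" "\<xi> * \<eta> * (\<eta> - \<xi>) = \<rho> * (1 / (a - \<kappa>))"
    unfolding rho a[symmetric] using nz' by (simp_all add: field_simps)
  let ?T = "\<lambda>i j. \<Phi> (bi_u (gen_series i j))" and ?T' = "\<lambda>i j. \<Phi> (fps_const (gen_series i j))"
  have main: "\<Phi> (rtt_cleared F N i k j l) = sc \<rho> * (?T i j * ?T' k l - ?T' k l * ?T i j - sc (1 / a) * (?T k j * ?T' i l - ?T' k j * ?T i l)
     + ((if k = - i then sc (c (th F i) / (a - \<kappa>)) * (\<Sum>p\<in>Idx N. sc (c (th F p)) * (?T p j * ?T' (- p) l)) else 0)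
       - (if l = - j then sc (c (th F j) / (a - \<kappa>)) * (\<Sum>p\<in>Idx N. sc (c (th F p)) * (?T' k (- p) * ?T i p)) else 0)))"
    for i k j l
  proof -
    define S1 S2 where "S1 = (\<Sum>p\<in>Idx N. sc (c (th F p)) * (?T p j * ?T' (- p) l))"
      and "S2 = (\<Sum>p\<in>Idx N. sc (c (th F p)) * (?T' k (- p) * ?T i p))"
    have if_Phi: "\<Phi> (if P then x else 0) = (if P then \<Phi> x else 0)" for P x by simp
    have "\<Phi> (rtt_cleared F N i k j l) = sc \<rho> * (?T i j * ?T' k l - ?T' k l * ?T i j)
        - sc (\<xi> * \<eta> * (\<eta> - \<xi> - \<kappa> * \<xi> * \<eta>)) * (?T k j * ?T' i l - ?T' k j * ?T i l)
        + sc (\<xi> * \<eta> * (\<eta> - \<xi>)) * ((if k = - i then sc (c (th F i)) * S1 else 0) - (if l = - j then sc (c (th F j)) * S2 else 0))"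
      unfolding rtt_cleared_def Let_def \<Phi>.add \<Phi>.diff \<Phi>.mult if_Phi \<Phi>.sum X Y C S1_def S2_def \<rho>_def \<kappa>_def
        R.sc.mult R.sc.diff ..
    also have "sc (\<xi> * \<eta> * (\<eta> - \<xi>)) * ((if k = - i then sc (c (th F i)) * S1 else 0) - (if l = - j then sc (c (th F j)) * S2 else 0))
      = sc \<rho> * ((if k = - i then sc (c (th F i) / (a - \<kappa>)) * S1 else 0) - (if l = - j then sc (c (th F j) / (a - \<kappa>)) * S2 else 0))"
      unfolding \<rho>a by (simp add: right_diff_distrib R.sc_mult_left)
    also have "sc (\<xi> * \<eta> * (\<eta> - \<xi> - \<kappa> * \<xi> * \<eta>)) * (?T k j * ?T' i l - ?T' k j * ?T i l)
        = sc \<rho> * (sc (1 / a) * (?T k j * ?T' i l - ?T' k j * ?T i l))"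
      unfolding \<rho>a R.sc_mult_left ..
    finally show ?thesis
      unfolding S1_def S2_def by (simp only: distrib_left right_diff_distrib)
  qed
  have iff: "sc \<rho> * x \<in> J \<longleftrightarrow> x \<in> J" for x
  proof
    assume "sc \<rho> * x \<in> J"
    then have "sc (1 / \<rho>) * (sc \<rho> * x) \<in> J" by (rule left_ideal.mult_left[OF J])
    then show "x \<in> J" using \<rho>0 by (simp add: R.sc_mult_left R.sc.one)
  qed (rule left_ideal.mult_left[OF J])
  show ?thesis
    unfolding R.rtt_def main iff a_def \<kappa>_def by (rule refl)
qed

lemma bi_subst_X: "\<xi> $ 0 = 0 \<Longrightarrow> bi_subst \<xi> \<eta> fps_X = bi_u (map_fps scal \<xi>)"
  using bi_subst_u[of \<xi> \<eta> fps_X] by (simp add: bi_u_X scal.eval_X)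

lemma bi_subst_Y: "\<eta> $ 0 = 0 \<Longrightarrow> bi_subst \<xi> \<eta> (fps_const fps_X) = fps_const (map_fps scal \<eta>)"
  by (simp add: bi_subst_v scal.eval_X)

lemma bi_subst_C: "bi_subst \<xi> \<eta> (fps_const (fps_const x)) = fps_const (fps_const x)"
  by (simp add: bi_subst_v scal.eval_const)

lemma at_v_const: "at_v (fps_const (scal c) :: 'g free fps) = sc2 (const2 c)"
proof -
  have "map_fps scal (fps_const c) = (fps_const (scal c) :: 'g free fps)"
    by (rule fps_ext) simp
  then have "at_v (fps_const (scal c) :: 'g free fps) = at_v (map_fps scal (fps_const c))"
    by (simp only:)
  then show ?thesis by (simp only: at_v_scal cv_simps(1))
qed

lemma R_free_eq:
  assumes "R_ring (sc2 :: _ \<Rightarrow> 'g free fls fls) N (\<lambda>i. const2 (th F i)) e (const2 (kappa F N))"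
    and "x \<in> Idx N \<times> Idx N" "y \<in> Idx N \<times> Idx N"
  shows "(R_free F N z x y :: 'g free fls fls) = R_ring.R sc2 (\<lambda>i. const2 (th F i)) (const2 (kappa F N)) z x y"
proof -
  interpret R_ring "sc2 :: _ \<Rightarrow> 'g free fls fls" N "\<lambda>i. const2 (th F i)" e "const2 (kappa F N)" by fact
  obtain i k j l where xy: "x = (i, k)" "y = (j, l)" by (cases x, cases y)
  then have "i \<in> Idx N" "j \<in> Idx N" using assms by auto
  note ij = this
  have if_div: "(if P then x else 0) / y = (if P then x / y else 0)" for P and x y :: "complex fls fls"
    by simp
  have if_const: "const2 (if P then x else 0) = (if P then const2 x else 0)" for P x
    by simp
  have "R_matrix F N z (i, k) (j, l) = (if i = j \<and> k = l then 1 else 0) - (if i = l \<and> k = j then 1 / z else 0)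
     + (if k = - i \<and> l = - j then const2 (th F i) * const2 (th F j) / (z - const2 (kappa F N)) else 0)"
    unfolding R_matrix_def P_op_eq[OF ij] Q_op_eq[OF ij] if_const if_div const2.one const2.mult prod.inject ..
  then show ?thesis
    unfolding R_free_def sc2_def[symmetric] R_def xy split_conv by (rule arg_cong)
qed

lemma mult2_cong:
  assumes "\<And>x y. x \<in> Idx N \<times> Idx N \<Longrightarrow> y \<in> Idx N \<times> Idx N \<Longrightarrow> A x y = A' x y"
    and "\<And>x y. x \<in> Idx N \<times> Idx N \<Longrightarrow> y \<in> Idx N \<times> Idx N \<Longrightarrow> B x y = B' x y"
    and "x \<in> Idx N \<times> Idx N" "y \<in> Idx N \<times> Idx N"
  shows "mult2 N A B x y = mult2 N A' B' x y"
  unfolding mult2_def using assms by (intro sum.cong refl) simp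

text \<open>Having all coefficients in the free ring is phrased as being fixed by a ring morphism,
  which makes closure under sums and products of series immediate.\<close>

definition stable2 :: "'g set \<Rightarrow> 'g free fls fls set" where
  "stable2 X = {f. map_fls (map_fls (restr X)) f = f}"

lemma map_restr2: "ring_morphism (map_fls (map_fls (restr X)))"
  by (intro ring_morphism.map_fls restr_morphism)

lemma stable2_iff: "f \<in> stable2 X \<longleftrightarrow> (\<forall>k l. f $$ k $$ l \<in> fcar X)"
proof -
  have "map_fls (restr X) 0 = 0" by (rule fls_eqI) simp
  then have "map_fls (map_fls (restr X)) f $$ k $$ l = restr X (f $$ k $$ l)" for k l by simp
  then show ?thesis
    unfolding stable2_def mem_Collect_eq fls_eq_iff restr_eq_iff[symmetric] by simp
qed

lemmas stable2_nth = stable2_iff[THEN iffD1, rule_format]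

lemma stable2_closed:
  "f \<in> stable2 X \<Longrightarrow> g \<in> stable2 X \<Longrightarrow> f * g \<in> stable2 X"
  "f \<in> stable2 X \<Longrightarrow> g \<in> stable2 X \<Longrightarrow> f - g \<in> stable2 X"
  "(\<And>a. a \<in> A \<Longrightarrow> F a \<in> stable2 X) \<Longrightarrow> sum F A \<in> stable2 X"
  "0 \<in> stable2 X"
proof -
  interpret m: ring_morphism "map_fls (map_fls (restr X))" by (rule map_restr2)
  show "f \<in> stable2 X \<Longrightarrow> g \<in> stable2 X \<Longrightarrow> f * g \<in> stable2 X"
    "f \<in> stable2 X \<Longrightarrow> g \<in> stable2 X \<Longrightarrow> f - g \<in> stable2 X"
    "(\<And>a. a \<in> A \<Longrightarrow> F a \<in> stable2 X) \<Longrightarrow> sum F A \<in> stable2 X"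
    "0 \<in> stable2 X"
    by (simp_all add: stable2_def m.mult m.diff m.sum)
qed

lemma stable2_R_free: "R_free F N z x y \<in> stable2 X"
  unfolding stable2_iff R_free_def sc2_def[symmetric] sc2_nth by (simp only: fcar_closed simp_thms)

lemma at_nth:
  "at_u f $$ k $$ l = (if 0 \<le> k \<and> l = 0 then f $ nat k else 0)"
  "at_v f $$ k $$ l = (if 0 \<le> l \<and> k = 0 then f $ nat l else 0)"
  by (simp_all add: at_u_def at_v_def)

lemma stable2_gens:
  assumes "i \<in> Idx N" "j \<in> Idx N"
  shows "at_u (gen_series i j) \<in> stable2 (gens N)" "at_v (gen_series i j) \<in> stable2 (gens N)"
proof -
  have "gen_series i j $ r \<in> fcar (gens N)" for r
    unfolding gen_series_def fps_nth_Abs_fps using assms by (intro fcar_closed) (simp add: gens_def)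
  then show "at_u (gen_series i j) \<in> stable2 (gens N)" "at_v (gen_series i j) \<in> stable2 (gens N)"
    unfolding stable2_iff at_nth by (simp_all add: fcar_closed(3))
qed

lemma stable2_mult2:
  assumes "\<And>x y. x \<in> Idx N \<times> Idx N \<Longrightarrow> y \<in> Idx N \<times> Idx N \<Longrightarrow> A x y \<in> stable2 X"
    and "\<And>x y. x \<in> Idx N \<times> Idx N \<Longrightarrow> y \<in> Idx N \<times> Idx N \<Longrightarrow> B x y \<in> stable2 X"
    and "x \<in> Idx N \<times> Idx N" "y \<in> Idx N \<times> Idx N"
  shows "mult2 N A B x y \<in> stable2 X"
  unfolding mult2_def using assms by (intro stable2_closed) auto

lemma stable2_in_first:
  assumes "x \<in> Idx N \<times> Idx N" "y \<in> Idx N \<times> Idx N"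
  shows "in_first (\<lambda>i j. at_u (gen_series i j)) x y \<in> stable2 (gens N)"
    "in_second (\<lambda>i j. at_v (gen_series i j)) x y \<in> stable2 (gens N)"
  using assms stable2_gens stable2_closed(4) by (auto simp: in_first_def in_second_def)

lemma eq_coeffs_fcar:
  assumes "\<And>x y. x \<in> Idx N \<times> Idx N \<Longrightarrow> y \<in> Idx N \<times> Idx N \<Longrightarrow> L x y \<in> stable2 X"
    and "\<And>x y. x \<in> Idx N \<times> Idx N \<Longrightarrow> y \<in> Idx N \<times> Idx N \<Longrightarrow> M x y \<in> stable2 X"
  shows "eq_coeffs N L M \<subseteq> fcar X"
proof
  fix f assume "f \<in> eq_coeffs N L M"
  then obtain x y k l where f: "f = (L x y - M x y) $$ k $$ l"
    and xy: "x \<in> Idx N \<times> Idx N" "y \<in> Idx N \<times> Idx N"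
    unfolding eq_coeffs_def by blast
  have "L x y - M x y \<in> stable2 X" by (intro stable2_closed(2) assms xy)
  then show "f \<in> fcar X" unfolding f by (rule stable2_nth)
qed

lemma fcar_diff: "f \<in> fcar X \<Longrightarrow> g \<in> fcar X \<Longrightarrow> f - g \<in> fcar X"
  unfolding restr_eq_iff[symmetric] by (simp only: restr.diff)

lemma RTT_rels_fcar: "RTT_rels F N \<subseteq> fcar (gens N)"
proof -
  have "gen (i, j, 0) - scal (if i = j then 1 else 0) \<in> fcar (gens N)" if "i \<in> Idx N" "j \<in> Idx N" for i j
    using that by (intro fcar_diff fcar_closed) (simp add: gens_def)
  moreover have "eq_coeffs N
      (mult2 N (mult2 N (R_free F N (var_u - var_v)) (in_first (\<lambda>i j. at_u (gen_series i j)))) (in_second (\<lambda>i j. at_v (gen_series i j))))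
      (mult2 N (mult2 N (in_second (\<lambda>i j. at_v (gen_series i j))) (in_first (\<lambda>i j. at_u (gen_series i j)))) (R_free F N (var_u - var_v)))
      \<subseteq> fcar (gens N)"
    by (intro eq_coeffs_fcar stable2_mult2 stable2_R_free stable2_in_first)
  ultimately show ?thesis unfolding RTT_rels_def Let_def by (intro Un_least) blast+
qed

lemma reflection_rels_fcar: "reflection_rels F N g \<subseteq> fcar (gens N)"
proof -
  have "gen (i, j, 0) - scal (if i = j then g i else 0) \<in> fcar (gens N)" if "i \<in> Idx N" "j \<in> Idx N" for i j
    using that by (intro fcar_diff fcar_closed) (simp add: gens_def)
  moreover have "eq_coeffs N
      (mult2 N (mult2 N (mult2 N (R_free F N (var_u - var_v)) (in_first (\<lambda>i j. at_u (gen_series i j)))) (R_free F N (var_u + var_v))) (in_second (\<lambda>i j. at_v (gen_series i j))))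
      (mult2 N (mult2 N (mult2 N (in_second (\<lambda>i j. at_v (gen_series i j))) (R_free F N (var_u + var_v))) (in_first (\<lambda>i j. at_u (gen_series i j)))) (R_free F N (var_u - var_v)))
      \<subseteq> fcar (gens N)"
    by (intro eq_coeffs_fcar stable2_mult2 stable2_R_free stable2_in_first)
  ultimately show ?thesis unfolding reflection_rels_def Let_def by (intro Un_least) blast+
qed

definition lift1 :: "'a::zero set \<Rightarrow> 'a fls set" where
  "lift1 J = {f. \<forall>k. f $$ k \<in> J}"

definition lift2 :: "'a::zero set \<Rightarrow> 'a fls fls set" where
  "lift2 J = {f. \<forall>k. \<forall>l. f $$ k $$ l \<in> J}"

lemma lift2_lift1: "lift2 J = lift1 (lift1 J)"
  by (auto simp: lift1_def lift2_def)

lemma left_ideal_lift1: "left_ideal J \<Longrightarrow> left_ideal (lift1 J)"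
  unfolding lift1_def by (rule left_ideal.lift_fls)

lemma left_ideal_lift2: "left_ideal J \<Longrightarrow> left_ideal (lift2 J)"
  unfolding lift2_lift1 by (intro left_ideal_lift1)

lemmas left_ideal_lift = left_ideal_lift1 left_ideal_lift2

lemma two_sided_lift1: "two_sided_ideal J \<Longrightarrow> two_sided_ideal (lift1 J)"
  unfolding lift1_def by (rule two_sided_ideal.lift_fls_two_sided)

lemma two_sided_lift2: "two_sided_ideal J \<Longrightarrow> two_sided_ideal (lift2 J)"
  unfolding lift2_lift1 by (intro two_sided_lift1)

section \<open>Functionals applied to matrix relations\<close>

locale functional = R_ring sc N \<theta> \<epsilon> \<kappa>
  for sc :: "'k::field \<Rightarrow> 'b::ring_1" and N and \<theta> :: "int \<Rightarrow> 'k" and \<epsilon> \<kappa> :: 'k +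
  fixes f :: "'b \<Rightarrow> 'k"
  assumes f_add: "f (x + y) = f x + f y" and f_sc: "f (sc c * x) = c * f x"
begin

lemma f_0: "f 0 = 0"
  using f_sc[of 0 0] by simp

lemma f_diff: "f (x - y) = f x - f y"
  using f_add[of "x - y" y] by simp

lemma f_sum: "f (sum g A) = (\<Sum>a\<in>A. f (g a))"
  by (induction A rule: infinite_finite_induct) (simp_all add: f_add f_0)

lemma f_if: "f (if P then x else 0) = (if P then f x else 0)"
  by (simp add: f_0)

lemma f_R_left:
  assumes "i \<in> Idx N" "k \<in> Idx N"
  shows "f ((R z \<bullet> Y) (i, k) c) = R_act z (\<lambda>i k. f (Y (i, k) c)) i k"
  unfolding R_left[OF assms] R_act_def f_add f_diff f_sc f_if f_sum by simp

lemma f_R_right: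
  assumes "j \<in> Idx N" "l \<in> Idx N"
  shows "f ((Y \<bullet> R z) c (j, l)) = R_act z (\<lambda>j l. f (Y c (j, l))) j l"
  unfolding R_right[OF assms] R_act_def f_add f_diff f_sc f_if f_sum by simp

lemma f_R_middle:
  assumes "i \<in> Idx N" "k \<in> Idx N" "j \<in> Idx N" "l \<in> Idx N"
  shows "f ((in_first X \<bullet> R z \<bullet> in_second Y) (i, k) (j, l)) = middle z (\<lambda>i j k l. f (X i j * Y k l)) i k j l"
    and "f ((in_second Y \<bullet> R z \<bullet> in_first X) (i, k) (j, l)) = middle z (\<lambda>k l i j. f (Y k l * X i j)) k i l j"
  unfolding mult2_assoc[symmetric] R_middle[OF assms] middle_def f_add f_diff f_sc f_if f_sum
  by (auto simp: eq_commute[of i l])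

lemma f_reflection:
  assumes "i \<in> Idx N" "k \<in> Idx N" "j \<in> Idx N" "l \<in> Idx N"
  shows "f ((R a \<bullet> in_first X \<bullet> R z \<bullet> in_second Y) (i, k) (j, l))
      = R_act a (\<lambda>i k. middle z (\<lambda>i j k l. f (X i j * Y k l)) i k j l) i k"
    and "f ((in_second Y \<bullet> R z \<bullet> in_first X \<bullet> R a) (i, k) (j, l))
      = R_act a (\<lambda>j l. middle z (\<lambda>k l i j. f (Y k l * X i j)) k i l j) j l"
proof -
  show "f ((R a \<bullet> in_first X \<bullet> R z \<bullet> in_second Y) (i, k) (j, l))
      = R_act a (\<lambda>i k. middle z (\<lambda>i j k l. f (X i j * Y k l)) i k j l) i k"
    unfolding f_R_left[OF assms(1,2)] using assms by (intro R_act_cong f_R_middle(1))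
  have "f (((in_second Y \<bullet> R z \<bullet> in_first X) \<bullet> R a) (i, k) (j, l))
      = R_act a (\<lambda>j l. middle z (\<lambda>k l i j. f (Y k l * X i j)) k i l j) j l"
    unfolding f_R_right[OF assms(3,4)] using assms by (intro R_act_cong f_R_middle(2))
  then show "f ((in_second Y \<bullet> R z \<bullet> in_first X \<bullet> R a) (i, k) (j, l))
      = R_act a (\<lambda>j l. middle z (\<lambda>k l i j. f (Y k l * X i j)) k i l j) j l"
    by (simp only: mult2_assoc)
qed

end

context R_ring
begin

lemma meq_by_functionals:
  assumes J: "left_ideal J"
    and f: "\<And>f x y. functional sc N \<theta> \<epsilon> \<kappa> f \<Longrightarrow> (\<And>w. w \<in> J \<Longrightarrow> f w = 0) \<Longrightarrow>
      x \<in> Idx N \<times> Idx N \<Longrightarrow> y \<in> Idx N \<times> Idx N \<Longrightarrow> f (X x y) = f (Y x y)"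
  shows "meq J X Y"
  unfolding meq_def
proof (intro ballI, rule ccontr)
  fix x y assume xy: "x \<in> Idx N \<times> Idx N" "y \<in> Idx N \<times> Idx N" and notin: "X x y - Y x y \<notin> J"
  obtain f where f1: "\<And>y z. f (y + z) = f y + f z" "\<And>c y. f (sc c * y) = c * f y"
    and f2: "\<And>y. y \<in> J \<Longrightarrow> f y = 0" "f (X x y - Y x y) \<noteq> 0"
    using subspace_separation[OF sc.central_morphism_axioms J notin] by metis
  interpret functional sc N \<theta> \<epsilon> \<kappa> f by unfold_locales (fact f1)+
  show False using f[OF functional_axioms f2(1) xy] f2(2) by (simp add: f_diff)
qed

lemma meq_functional:
  assumes "meq J X Y" "functional sc N \<theta> \<epsilon> \<kappa> f" "\<And>w. w \<in> J \<Longrightarrow> f w = 0"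
    "x \<in> Idx N \<times> Idx N" "y \<in> Idx N \<times> Idx N"
  shows "f (X x y) = f (Y x y)"
proof -
  interpret functional sc N \<theta> \<epsilon> \<kappa> f by fact
  have "f (X x y - Y x y) = 0" using assms by (auto simp: meq_def)
  then show ?thesis by (simp add: f_diff)
qed

text \<open>A functional takes the value c * f 1 at a scalar c, and nothing is known about f 1;
  hence the factor y, which is absorbed into g.\<close>

lemma meq_diag:
  assumes J: "left_ideal J" and K: "\<And>y. K_matrix_pair a z (\<lambda>i. y * g i) g'"
  shows "meq J (R a \<bullet> in_first (diag g) \<bullet> R z \<bullet> in_second (diag g'))
        (in_second (diag g') \<bullet> R z \<bullet> in_first (diag g) \<bullet> R a)"
proof (rule meq_by_functionals[OF J])
  fix f x y assume "functional sc N \<theta> \<epsilon> \<kappa> f" and xy: "x \<in> Idx N \<times> Idx N" "y \<in> Idx N \<times> Idx N"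
  interpret functional sc N \<theta> \<epsilon> \<kappa> f by fact
  obtain i k j l where ijkl: "x = (i, k)" "y = (j, l)" and I: "i \<in> Idx N" "k \<in> Idx N" "j \<in> Idx N" "l \<in> Idx N"
    using xy by auto
  have sc1: "f (sc c) = c * f 1" for c using f_sc[of c 1] by simp
  have "f (diag g i j * diag g' k l) = diag2 (\<lambda>i. f 1 * g i) g' i j k l" for i j k l
    by (simp add: diag_def diag2_def f_0 sc1 sc.mult[symmetric])
  moreover have "f (diag g' k l * diag g i j) = diag2 g' (\<lambda>i. f 1 * g i) k l i j" for i j k l
    by (simp add: diag_def diag2_def f_0 sc1 sc.mult[symmetric])
  ultimately show "f ((R a \<bullet> in_first (diag g) \<bullet> R z \<bullet> in_second (diag g')) x y)
      = f ((in_second (diag g') \<bullet> R z \<bullet> in_first (diag g) \<bullet> R a) x y)"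
    unfolding ijkl f_reflection[OF I] using reflection_diag2[OF K[of "f 1"] I] by simp
qed

end

text \<open>Linear independence of u, v and 1. The denominators that occur in two variables are
  affine in u and v, so this shows that they do not vanish.\<close>

lemma affine_neq:
  assumes "p \<noteq> 0 \<or> q \<noteq> 0 \<or> r \<noteq> 0"
  shows "const2 p * var_u + const2 q * var_v + const2 r \<noteq> 0"
proof
  assume 0: "const2 p * var_u + const2 q * var_v + const2 r = 0"
  have v: "const2 q * var_v = fls_const (fls_const q * fls_X_inv)"
    by (simp add: const2_def var_v_def)
  have u: "const2 p * var_u = fls_const (fls_const p) * fls_X_inv" by (simp add: const2_def var_u_def)
  have m: "(fls_const c * fls_X_inv) $$ k = (if k = - 1 then c else 0)" for c :: "'a::comm_ring_1" and k
    by auto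
  define w where "w = fls_const (fls_const p) * fls_X_inv + fls_const (fls_const q * fls_X_inv) + fls_const (fls_const r)"
  have w: "w = 0" using 0 unfolding w_def by (simp only: u v const2_def[of r])
  have "w $$ (- 1) = fls_const p" unfolding w_def fls_plus_nth m by simp
  then have "fls_const p $$ 0 = 0" by (simp only: w fls_zero_nth)
  then have "p = 0" by simp
  moreover have "w $$ 0 = fls_const q * fls_X_inv + fls_const r" unfolding w_def fls_plus_nth m by simp
  then have 1: "fls_const q * fls_X_inv + fls_const r = 0" by (simp only: w fls_zero_nth)
  have "q = 0" using arg_cong[OF 1, of "\<lambda>f. f $$ (- 1)"] by (simp add: m)
  moreover have "r = 0" using arg_cong[OF 1, of "\<lambda>f. f $$ 0"] by (simp add: m)
  ultimately show False using assms by blast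
qed

lemma affine_neq1:
  assumes "p \<noteq> 0 \<or> q \<noteq> 0"
  shows "fls_const p * fls_X_inv + fls_const q \<noteq> (0 :: complex fls)"
proof
  assume 0: "fls_const p * fls_X_inv + fls_const q = (0 :: complex fls)"
  have m: "(fls_const c * fls_X_inv) $$ k = (if k = - 1 then c else 0)" for c :: "complex" and k
    by auto
  have "p = 0" using arg_cong[OF 0, of "\<lambda>f. f $$ (- 1)"] by (simp add: m)
  moreover have "q = 0" using arg_cong[OF 0, of "\<lambda>f. f $$ 0"] by (simp add: m)
  ultimately show False using assms by blast
qed

lemma var_u_neq_0: "var_u \<noteq> 0" "var_v \<noteq> 0"
  using affine_neq[of 1 0 0] affine_neq[of 0 1 0] by (simp_all add: const2.one)

lemma fps_to_fls_const: "fps_to_fls (fps_const c) = fls_const c"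
  by (rule fls_eqI) auto

lemma sc1_const: "sc1 (fls_const x) = fls_const (scal x)"
  by (rule fls_eqI) (simp add: sc1_def)

lemma fps_to_fls_X: "fps_to_fls fps_X = 1 / (fls_X_inv :: complex fls)"
proof -
  have "fps_to_fls fps_X = (fls_X :: complex fls)" by (rule fls_eqI) auto
  then show ?thesis
    by (metis fls_X_inv_X eq_divide_eq mult.commute mult_zero_left zero_neq_one)
qed

lemma map_scal_X: "map_fps scal fps_X = (fps_X :: 'g free fps)"
  by (rule fps_ext) (simp add: fps_X_def scal.one)

lemma at_X: "at_u (fps_X :: 'g free fps) = sc2 (1 / var_u)" "at_v (fps_X :: 'g free fps) = sc2 (1 / var_v)"
  unfolding map_scal_X[symmetric] at_u_scal at_v_scal cu_simps cv_simps by (rule refl)+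

lemma pt_values:
  assumes "\<alpha> \<noteq> 0"
  shows "cu (pt \<alpha> \<beta>) = 1 / (const2 \<alpha> * var_u + const2 \<beta>)" "cv (pt \<alpha> \<beta>) = 1 / (const2 \<alpha> * var_v + const2 \<beta>)"
    "fps_to_fls (pt \<alpha> \<beta>) = 1 / (fls_const \<alpha> * fls_X_inv + fls_const \<beta>)"
    "const2 \<alpha> * var_u + const2 \<beta> \<noteq> 0" "const2 \<alpha> * var_v + const2 \<beta> \<noteq> 0"
    "fls_const \<alpha> * fls_X_inv + fls_const \<beta> \<noteq> 0"
proof -
  have X: "fls_X_inv \<noteq> (0 :: complex fls)"
    by (metis fls_X_inv_X mult_zero_left zero_neq_one)
  note c = affine_value[OF cu_morphism cu_simps(2) var_u_neq_0(1) assms, of \<beta>, unfolded cu_simps]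
    affine_value[OF cv_morphism cv_simps(2) var_u_neq_0(2) assms, of \<beta>, unfolded cv_simps]
    affine_value[OF ring_morphism_fps_to_fls fps_to_fls_X X assms, of \<beta>, unfolded fps_to_fls_const]
  show "cu (pt \<alpha> \<beta>) = 1 / (const2 \<alpha> * var_u + const2 \<beta>)" "cv (pt \<alpha> \<beta>) = 1 / (const2 \<alpha> * var_v + const2 \<beta>)"
    "fps_to_fls (pt \<alpha> \<beta>) = 1 / (fls_const \<alpha> * fls_X_inv + fls_const \<beta>)"
    "const2 \<alpha> * var_u + const2 \<beta> \<noteq> 0" "const2 \<alpha> * var_v + const2 \<beta> \<noteq> 0"
    "fls_const \<alpha> * fls_X_inv + fls_const \<beta> \<noteq> 0"
    by (fact c)+
qed

section \<open>The RTT relation at affine points\<close>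

locale yangian =
  fixes F :: lie_type and N :: nat
  assumes parity: "F = Sympl \<Longrightarrow> even N"
begin

sublocale yang: presentation "gens N" "RTT_rels F N"
  by unfold_locales (rule RTT_rels_fcar)

sublocale r2: R_ring sc2 N "\<lambda>i. const2 (th F i)" "const2 (ep F)" "const2 (kappa F N)"
  by (intro R_ring.intro sc2.central_morphism_axioms osp_index_Idx const2_morphism parity)

sublocale r1: R_ring sc1 N "\<lambda>i. fls_const (th F i)" "fls_const (ep F)" "fls_const (kappa F N)"
  by (intro R_ring.intro sc1.central_morphism_axioms osp_index_Idx ring_morphism_fls_const parity)

abbreviation "Y0 \<equiv> yang.full_ideal"

lemma left_Y0: "left_ideal Y0"
  using yang.two_sided_full_ideal by (simp add: two_sided_ideal_def)

lemma rtt_uv: "r2.rtt (lift2 Y0) (var_u - var_v) (\<lambda>i j. at_u (gen_series i j)) (\<lambda>i j. at_v (gen_series i j))"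
  unfolding r2.rtt_iff r2.meq_def
proof (intro ballI)
  fix x y assume xy: "x \<in> Idx N \<times> Idx N" "y \<in> Idx N \<times> Idx N"
  let ?T1 = "in_first (\<lambda>i j. at_u (gen_series i j))" and ?T2 = "in_second (\<lambda>i j. at_v (gen_series i j))"
  let ?R = "R_free F N (var_u - var_v)"
  have "mult2 N ?R (mult2 N ?T1 ?T2) x y = mult2 N (r2.R (var_u - var_v)) (mult2 N ?T1 ?T2) x y"
    using xy by (intro mult2_cong refl R_free_eq[OF r2.R_ring_axioms])
  moreover have "mult2 N (mult2 N ?T2 ?T1) ?R x y = mult2 N (mult2 N ?T2 ?T1) (r2.R (var_u - var_v)) x y"
    using xy by (intro mult2_cong refl R_free_eq[OF r2.R_ring_axioms])
  moreover have "(mult2 N (mult2 N ?R ?T1) ?T2 x y - mult2 N (mult2 N ?T2 ?T1) ?R x y) $$ k $$ l \<in> RTT_rels F N" for k l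
    unfolding RTT_rels_def Let_def eq_coeffs_def using xy by blast
  ultimately show "mult2 N (r2.R (var_u - var_v)) (mult2 N ?T1 ?T2) x y - mult2 N ?T2 (mult2 N ?T1 (r2.R (var_u - var_v))) x y \<in> lift2 Y0"
    using yang.Rel_full_ideal unfolding lift2_def mult2_assoc by simp
qed

text \<open>Here the relation leaves the Laurent series: its cleared form is a power series in both
  variables, whose coefficients can be read off and then substituted into.\<close>

lemma rtt_cleared_mem:
  assumes "i \<in> Idx N" "k \<in> Idx N" "j \<in> Idx N" "l \<in> Idx N"
  shows "rtt_cleared F N i k j l $ m $ n \<in> Y0"
proof -
  have bX: "bi_fls fps_X = sc2 (1 / var_u)"
    unfolding bi_u_X[symmetric] bi_fls_u at_X by (rule refl)
  have bY: "bi_fls (fps_const fps_X) = sc2 (1 / var_v)"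
    unfolding bi_fls_v at_X by (rule refl)
  have bC: "bi_fls (fps_const (fps_const (scal x))) = sc2 (const2 x)" for x
    unfolding bi_fls_v at_v_const by (rule refl)
  have nz: "1 / var_u \<noteq> 0" "1 / var_v \<noteq> 0" "1 / (1 / var_u) - 1 / (1 / var_v) \<noteq> 0"
      "1 / (1 / var_u) - 1 / (1 / var_v) \<noteq> const2 (kappa F N)"
    using var_u_neq_0 affine_neq[of 1 "- 1" 0] affine_neq[of 1 "- 1" "- kappa F N"]
    by (simp_all add: const2.one const2.uminus)
  have "bi_fls (rtt_cleared F N i k j l) \<in> lift2 Y0"
    using rtt_cleared_image[OF bi_fls_morphism r2.R_ring_axioms bX bY bC nz left_ideal_lift(2)[OF left_Y0]] rtt_uv assms
    unfolding bi_fls_u bi_fls_v by simp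
  then have "bi_fls (rtt_cleared F N i k j l) $$ int m $$ int n \<in> Y0" by (simp add: lift2_def)
  then show ?thesis by (simp add: bi_fls_nth)
qed

lemma bi_fls_mem:
  assumes "\<And>m n. c $ m $ n \<in> Y0"
  shows "bi_fls c \<in> lift2 Y0"
  using assms left_ideal.zero[OF left_Y0] by (simp add: lift2_def bi_fls_nth)

lemma rtt_point:
  fixes \<alpha> \<beta> \<alpha>' \<beta>'
  defines "a \<equiv> const2 \<alpha> * var_u + const2 \<beta> - (const2 \<alpha>' * var_v + const2 \<beta>')"
  assumes nz: "\<alpha> \<noteq> 0" "\<alpha>' \<noteq> 0"
  shows "r2.rtt (lift2 Y0) a (\<lambda>i j. at_u (subst_affine \<alpha> \<beta> (gen_series i j))) (\<lambda>i j. at_v (subst_affine \<alpha>' \<beta>' (gen_series i j)))"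
proof -
  let ?\<Phi> = "\<lambda>c. bi_fls (bi_subst (pt \<alpha> \<beta>) (pt \<alpha>' \<beta>') c)"
  have m: "ring_morphism ?\<Phi>"
    by (intro ring_morphism_comp[OF bi_fls_morphism] bi_subst_morphism pt_0 nz)
  have X: "?\<Phi> fps_X = sc2 (cu (pt \<alpha> \<beta>))"
    unfolding bi_subst_X[OF pt_0[OF nz(1)]] bi_fls_u at_u_scal by (rule refl)
  have Y: "?\<Phi> (fps_const fps_X) = sc2 (cv (pt \<alpha>' \<beta>'))"
    unfolding bi_subst_Y[OF pt_0[OF nz(2)]] bi_fls_v at_v_scal by (rule refl)
  have C: "?\<Phi> (fps_const (fps_const (scal x))) = sc2 (const2 x)" for x
    unfolding bi_subst_C bi_fls_v at_v_const by (rule refl)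
  have a: "1 / cu (pt \<alpha> \<beta>) - 1 / cv (pt \<alpha>' \<beta>') = a"
    by (simp add: pt_values nz a_def)
  have "a \<noteq> 0" "a \<noteq> const2 (kappa F N)"
    using affine_neq[of \<alpha> "- \<alpha>'" "\<beta> - \<beta>'"] affine_neq[of \<alpha> "- \<alpha>'" "\<beta> - \<beta>' - kappa F N"] nz
    by (auto simp: a_def const2.diff const2.add const2.uminus algebra_simps)
  then have "cu (pt \<alpha> \<beta>) \<noteq> 0" "cv (pt \<alpha>' \<beta>') \<noteq> 0" "1 / cu (pt \<alpha> \<beta>) - 1 / cv (pt \<alpha>' \<beta>') \<noteq> 0"
    "1 / cu (pt \<alpha> \<beta>) - 1 / cv (pt \<alpha>' \<beta>') \<noteq> const2 (kappa F N)"
    unfolding a using pt_values(4,5) nz by (simp_all add: pt_values)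
  note iff = rtt_cleared_image[OF m r2.R_ring_axioms X Y C this left_ideal_lift(2)[OF left_Y0]]
  have "?\<Phi> (rtt_cleared F N i k j l) \<in> lift2 Y0" if "i \<in> Idx N" "k \<in> Idx N" "j \<in> Idx N" "l \<in> Idx N" for i k j l
    by (intro bi_fls_mem bi_subst_mem left_Y0 rtt_cleared_mem that)
  then show ?thesis
    using iff unfolding a bi_subst_u bi_subst_v bi_fls_u bi_fls_v subst_affine_eval by simp
qed

lemma rtt_point_swapped:
  fixes \<alpha> \<beta> \<alpha>' \<beta>'
  defines "a \<equiv> const2 \<alpha> * var_v + const2 \<beta> - (const2 \<alpha>' * var_u + const2 \<beta>')"
  assumes nz: "\<alpha> \<noteq> 0" "\<alpha>' \<noteq> 0"
  shows "r2.rtt (lift2 Y0) a (\<lambda>i j. at_v (subst_affine \<alpha> \<beta> (gen_series i j))) (\<lambda>i j. at_u (subst_affine \<alpha>' \<beta>' (gen_series i j)))"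
proof -
  let ?\<Phi> = "\<lambda>c. bi_fls (bi_subst (pt \<alpha>' \<beta>') (pt \<alpha> \<beta>) (bi_swap c))"
  have m: "ring_morphism ?\<Phi>"
    by (intro ring_morphism_comp[OF bi_fls_morphism] ring_morphism_comp[OF bi_subst_morphism] bi_swap_morphism pt_0 nz)
  have X: "?\<Phi> fps_X = sc2 (cv (pt \<alpha> \<beta>))"
    unfolding bi_u_X[symmetric] bi_swap_u bi_subst_Y[OF pt_0[OF nz(1)]] bi_fls_v at_v_scal by (rule refl)
  have Y: "?\<Phi> (fps_const fps_X) = sc2 (cu (pt \<alpha>' \<beta>'))"
    unfolding bi_swap_v bi_u_X bi_subst_X[OF pt_0[OF nz(2)]] bi_fls_u at_u_scal by (rule refl)
  have C: "?\<Phi> (fps_const (fps_const (scal x))) = sc2 (const2 x)" for x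
    unfolding bi_swap_v bi_u_const bi_subst_C bi_fls_v at_v_const by (rule refl)
  have a: "1 / cv (pt \<alpha> \<beta>) - 1 / cu (pt \<alpha>' \<beta>') = a"
    by (simp add: pt_values nz a_def)
  have "a \<noteq> 0" "a \<noteq> const2 (kappa F N)"
    using affine_neq[of "- \<alpha>'" \<alpha> "\<beta> - \<beta>'"] affine_neq[of "- \<alpha>'" \<alpha> "\<beta> - \<beta>' - kappa F N"] nz
    by (auto simp: a_def const2.diff const2.add const2.uminus algebra_simps)
  then have "cv (pt \<alpha> \<beta>) \<noteq> 0" "cu (pt \<alpha>' \<beta>') \<noteq> 0" "1 / cv (pt \<alpha> \<beta>) - 1 / cu (pt \<alpha>' \<beta>') \<noteq> 0"
    "1 / cv (pt \<alpha> \<beta>) - 1 / cu (pt \<alpha>' \<beta>') \<noteq> const2 (kappa F N)"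
    unfolding a using pt_values(4,5) nz by (simp_all add: pt_values)
  note iff = rtt_cleared_image[OF m r2.R_ring_axioms X Y C this left_ideal_lift(2)[OF left_Y0]]
  have "bi_swap (rtt_cleared F N i k j l) $ m $ n \<in> Y0" if "i \<in> Idx N" "k \<in> Idx N" "j \<in> Idx N" "l \<in> Idx N" for i k j l m n
    using rtt_cleared_mem[OF that] by (simp add: bi_swap_def)
  then have "?\<Phi> (rtt_cleared F N i k j l) \<in> lift2 Y0" if "i \<in> Idx N" "k \<in> Idx N" "j \<in> Idx N" "l \<in> Idx N" for i k j l
    using that by (intro bi_fls_mem bi_subst_mem left_Y0)
  then show ?thesis
    using iff unfolding a bi_swap_u bi_swap_v bi_subst_u bi_subst_v bi_fls_u bi_fls_v subst_affine_eval by simp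
qed

text \<open>Both arguments use the same variable. The condition \<alpha> \<noteq> \<alpha>' makes
  their difference a nonconstant, so that it avoids the poles 0 and \<kappa>.\<close>

lemma rtt_point_diag:
  fixes \<alpha> \<beta> \<alpha>' \<beta>'
  defines "a \<equiv> fls_const \<alpha> * fls_X_inv + fls_const \<beta> - (fls_const \<alpha>' * fls_X_inv + fls_const \<beta>')"
  assumes nz: "\<alpha> \<noteq> 0" "\<alpha>' \<noteq> 0" "\<alpha> \<noteq> \<alpha>'"
  shows "r1.rtt (lift1 Y0) a (\<lambda>i j. fps_to_fls (subst_affine \<alpha> \<beta> (gen_series i j))) (\<lambda>i j. fps_to_fls (subst_affine \<alpha>' \<beta>' (gen_series i j)))"
proof -
  let ?\<Phi> = "\<lambda>c. fps_to_fls (bi_diag (bi_subst (pt \<alpha> \<beta>) (pt \<alpha>' \<beta>') c))"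
  have m: "ring_morphism ?\<Phi>"
    by (intro ring_morphism_comp[OF ring_morphism_fps_to_fls] ring_morphism_comp[OF bi_diag_morphism] bi_subst_morphism pt_0 nz)
  have X: "?\<Phi> fps_X = sc1 (fps_to_fls (pt \<alpha> \<beta>))"
    unfolding bi_subst_X[OF pt_0[OF nz(1)]] bi_diag_u fps_to_fls_scal by (rule refl)
  have Y: "?\<Phi> (fps_const fps_X) = sc1 (fps_to_fls (pt \<alpha>' \<beta>'))"
    unfolding bi_subst_Y[OF pt_0[OF nz(2)]] bi_diag_v fps_to_fls_scal by (rule refl)
  have C: "?\<Phi> (fps_const (fps_const (scal x))) = sc1 (fls_const x)" for x
    unfolding bi_subst_C bi_diag_v fps_to_fls_const sc1_const by (rule refl)
  have a: "1 / fps_to_fls (pt \<alpha> \<beta>) - 1 / fps_to_fls (pt \<alpha>' \<beta>') = a"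
    by (simp add: pt_values nz a_def)
  have "a \<noteq> 0" "a \<noteq> fls_const (kappa F N)"
    using affine_neq1[of "\<alpha> - \<alpha>'" "\<beta> - \<beta>'"] affine_neq1[of "\<alpha> - \<alpha>'" "\<beta> - \<beta>' - kappa F N"] nz
    by (auto simp: a_def fls_const.diff fls_const.add algebra_simps)
  then have "fps_to_fls (pt \<alpha> \<beta>) \<noteq> 0" "fps_to_fls (pt \<alpha>' \<beta>') \<noteq> 0" "1 / fps_to_fls (pt \<alpha> \<beta>) - 1 / fps_to_fls (pt \<alpha>' \<beta>') \<noteq> 0"
    "1 / fps_to_fls (pt \<alpha> \<beta>) - 1 / fps_to_fls (pt \<alpha>' \<beta>') \<noteq> fls_const (kappa F N)"
    unfolding a using pt_values(6) nz by (simp_all add: pt_values)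
  note iff = rtt_cleared_image[OF m r1.R_ring_axioms X Y C this left_ideal_lift(1)[OF left_Y0]]
  have "?\<Phi> (rtt_cleared F N i k j l) \<in> lift1 Y0" if "i \<in> Idx N" "k \<in> Idx N" "j \<in> Idx N" "l \<in> Idx N" for i k j l
  proof -
    have "bi_diag (bi_subst (pt \<alpha> \<beta>) (pt \<alpha>' \<beta>') (rtt_cleared F N i k j l)) $ n \<in> Y0" for n
      unfolding bi_diag_def fps_nth_Abs_fps
      by (intro left_ideal.sum[OF left_Y0] bi_subst_mem left_Y0 rtt_cleared_mem that)
    then show ?thesis using left_ideal.zero[OF left_Y0] by (simp add: lift1_def)
  qed
  then show ?thesis
    using iff unfolding a bi_subst_u bi_subst_v bi_diag_u bi_diag_v subst_affine_eval by simp
qed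

end

section \<open>The generating matrix of the twisted Yangian\<close>

lemma Idx_threshold:
  assumes "p \<le> N" "even p \<longleftrightarrow> even N" "i \<in> Idx N"
  shows "2 * \<bar>i\<bar> \<le> int p \<longleftrightarrow> i \<in> Idx p" and "odd p \<Longrightarrow> 2 * \<bar>i\<bar> \<le> int p - 1 \<longleftrightarrow> i \<in> Idx p"
proof -
  have "(2 * \<bar>i\<bar> \<le> int p \<longleftrightarrow> i \<in> Idx p) \<and> (odd p \<longrightarrow> (2 * \<bar>i\<bar> \<le> int p - 1 \<longleftrightarrow> i \<in> Idx p))"
  proof (cases "even p")
    case True
    then obtain m where "p = 2 * m" by (elim evenE)
    then show ?thesis using assms by (auto simp: Idx_def rank_def)
  next
    case False
    then obtain m where "p = 2 * m + 1" by (elim oddE)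
    then show ?thesis using assms by (auto simp: Idx_def rank_def)
  qed
  then show "2 * \<bar>i\<bar> \<le> int p \<longleftrightarrow> i \<in> Idx p" "odd p \<Longrightarrow> 2 * \<bar>i\<bar> \<le> int p - 1 \<longleftrightarrow> i \<in> Idx p"
    by blast+
qed

lemma sum_threshold:
  fixes x y :: complex
  assumes "p \<le> N" "even p \<longleftrightarrow> even N"
  shows "(\<Sum>i\<in>Idx N. if i \<in> Idx p then x else y) = of_nat p * x + (of_nat N - of_nat p) * y"
proof -
  have sub: "Idx p \<subseteq> Idx N" using assms by (auto simp: Idx_def rank_def)
  then have "Idx N \<inter> {i. i \<in> Idx p} = Idx p" "Idx N \<inter> - {i. i \<in> Idx p} = Idx N - Idx p" by auto
  then show ?thesis
    using assms(1) by (simp add: sum.If_cases finite_Idx card_Idx card_Diff_subset[OF finite_Idx sub] of_nat_diff)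
qed

definition linear_ratio :: "complex \<Rightarrow> complex \<Rightarrow> complex fps" where
  "linear_ratio c g = (fps_X - fps_const (c * g)) / (fps_X - fps_const c)"

text \<open>The nine types have three shapes of G(u): the identity, a constant traceless matrix with
  square 1, and (I - c u G)/(1 - c u) with c tr G = 4. The diagonal of G is even or odd under
  negation of the index, which \<delta> records in the second shape.\<close>

lemma type_cases:
  assumes "of_type F N t"
  obtains (const) "\<And>i. g_series t i = 1" "\<And>i. g_diag t i = 1"
  | (traceless) \<delta> where "\<And>i. g_series t i = fps_const (g_diag t i)"
      "\<And>i. i \<in> Idx N \<Longrightarrow> g_diag t i * g_diag t i = 1" "\<And>i. g_diag t (- i) = \<delta> * g_diag t i"
      "\<delta> * \<delta> = 1" "(\<Sum>i\<in>Idx N. g_diag t i) = 0"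
  | (linear) c where "\<And>i. g_series t i = linear_ratio c (g_diag t i)"
      "\<And>i. g_diag t i * g_diag t i = 1" "\<And>i. g_diag t (- i) = g_diag t i"
      "c \<noteq> 0" "c * (\<Sum>i\<in>Idx N. g_diag t i) = 4"
proof -
  have sgn_sum: "(\<Sum>i\<in>Idx N. of_int (sgn i) :: complex) = 0"
  proof -
    have "(\<Sum>i\<in>Idx N. of_int (sgn i) :: complex) = (\<Sum>i\<in>Idx N. - of_int (sgn i))"
      by (rule sum.reindex_bij_witness[of _ uminus uminus]) (auto simp: neg_Idx sgn_minus)
    then show ?thesis by (simp add: sum_negf)
  qed
  have sgn_sq: "even N \<Longrightarrow> i \<in> Idx N \<Longrightarrow> of_int (sgn i) * of_int (sgn i) = (1 :: complex)" for i
    by (auto simp: Idx_def sgn_if)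
  have up: "(\<Sum>i\<in>Idx N. if 2 * \<bar>i\<bar> \<le> int p then 1 else - 1 :: complex) = of_nat p - of_nat q"
    if "p + q = N" "even p" "even q" for p q
  proof -
    have "(\<Sum>i\<in>Idx N. if 2 * \<bar>i\<bar> \<le> int p then 1 else - 1 :: complex) = (\<Sum>i\<in>Idx N. if i \<in> Idx p then 1 else - 1)"
      using that Idx_threshold(1)[of p N] by (intro sum.cong refl) auto
    also have "\<dots> = of_nat p - of_nat q" using that by (subst sum_threshold) (auto simp: that(1)[symmetric])
    finally show ?thesis .
  qed
  \<comment> \<open>x = 1 serves BI(a); x = -1, with p and q exchanged, serves BI(b).\<close>
  have up_odd: "(\<Sum>i\<in>Idx N. if 2 * \<bar>i\<bar> \<le> int p - 1 then x else - x :: complex) = (of_nat p - of_nat q) * x"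
    if "p + q = N" "odd p" "even q" for p q x
  proof -
    have "(\<Sum>i\<in>Idx N. if 2 * \<bar>i\<bar> \<le> int p - 1 then x else - x :: complex) = (\<Sum>i\<in>Idx N. if i \<in> Idx p then x else - x)"
      using that Idx_threshold(2)[of p N] by (intro sum.cong refl) auto
    also have "\<dots> = (of_nat p - of_nat q) * x"
      using that by (subst sum_threshold) (auto simp: that(1)[symmetric] algebra_simps)
    finally show ?thesis .
  qed
  have lin: thesis if "\<And>i. g_series t i = g_ratio p q (g_diag t i)" "p \<noteq> q" "\<And>i. g_diag t i * g_diag t i = 1"
    "\<And>i. g_diag t (- i) = g_diag t i" "(\<Sum>i\<in>Idx N. g_diag t i) = of_nat p - of_nat q" for p q
  proof -
    define d c where "d = (of_nat p - of_nat q :: complex)" and "c = 4 / d"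
    have d: "d \<noteq> 0" using that(2) by (simp add: d_def)
    have "g_series t i = linear_ratio c (g_diag t i)" for i
      unfolding that(1) g_ratio_def Let_def linear_ratio_def c_def d_def ..
    moreover have "c * (\<Sum>i\<in>Idx N. g_diag t i) = 4" "c \<noteq> 0"
      unfolding that(5) d_def[symmetric] c_def using d by simp_all
    ultimately show thesis using that(3,4) linear[of c] by blast
  qed
  show thesis
  proof (cases t)
    case CI
    then show ?thesis using assms sgn_sum sgn_sq by (intro traceless[of "- 1"]) (auto simp: sgn_minus)
  next
    case DIII
    then show ?thesis using assms sgn_sum sgn_sq by (intro traceless[of "- 1"]) (auto simp: sgn_minus)
  next
    case (BIa p q)
    then show ?thesis using assms up_odd[of p q 1] by (intro lin[of p q]) auto
  next
    case (BIb p q)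
    then show ?thesis using assms up_odd[of q p "- 1", unfolded minus_minus] by (intro lin[of p q]) (auto simp: add.commute)
  next
    case (CII p q)
    show ?thesis
    proof (cases "p = q")
      case True
      then show ?thesis using CII assms up[of p q] by (intro traceless[of 1]) auto
    next
      case False
      then show ?thesis using CII assms up[of p q] by (intro lin[of p q]) auto
    qed
  next
    case (DIa p q)
    show ?thesis
    proof (cases "p = q")
      case True
      then show ?thesis using DIa assms up[of p q] by (intro traceless[of 1]) auto
    next
      case False
      then show ?thesis using DIa assms up[of p q] by (intro lin[of p q]) auto
    qed
  qed (use const in \<open>simp_all\<close>)
qed

lemma linear_ratio_mult:
  assumes "c \<noteq> 0"
  shows "linear_ratio c g * (fps_X - fps_const c) = fps_X - fps_const (c * g)"
  using assms by (simp add: linear_ratio_def fps_divide_unit mult.assoc inverse_mult_eq_1)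

text \<open>The value in a field in which u has become U. The inverse of 1 - c U is kept as a
  prefactor independent of g, to match the factor x in the lemmas on diagonal solutions.\<close>

lemma linear_ratio_value:
  fixes e :: "complex fps \<Rightarrow> 'k::field"
  assumes "ring_morphism e" "c \<noteq> 0" "p $ 0 = 0" "e p = 1 / U" "U \<noteq> 0" "1 - e (fps_const c) * U \<noteq> 0"
  shows "e (linear_ratio c g oo p) = inverse (1 - e (fps_const c) * U) * (1 - e (fps_const c) * U * e (fps_const g))"
proof -
  interpret e: ring_morphism e by fact
  have "(linear_ratio c g * (fps_X - fps_const c)) oo p = (fps_X - fps_const (c * g)) oo p"
    by (simp only: linear_ratio_mult[OF assms(2)])
  then have "(linear_ratio c g oo p) * (p - fps_const c) = p - fps_const c * fps_const g"
    using assms(3) by (simp add: fps_compose_mult_distrib fps_compose_sub_distrib)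
  then have "e (linear_ratio c g oo p) * (e p - e (fps_const c)) = e p - e (fps_const c) * e (fps_const g)"
    by (simp only: e.mult[symmetric] e.diff[symmetric])
  then have "e (linear_ratio c g oo p) * (e p - e (fps_const c)) * U = (e p - e (fps_const c) * e (fps_const g)) * U"
    by simp
  then have "e (linear_ratio c g oo p) * (1 - e (fps_const c) * U) = 1 - e (fps_const c) * U * e (fps_const g)"
    using assms(4,5) by (simp add: left_diff_distrib right_diff_distrib mult_ac)
  then have "e (linear_ratio c g oo p) = (1 - e (fps_const c) * U * e (fps_const g)) / (1 - e (fps_const c) * U)"
    by (simp only: nonzero_eq_divide_eq[OF assms(6)])
  then show ?thesis by (simp only: divide_inverse mult.commute)
qed

lemma subst_affine_0: "subst_affine \<alpha> \<beta> f $ 0 = f $ 0"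
  by (simp add: subst_affine_eval scal.eval_def scal.one)

lemma th_neg_neg: "theta F (- j) (- k) = th F k * th F j"
  by (cases F) (simp_all add: sgn_minus)

context yangian
begin

abbreviation "s \<equiv> s_series F N"

lemma s_subst:
  assumes "\<alpha> \<noteq> 0"
  shows "subst_affine \<alpha> \<beta> (s t i j) = (\<Sum>k\<in>Idx N. subst_affine \<alpha> (\<beta> - kappa F N / 2) (gen_series i k)
      * map_fps scal (g_series t k oo pt \<alpha> \<beta>)
      * (map_fps scal (fps_const (th F k * th F j)) * subst_affine (- \<alpha>) (kappa F N / 2 - \<beta>) (gen_series (- j) (- k))))"
proof -
  interpret e: ring_morphism "scal.eval (pt \<alpha> \<beta>) :: idx free fps \<Rightarrow> _"
    by (rule scal.eval_morphism[OF pt_0[OF assms]])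
  have 1: "scal.eval (pt \<alpha> \<beta>) (scal.eval (pt 1 (- kappa F N / 2)) f) = scal.eval (pt \<alpha> (\<beta> - kappa F N / 2)) f"
    for f :: "idx free fps"
    using assms by (simp add: scal.eval_eval pt_0 pt_compose)
  have 2: "scal.eval (pt \<alpha> \<beta>) (scal.eval (pt (- 1) (kappa F N / 2)) f) = scal.eval (pt (- \<alpha>) (kappa F N / 2 - \<beta>)) f"
    for f :: "idx free fps"
    using assms by (simp add: scal.eval_eval pt_0 pt_compose)
  have 3: "scal.eval (pt (- \<alpha>) b) (map_fps scal (fps_const c) * f) = map_fps scal (fps_const c) * scal.eval (pt (- \<alpha>) b) f"
    for b c and f :: "idx free fps"
    using assms by (simp add: scal.eval_mult pt_0 scal.eval_map_fps)
  show ?thesis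
    unfolding s_series_def subst_affine_eval e.sum e.mult transp_def 1 2 3 th_neg_neg
    using assms by (simp add: scal.eval_map_fps pt_0)
qed

text \<open>Brings S at a shifted argument into the form T G \<open>tr t\<close> that
  \<open>reflection_from_rtt\<close> and \<open>symmetry\<close> ask for.\<close>

lemma s_image:
  fixes sc :: "'k::field \<Rightarrow> 'b::ring_1"
  assumes \<Psi>: "ring_morphism \<Psi>" and c: "ring_morphism c" and R: "R_ring sc N (\<lambda>i. c (th F i)) e' \<kappa>'"
    and scal: "\<And>f. \<Psi> (map_fps scal f) = sc (e f)" and const: "\<And>x. e (fps_const x) = c x" and \<alpha>: "\<alpha> \<noteq> 0"
  shows "\<Psi> (subst_affine \<alpha> \<beta> (s t i j)) = (\<Sum>k\<in>Idx N. \<Psi> (subst_affine \<alpha> (\<beta> - kappa F N / 2) (gen_series i k))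
      * sc (e (g_series t k oo pt \<alpha> \<beta>))
      * R_ring.tr sc (\<lambda>i. c (th F i)) (\<lambda>i j. \<Psi> (subst_affine (- \<alpha>) (kappa F N / 2 - \<beta>) (gen_series i j))) k j)"
proof -
  interpret \<Psi>: ring_morphism \<Psi> by fact
  interpret c: ring_morphism c by fact
  interpret R: R_ring sc N "\<lambda>i. c (th F i)" e' \<kappa>' by fact
  show ?thesis
    unfolding s_subst[OF \<alpha>] R.tr_def \<Psi>.sum \<Psi>.mult scal const c.mult by (rule refl)
qed

definition shat :: "sym_type \<Rightarrow> int \<Rightarrow> int \<Rightarrow> idx free fps" where
  "shat t i j = subst_affine 1 (1/2) (s t i j)"

definition g_u :: "sym_type \<Rightarrow> int \<Rightarrow> complex fls fls" where
  "g_u t i = cu (g_series t i oo pt 1 (1/2))"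

definition g_v :: "sym_type \<Rightarrow> int \<Rightarrow> complex fls fls" where
  "g_v t i = cv (g_series t i oo pt 1 (1/2))"

lemma half2: "const2 (1/2) + const2 (1/2) = 1"
  unfolding const2.add[symmetric] by (simp add: const2.one)

lemma K_pair:
  assumes "of_type F N t"
  shows "r2.K_matrix_pair (var_u - var_v) (var_u + var_v + 1) (\<lambda>i. y * g_u t i) (g_v t)"
  using assms
proof (cases rule: type_cases)
  case const
  then show ?thesis
    using r2.K_matrix_pair_const[of _ _ y 1] by (simp add: g_u_def[abs_def] g_v_def[abs_def] cu.one cv.one)
next
  case (traceless \<delta>)
  have g: "g_u t = (\<lambda>i. const2 (g_diag t i))" "g_v t = (\<lambda>i. 1 * const2 (g_diag t i))"
    by (simp_all add: g_u_def[abs_def] g_v_def[abs_def] traceless(1) cu_simps cv_simps)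
  show ?thesis unfolding g
    using traceless
    by (intro r2.K_matrix_pair_traceless[where \<delta> = "const2 \<delta>"])
      (simp_all add: const2.mult[symmetric] const2.one const2.sum[symmetric])
next
  case (linear c)
  \<comment> \<open>U and V are u + 1/2 and v + 1/2, so U + V = u + v + 1, the argument of the
    middle R.\<close>
  define U V where "U = const2 1 * var_u + const2 (1/2)" and "V = const2 1 * var_v + const2 (1/2)"
  have UV: "var_u - var_v = U - V" "var_u + var_v + 1 = U + V"
    using half2 by (simp_all add: U_def V_def const2.one)
  have nzU: "1 - cu (fps_const c) * U \<noteq> 0"
    using affine_neq[of "- c" 0 "1 - c / 2"] linear(4)
    by (simp add: U_def cu_simps const2.one const2.diff const2.uminus distrib_left const2.mult[symmetric] algebra_simps)
  have nzV: "1 - cv (fps_const c) * V \<noteq> 0"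
    using affine_neq[of 0 "- c" "1 - c / 2"] linear(4)
    by (simp add: V_def cv_simps const2.one const2.diff const2.uminus distrib_left const2.mult[symmetric] algebra_simps)
  have g: "g_u t i = inverse (1 - const2 c * U) * (1 - const2 c * U * const2 (g_diag t i))"
    "g_v t i = inverse (1 - const2 c * V) * (1 - const2 c * V * const2 (g_diag t i))" for i
    unfolding g_u_def g_v_def linear(1)
    using linear_ratio_value[OF cu_morphism linear(4) pt_0 pt_values(1)[of 1 "1/2"] pt_values(4)[of 1 "1/2"] nzU[unfolded U_def]]
      linear_ratio_value[OF cv_morphism linear(4) pt_0 pt_values(2)[of 1 "1/2"] pt_values(5)[of 1 "1/2"] nzV[unfolded V_def]]
    by (simp_all add: U_def V_def cu_simps cv_simps)
  have nz: "U - V \<noteq> 0" "U + V \<noteq> 0" "U - V \<noteq> const2 (kappa F N)" "U + V \<noteq> const2 (kappa F N)"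
    unfolding UV[symmetric]
    using affine_neq[of 1 "- 1" 0] affine_neq[of 1 1 1] affine_neq[of 1 "- 1" "- kappa F N"] affine_neq[of 1 1 "1 - kappa F N"]
    by (auto simp: const2.one const2.uminus const2.diff algebra_simps)
  have "const2 c * (\<Sum>i\<in>Idx N. const2 (g_diag t i)) = const2 4"
    using linear(5) by (simp only: const2.mult[symmetric] const2.sum[symmetric])
  moreover have "const2 4 = 4"
    using const2.add[of 2 2] const2.add[of 1 1] by (simp add: const2.one)
  ultimately have tr: "const2 c * (\<Sum>i\<in>Idx N. const2 (g_diag t i)) = 4" by simp
  have gv: "g_v t = (\<lambda>i. inverse (1 - const2 c * V) * (1 - const2 c * V * const2 (g_diag t i)))"
    by (rule ext) (rule g)
  show ?thesis unfolding g(1) gv mult.assoc[symmetric, of y] UV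
    by (rule r2.K_matrix_pair_linear[OF _ _ tr refl refl nz])
      (simp_all add: linear const2.mult[symmetric] const2.one)
qed

theorem reflection_shat:
  assumes "of_type F N t"
  shows "r2.meq (lift2 Y0)
    (mult2 N (r2.R (var_u - var_v)) (mult2 N (in_first (\<lambda>i j. at_u (shat t i j)))
      (mult2 N (r2.R (var_u + var_v + 1)) (in_second (\<lambda>i j. at_v (shat t i j))))))
    (mult2 N (in_second (\<lambda>i j. at_v (shat t i j))) (mult2 N (r2.R (var_u + var_v + 1))
      (mult2 N (in_first (\<lambda>i j. at_u (shat t i j))) (r2.R (var_u - var_v)))))"
proof (rule r2.reflection_from_rtt[OF two_sided_lift2[OF yang.two_sided_full_ideal]])
  \<comment> \<open>T is taken at u + \<open>?b\<close> and its transpose at -u - \<open>?b\<close>.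
    The difference of the arguments of t and \<open>T'\<close> is therefore -u - v - 2
    \<open>?b\<close>, which equals \<kappa> - (u + v + 1), as \<open>transposed_first\<close>
    requires.\<close>
  let ?b = "1/2 - kappa F N / 2" and ?b' = "kappa F N / 2 - 1/2"
  have b: "const2 ?b' = - const2 ?b" "const2 (- 1) = - 1" "const2 1 = 1"
    unfolding const2.uminus[symmetric] by (simp_all add: const2.one const2.uminus)
  have z: "const2 (kappa F N) - (var_u + var_v + 1) = - var_u - var_v - const2 ?b - const2 ?b"
  proof -
    have "const2 ?b + const2 ?b = 1 - const2 (kappa F N)"
      by (simp only: const2.add[symmetric] const2.one[symmetric] const2.diff[symmetric]) simp
    then show ?thesis by (simp add: algebra_simps)
  qed
  show "r2.rtt (lift2 Y0) (var_u - var_v) (\<lambda>i j. at_u (subst_affine 1 ?b (gen_series i j))) (\<lambda>i j. at_v (subst_affine 1 ?b (gen_series i j)))"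
    using rtt_point[of 1 1 ?b ?b] by (simp add: b)
  show "r2.rtt (lift2 Y0) (const2 (kappa F N) - (var_u + var_v + 1)) (\<lambda>i j. at_u (subst_affine (- 1) ?b' (gen_series i j))) (\<lambda>i j. at_v (subst_affine 1 ?b (gen_series i j)))"
  proof -
    have "const2 (- 1) * var_u + const2 ?b' - (const2 1 * var_v + const2 ?b) = const2 (kappa F N) - (var_u + var_v + 1)"
      unfolding z by (simp add: b algebra_simps)
    then show ?thesis using rtt_point[of "- 1" 1 ?b' ?b] by simp
  qed
  show "r2.rtt (lift2 Y0) (const2 (kappa F N) - (var_u + var_v + 1)) (\<lambda>i j. at_v (subst_affine (- 1) ?b' (gen_series i j))) (\<lambda>i j. at_u (subst_affine 1 ?b (gen_series i j)))"
  proof -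
    have "const2 (- 1) * var_v + const2 ?b' - (const2 1 * var_u + const2 ?b) = const2 (kappa F N) - (var_u + var_v + 1)"
      unfolding z by (simp add: b algebra_simps)
    then show ?thesis using rtt_point_swapped[of "- 1" 1 ?b' ?b] by simp
  qed
  show "r2.rtt (lift2 Y0) (var_u - var_v) (\<lambda>i j. at_v (subst_affine (- 1) ?b' (gen_series i j))) (\<lambda>i j. at_u (subst_affine (- 1) ?b' (gen_series i j)))"
    using rtt_point_swapped[of "- 1" "- 1" ?b' ?b'] by (simp add: b)
  show "r2.meq (lift2 Y0) (mult2 N (r2.R (var_u - var_v)) (mult2 N (in_first (r2.diag (g_u t)))
      (mult2 N (r2.R (var_u + var_v + 1)) (in_second (r2.diag (g_v t))))))
    (mult2 N (in_second (r2.diag (g_v t))) (mult2 N (r2.R (var_u + var_v + 1))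
      (mult2 N (in_first (r2.diag (g_u t))) (r2.R (var_u - var_v)))))"
    by (intro r2.meq_diag left_ideal_lift2 left_Y0 K_pair assms)
  show "(\<lambda>i j. at_u (shat t i j)) = (\<lambda>i j. \<Sum>p\<in>Idx N. at_u (subst_affine 1 ?b (gen_series i p)) * sc2 (g_u t p)
      * r2.tr (\<lambda>i j. at_u (subst_affine (- 1) ?b' (gen_series i j))) p j)"
    unfolding shat_def g_u_def
    by (intro ext s_image[OF at_u_morphism const2_morphism r2.R_ring_axioms at_u_scal cu_simps(1)]) simp
  show "(\<lambda>i j. at_v (shat t i j)) = (\<lambda>i j. \<Sum>p\<in>Idx N. at_v (subst_affine 1 ?b (gen_series i p)) * sc2 (g_v t p)
      * r2.tr (\<lambda>i j. at_v (subst_affine (- 1) ?b' (gen_series i j))) p j)"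
    unfolding shat_def g_v_def
    by (intro ext s_image[OF at_v_morphism const2_morphism r2.R_ring_axioms at_v_scal cv_simps(1)]) simp
qed

text \<open>The partner of U = u + 1/2 is W = \<kappa> - U, and the difference of the arguments of T
  and of its transpose is 2 U - \<kappa>.\<close>

lemma K_symm:
  assumes "of_type F N t"
  shows "r1.K_symmetric (fls_const 1 * fls_X_inv + fls_const (1/2 - kappa F N / 2) - (fls_const (- 1) * fls_X_inv + fls_const (kappa F N / 2 - 1/2)))
     (\<lambda>i. fps_to_fls (g_series t i oo pt 1 (1/2))) (\<lambda>i. fps_to_fls (g_series t i oo pt (- 1) (kappa F N - 1/2)))"
    (is "r1.K_symmetric ?a _ _")
  using assms
proof (cases rule: type_cases)
  case const
  then show ?thesis using r1.K_symmetric_const[of 1 _ 1] by simp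
next
  case (traceless \<delta>)
  have "r1.K_symmetric ?a (\<lambda>i. 1 * fls_const (g_diag t i)) (\<lambda>i. 1 * fls_const (g_diag t i))"
    using traceless
    by (intro r1.K_symmetric_traceless[where \<delta> = "fls_const \<delta>"])
      (simp_all add: fls_const.sum[symmetric])
  then show ?thesis by (simp add: traceless(1) fps_to_fls_const)
next
  case (linear c)
  define U where "U = fls_const 1 * fls_X_inv + fls_const (1/2 :: complex)"
  define W where "W = fls_const (- 1) * fls_X_inv + fls_const (kappa F N - 1/2)"
  have W: "W = fls_const (kappa F N) - U" by (simp add: W_def U_def fls_const.diff fls_const.uminus)
  have a: "?a = 2 * U - fls_const (kappa F N)"
  proof -
    have "fls_const (1/2 - kappa F N / 2) - fls_const (kappa F N / 2 - 1/2) = fls_const (1 - kappa F N)"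
      by (simp only: fls_const.diff[symmetric]) simp
    moreover have "2 * fls_const (1/2 :: complex) = 1"
      unfolding mult_2 fls_const.add[symmetric] by simp
    ultimately show ?thesis by (simp add: U_def fls_const.diff fls_const.uminus algebra_simps)
  qed
  have nzU: "1 - fps_to_fls (fps_const c) * U \<noteq> 0"
    using affine_neq1[of "- c" "1 - c / 2"] linear(4)
    by (simp add: U_def fps_to_fls_const fls_const.diff fls_const.uminus distrib_left fls_const.mult[symmetric] algebra_simps)
  have nzW: "1 - fps_to_fls (fps_const c) * W \<noteq> 0"
    using affine_neq1[of "c" "1 - c * (kappa F N - 1/2)"] linear(4)
    by (simp add: W_def fps_to_fls_const fls_const.add fls_const.diff fls_const.uminus distrib_left fls_const.mult[symmetric] algebra_simps)
  have g: "fps_to_fls (g_series t i oo pt 1 (1/2)) = inverse (1 - fls_const c * U) * (1 - fls_const c * U * fls_const (g_diag t i))"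
    "fps_to_fls (g_series t i oo pt (- 1) (kappa F N - 1/2)) = inverse (1 - fls_const c * W) * (1 - fls_const c * W * fls_const (g_diag t i))" for i
    unfolding linear(1)
    using linear_ratio_value[OF ring_morphism_fps_to_fls linear(4) pt_0 pt_values(3)[of 1 "1/2"] pt_values(6)[of 1 "1/2"] nzU[unfolded U_def]]
      linear_ratio_value[OF ring_morphism_fps_to_fls linear(4) pt_0 pt_values(3)[of "- 1" "kappa F N - 1/2"] pt_values(6)[of "- 1" "kappa F N - 1/2"] nzW[unfolded W_def]]
    by (simp_all add: U_def W_def fps_to_fls_const)
  have "fls_const c * (\<Sum>i\<in>Idx N. fls_const (g_diag t i)) = fls_const 4"
    using linear(5) by (simp only: fls_const.mult[symmetric] fls_const.sum[symmetric])
  moreover have "fls_const 4 = (4 :: complex fls)"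
    using fls_const.add[of "2 :: complex" 2] fls_const.add[of "1 :: complex" 1] by simp
  ultimately have tr: "fls_const c * (\<Sum>i\<in>Idx N. fls_const (g_diag t i)) = 4" by simp
  have nz: "2 * U - fls_const (kappa F N) \<noteq> 0" "U \<noteq> fls_const (kappa F N)" "inverse (1 - fls_const c * W) \<noteq> 0" "(2 :: complex fls) \<noteq> 0"
  proof -
    have "fls_const 2 = (2 :: complex fls)" using fls_const.add[of "1 :: complex" 1] by simp
    then show 2: "(2 :: complex fls) \<noteq> 0" by (metis fls_const_nonzero zero_neq_numeral)
    show "2 * U - fls_const (kappa F N) \<noteq> 0"
    proof -
      have "2 * fls_const (1/2 :: complex) = 1"
        unfolding mult_2 fls_const.add[symmetric] by simp
      moreover have "2 * U = 2 * fls_X_inv + 2 * fls_const (1/2)"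
        unfolding U_def distrib_left by simp
      moreover have "fls_const (1 - kappa F N) = 1 - fls_const (kappa F N)"
        unfolding fls_const.diff by simp
      ultimately have "2 * U - fls_const (kappa F N) = fls_const 2 * fls_X_inv + fls_const (1 - kappa F N)"
        using \<open>fls_const 2 = 2\<close> by simp
      then show ?thesis using affine_neq1[of 2 "1 - kappa F N"] by simp
    qed
    show "U \<noteq> fls_const (kappa F N)"
      using affine_neq1[of 1 "1/2 - kappa F N"] by (auto simp: U_def fls_const.diff add_diff_eq)
    show "inverse (1 - fls_const c * W) \<noteq> 0" using nzW by (simp add: fps_to_fls_const)
  qed
  show ?thesis unfolding g a unfolding W
    by (rule r1.K_symmetric_linear[OF _ tr refl nz[unfolded W]]) (simp add: linear)
qed

text \<open>T is taken at u + 1/2 - \<kappa>/2 and the transposed factor at the opposite point.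
  Exchanging the two points turns S(u + 1/2) into S(\<kappa> - u - 1/2), which is the second series
  in the relation.\<close>

theorem symmetry_shat:
  assumes "of_type F N t" and ij: "i \<in> Idx N" "j \<in> Idx N" "i \<noteq> j"
  shows "\<exists>c c'. fps_to_fls (shat t i j) - sc1 c * fps_to_fls (shat t (- j) (- i))
      - sc1 c' * fps_to_fls (subst_affine (- 1) (kappa F N - 1/2) (s t (- j) (- i))) \<in> lift1 Y0"
proof -
  let ?b = "1/2 - kappa F N / 2" and ?b' = "kappa F N / 2 - 1/2"
  have bb: "kappa F N - 1/2 - kappa F N / 2 = ?b'" "kappa F N / 2 - (kappa F N - 1/2) = ?b" "- (- 1) = (1 :: complex)"
    by (simp_all add: field_simps)
  note im = s_image[OF ring_morphism_fps_to_fls ring_morphism_fls_const r1.R_ring_axioms fps_to_fls_scal fps_to_fls_const]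
  have im1: "fps_to_fls (shat t i j) = (\<Sum>k\<in>Idx N. fps_to_fls (subst_affine 1 ?b (gen_series i k)) * sc1 (fps_to_fls (g_series t k oo pt 1 (1/2)))
      * r1.tr (\<lambda>i j. fps_to_fls (subst_affine (- 1) ?b' (gen_series i j))) k j)" for i j
    unfolding shat_def by (rule im) simp
  have im2: "fps_to_fls (subst_affine (- 1) (kappa F N - 1/2) (s t i j)) = (\<Sum>k\<in>Idx N. fps_to_fls (subst_affine (- 1) ?b' (gen_series i k)) * sc1 (fps_to_fls (g_series t k oo pt (- 1) (kappa F N - 1/2)))
      * r1.tr (\<lambda>i j. fps_to_fls (subst_affine 1 ?b (gen_series i j))) k j)" for i j
    using im[of "- 1" "kappa F N - 1/2"] unfolding bb by simp
  have rtt: "r1.rtt (lift1 Y0) (fls_const 1 * fls_X_inv + fls_const ?b - (fls_const (- 1) * fls_X_inv + fls_const ?b'))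
     (\<lambda>i j. fps_to_fls (subst_affine 1 ?b (gen_series i j))) (\<lambda>i j. fps_to_fls (subst_affine (- 1) ?b' (gen_series i j)))"
    by (rule rtt_point_diag) simp_all
  show ?thesis
    unfolding im1 im2 by (rule r1.symmetry[OF left_ideal_lift1[OF left_Y0] rtt ij K_symm[OF assms(1)]])
qed

lemma g_series_0:
  assumes "of_type F N t"
  shows "g_series t i $ 0 = g_diag t i"
  using assms
proof (cases rule: type_cases)
  case (linear c)
  then show ?thesis using arg_cong[OF linear_ratio_mult[OF linear(4), of "g_diag t i"], of "\<lambda>f. f $ 0"] by simp
qed simp_all

text \<open>At infinity T becomes the identity, so S becomes G; an affine substitution keeps the
  constant term.\<close>

lemma shat_0:
  assumes "of_type F N t" and ij: "i \<in> Idx N" "j \<in> Idx N"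
  shows "shat t i j $ 0 - scal (if i = j then g_diag t i else 0) \<in> Y0"
proof -
  interpret Y: two_sided_ideal Y0 by (rule yang.two_sided_full_ideal)
  let ?d = "\<lambda>i j. scal (if i = j then 1 else 0) :: idx free"
  have T: "gen (i, j, 0) - ?d i j \<in> Y0" if "i \<in> Idx N" "j \<in> Idx N" for i j
    using that by (intro yang.Rel_full_ideal) (auto simp: RTT_rels_def Let_def)
  have st: "shat t i j $ 0 = (\<Sum>k\<in>Idx N. gen (i, k, 0) * scal (g_diag t k) * (scal (th F k * th F j) * gen (- j, - k, 0)))"
    unfolding shat_def subst_affine_0 s_series_def transp_def
    by (simp add: fps_sum_nth subst_affine_0 gen_series_def g_series_0[OF assms(1)] th_neg_neg)
  have "(\<Sum>k\<in>Idx N. gen (i, k, 0) * scal (g_diag t k) * (scal (th F k * th F j) * gen (- j, - k, 0))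
      - ?d i k * scal (g_diag t k) * (scal (th F k * th F j) * ?d (- j) (- k))) \<in> Y0"
  proof (rule Y.sum)
    fix k assume k: "k \<in> Idx N"
    \<comment> \<open>The difference of the two products is written so that each summand has a
      factor in the ideal.\<close>
    have "(gen (i, k, 0) - ?d i k) * (scal (g_diag t k) * (scal (th F k * th F j) * gen (- j, - k, 0)))
        + ?d i k * scal (g_diag t k) * (scal (th F k * th F j) * (gen (- j, - k, 0) - ?d (- j) (- k))) \<in> Y0"
      using ij k neg_Idx by (intro Y.add Y.mult_right Y.mult_left T) auto
    then show "gen (i, k, 0) * scal (g_diag t k) * (scal (th F k * th F j) * gen (- j, - k, 0))
      - ?d i k * scal (g_diag t k) * (scal (th F k * th F j) * ?d (- j) (- k)) \<in> Y0"
      by (simp add: left_diff_distrib right_diff_distrib mult.assoc)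
  qed
  moreover have "(\<Sum>k\<in>Idx N. ?d i k * scal (g_diag t k) * (scal (th F k * th F j) * ?d (- j) (- k)))
      = (\<Sum>k\<in>Idx N. if k = i then scal (if i = j then g_diag t i * (th F i * th F j) else 0) else 0)"
    by (intro sum.cong refl) (auto simp: scal.mult[symmetric])
  moreover have "th F i * th F i = 1"
    using ij parity by (cases F) (auto simp: Idx_def sgn_if)
  ultimately show ?thesis
    using ij finite_Idx unfolding st by (auto simp: sum_subtractf sum.delta split: if_splits)
qed

end

section \<open>Modules over the twisted Yangian\<close>

lemma subst_closed:
  fixes h :: "'g \<Rightarrow> 'h free"
  assumes add: "\<And>f g. f \<in> S \<Longrightarrow> g \<in> S \<Longrightarrow> f + g \<in> S" and mult: "\<And>f g. f \<in> S \<Longrightarrow> g \<in> S \<Longrightarrow> f * g \<in> S"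
    and scal: "\<And>c. scal c \<in> S" and h: "\<And>x. h x \<in> S"
  shows "subst h f \<in> S"
proof -
  have "prod_list (map h xs) \<in> S" for xs
    using scal[of 1] by (induction xs) (simp_all add: scal.one mult h)
  then have terms: "scal c * prod_list (map h xs) \<in> S" for c xs by (intro mult scal)
  have "sum k A \<in> S" if "\<And>a. k a \<in> S" for k :: "'g fword \<Rightarrow> 'h free" and A
    using scal[of 0] by (induction A rule: infinite_finite_induct) (simp_all add: add that)
  then show ?thesis unfolding subst_def using terms by simp
qed

context presentation
begin

lemma a_minus_eq:
  assumes "f \<in> fcar X" "g \<in> fcar X"
  shows "f \<ominus>\<^bsub>free_ring X\<^esub> g = f - g"
proof -
  have "- g \<in> fcar X" using assms(2) by (simp add: free_ring_simps)
  moreover have "\<ominus>\<^bsub>free_ring X\<^esub> g = - g"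
    using calculation assms(2) by (intro fr.minus_equality) (simp_all add: free_ring_simps(4,5))
  ultimately show ?thesis by (simp add: a_minus_def free_ring_simps(5))
qed

lemma cls_eqD:
  assumes "f \<in> fcar X" "g \<in> fcar X" "cls f = cls g"
  shows "f - g \<in> rel_ideal X Rel"
  using fr.quotient_eq_iff_same_a_r_cos[OF ideal_rel assms(1,2)] assms(3) a_minus_eq[OF assms(1,2)]
  by (simp add: presented_class_def)

lemma rel_ideal_minimal:
  assumes "two_sided_ideal K" "Rel \<subseteq> K"
  shows "rel_ideal X Rel \<subseteq> K"
proof -
  interpret K: two_sided_ideal K by fact
  have "subgroup (K \<inter> fcar X) (add_monoid (free_ring X))"
  proof (rule fr.add.subgroupI)
    show "K \<inter> fcar X \<noteq> {}" using K.zero fcar_closed(3) by blast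
    fix a assume a: "a \<in> K \<inter> fcar X"
    have "\<ominus>\<^bsub>free_ring X\<^esub> a = 0 - a"
      using a a_minus_eq[of 0 a] fcar_closed(3)[of X] fr.minus_eq[of 0 a] fr.l_zero[of "\<ominus>\<^bsub>free_ring X\<^esub> a"] fr.a_inv_closed[of a]
      by (simp add: free_ring_simps(4))
    moreover have "0 - a \<in> fcar X" using a fcar_closed(3) by (intro fcar_diff) auto
    moreover have "0 - a \<in> K" using a by (intro K.diff K.zero) auto
    ultimately show "\<ominus>\<^bsub>free_ring X\<^esub> a \<in> K \<inter> fcar X" by simp
  next
    fix a b assume "a \<in> K \<inter> fcar X" "b \<in> K \<inter> fcar X"
    then show "a \<oplus>\<^bsub>free_ring X\<^esub> b \<in> K \<inter> fcar X"
      unfolding free_ring_simps(5) by (blast intro: K.add fcar_closed(1))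
  qed blast
  then have "ideal (K \<inter> fcar X) (free_ring X)"
  proof (rule idealI[OF fr.ring_axioms])
    fix a x assume "a \<in> K \<inter> fcar X" "x \<in> fcar X"
    then show "x \<otimes>\<^bsub>free_ring X\<^esub> a \<in> K \<inter> fcar X" "a \<otimes>\<^bsub>free_ring X\<^esub> x \<in> K \<inter> fcar X"
      unfolding free_ring_simps(2) by (blast intro: K.mult_left K.mult_right fcar_closed(2))+
  qed
  then show ?thesis
    unfolding rel_ideal_def using fr.genideal_minimal[of "K \<inter> fcar X" Rel] Rel assms(2) by blast
qed

end

lemma fps_fcar:
  "(\<And>n. f $ n \<in> fcar X) \<Longrightarrow> (\<And>n. g $ n \<in> fcar X) \<Longrightarrow> (f * g) $ n \<in> fcar X"
  "(\<And>n. f $ n \<in> fcar X) \<Longrightarrow> subst_affine \<alpha> \<beta> f $ n \<in> fcar X"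
  "map_fps scal p $ n \<in> fcar X"
proof -
  show "(f * g) $ n \<in> fcar X" if "\<And>n. f $ n \<in> fcar X" "\<And>n. g $ n \<in> fcar X"
    unfolding fps_mult_nth using that by (intro fcar_sum fcar_closed)
  show "subst_affine \<alpha> \<beta> f $ n \<in> fcar X" if "\<And>n. f $ n \<in> fcar X"
    unfolding subst_affine_eval scal.eval_def fps_nth_Abs_fps using that by (intro fcar_sum fcar_closed)
  show "map_fps scal p $ n \<in> fcar X" unfolding map_fps_nth by (rule fcar_closed)
qed

lemma subst_affine_subst_affine:
  assumes "\<alpha> \<noteq> 0" "\<alpha>' \<noteq> 0"
  shows "subst_affine \<alpha>' \<beta>' (subst_affine \<alpha> \<beta> f) = subst_affine (\<alpha> * \<alpha>') (\<alpha> * \<beta>' + \<beta>) f"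
  using assms by (simp add: subst_affine_eval scal.eval_eval pt_0 pt_compose)

lemma subst_affine_id: "subst_affine 1 0 f = f"
proof -
  have "pt 1 0 = fps_X" using pt_mult[of 1 0] by simp
  then show ?thesis by (simp add: subst_affine_eval scal.eval_fps_X)
qed

locale twisted_module = yangian F N for F N +
  fixes t :: sym_type and scale :: "complex \<Rightarrow> 'v::ab_group_add \<Rightarrow> 'v" and \<rho> :: "idx free set \<Rightarrow> 'v \<Rightarrow> 'v"
  assumes type: "of_type F N t" and N_ge: "N \<ge> 4" and vs: "vector_space scale"
    and rep: "algebra_rep (tw_yangian F N t) scale UNIV \<rho>"
begin

sublocale vector_space scale by (rule vs)

abbreviation "A \<equiv> tw_yangian F N t"
abbreviation "VP \<equiv> V_plus F N t \<rho>"
abbreviation "n \<equiv> rank N"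

text \<open>Representatives in the free algebra of the elements that act: on a module over the
  twisted Yangian the generators of the extended Yangian itself have no action.\<close>

definition twc :: "idx free set" where
  "twc = {e \<in> fcar (gens N). yclass F N e \<in> carrier A}"

definition act :: "idx free \<Rightarrow> 'v \<Rightarrow> 'v" where
  "act e w = \<rho> (yclass F N e) w"

lemma yclass_cls: "yclass F N = yang.cls"
  by (rule ext) (simp add: yclass_def)

lemma A_ops: "a \<oplus>\<^bsub>A\<^esub> b = a \<oplus>\<^bsub>yang.alg\<^esub> b" "a \<otimes>\<^bsub>A\<^esub> b = a \<otimes>\<^bsub>yang.alg\<^esub> b"
    "\<one>\<^bsub>A\<^esub> = \<one>\<^bsub>yang.alg\<^esub>" "c \<odot>\<^bsub>A\<^esub> a = c \<odot>\<^bsub>yang.alg\<^esub> a"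
  by (simp_all add: tw_yangian_def generated_subalgebra_def ext_yangian_def)

lemma carrier_A: "carrier A = generate_ring yang.alg (range (\<lambda>c. c \<odot>\<^bsub>yang.alg\<^esub> \<one>\<^bsub>yang.alg\<^esub>)
    \<union> {yclass F N (s t i j $ r) | i j r. i \<in> Idx N \<and> j \<in> Idx N})"
  by (simp add: tw_yangian_def generated_subalgebra_def ext_yangian_def)

lemma s_fcar:
  assumes "i \<in> Idx N" "j \<in> Idx N"
  shows "s t i j $ r \<in> fcar (gens N)"
proof -
  have "gen_series i j $ r \<in> fcar (gens N)" if "i \<in> Idx N" "j \<in> Idx N" for i j r
    unfolding gen_series_def fps_nth_Abs_fps using that by (intro fcar_closed) (simp add: gens_def)
  then show ?thesis
    unfolding s_series_def fps_sum_nth transp_def using assms neg_Idx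
    by (intro fcar_sum fps_fcar) auto
qed

lemma twc_closed:
  "e \<in> twc \<Longrightarrow> e' \<in> twc \<Longrightarrow> e + e' \<in> twc" "e \<in> twc \<Longrightarrow> e' \<in> twc \<Longrightarrow> e * e' \<in> twc"
  "scal c \<in> twc" "i \<in> Idx N \<Longrightarrow> j \<in> Idx N \<Longrightarrow> s t i j $ r \<in> twc"
proof -
  note g = generate_ring.eng_add[of _ yang.alg] generate_ring.eng_mult[of _ yang.alg]
  show "e \<in> twc \<Longrightarrow> e' \<in> twc \<Longrightarrow> e + e' \<in> twc"
    unfolding twc_def carrier_A yclass_cls using g(1) fcar_closed(1)[of e "gens N" e'] yang.alg_simps(2)[of e e'] by force
  show "e \<in> twc \<Longrightarrow> e' \<in> twc \<Longrightarrow> e * e' \<in> twc"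
    unfolding twc_def carrier_A yclass_cls using g(2) fcar_closed(2)[of e "gens N" e'] yang.alg_simps(3)[of e e'] by force
  have "yang.cls (scal c) = c \<odot>\<^bsub>yang.alg\<^esub> \<one>\<^bsub>yang.alg\<^esub>"
    using yang.alg_simps(5)[OF fcar_closed(4), of c] by (simp add: yang.alg_simps(4))
  then show "scal c \<in> twc"
    unfolding twc_def carrier_A yclass_cls using fcar_closed(5) by (auto intro!: generate_ring.incl)
  show "s t i j $ r \<in> twc" if "i \<in> Idx N" "j \<in> Idx N"
    unfolding twc_def carrier_A using s_fcar[OF that] that by (auto intro!: generate_ring.incl)
qed

lemma twc_sum: "(\<And>a. a \<in> B \<Longrightarrow> f a \<in> twc) \<Longrightarrow> sum f B \<in> twc"
  using twc_closed(3)[of 0] by (induction B rule: infinite_finite_induct) (simp_all add: twc_closed)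

lemma act_simps:
  "e \<in> twc \<Longrightarrow> e' \<in> twc \<Longrightarrow> act (e + e') w = act e w + act e' w"
  "e \<in> twc \<Longrightarrow> e' \<in> twc \<Longrightarrow> act (e * e') w = act e (act e' w)"
  "act (scal c) w = scale c w"
  "e \<in> twc \<Longrightarrow> act e (w + w') = act e w + act e w'"
  "e \<in> twc \<Longrightarrow> act e (scale c w) = scale c (act e w)"
proof -
  have r: "\<And>x w w'. x \<in> carrier A \<Longrightarrow> \<rho> x (w + w') = \<rho> x w + \<rho> x w'"
    "\<And>x w c. x \<in> carrier A \<Longrightarrow> \<rho> x (scale c w) = scale c (\<rho> x w)"
    "\<And>x y w. x \<in> carrier A \<Longrightarrow> y \<in> carrier A \<Longrightarrow> \<rho> (x \<oplus>\<^bsub>A\<^esub> y) w = \<rho> x w + \<rho> y w"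
    "\<And>x y w. x \<in> carrier A \<Longrightarrow> y \<in> carrier A \<Longrightarrow> \<rho> (x \<otimes>\<^bsub>A\<^esub> y) w = \<rho> x (\<rho> y w)"
    "\<And>c x w. x \<in> carrier A \<Longrightarrow> \<rho> (c \<odot>\<^bsub>A\<^esub> x) w = scale c (\<rho> x w)"
    "\<And>w. \<rho> \<one>\<^bsub>A\<^esub> w = w"
    using rep unfolding algebra_rep_def by blast+
  have tw: "e \<in> twc \<Longrightarrow> yang.cls e \<in> carrier A" "e \<in> twc \<Longrightarrow> e \<in> fcar (gens N)" for e
    by (simp_all only: twc_def yclass_cls mem_Collect_eq)
  show "e \<in> twc \<Longrightarrow> e' \<in> twc \<Longrightarrow> act (e + e') w = act e w + act e' w"
    unfolding act_def yclass_cls by (simp add: r(3)[symmetric] tw A_ops yang.alg_simps(2))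
  show "e \<in> twc \<Longrightarrow> e' \<in> twc \<Longrightarrow> act (e * e') w = act e (act e' w)"
    unfolding act_def yclass_cls by (simp add: r(4)[symmetric] tw A_ops yang.alg_simps(3))
  have one: "1 \<in> twc" using twc_closed(3)[of 1] by (simp add: scal.one)
  have "yang.cls (scal c) = c \<odot>\<^bsub>A\<^esub> yang.cls 1"
    using yang.alg_simps(5)[OF fcar_closed(4), of c] by (simp add: A_ops)
  then show "act (scal c) w = scale c w"
    unfolding act_def yclass_cls
    by (simp add: r(5)[OF tw(1)[OF one]] r(6)[unfolded A_ops yang.alg_simps(4)])
  show "e \<in> twc \<Longrightarrow> act e (w + w') = act e w + act e w'" "e \<in> twc \<Longrightarrow> act e (scale c w) = scale c (act e w)"
    unfolding act_def yclass_cls by (simp_all add: r(1,2) tw)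
qed

lemma act_zero: "act 0 w = 0"
  using act_simps(3)[of 0 w] by simp

lemma act_Y0:
  assumes "e \<in> twc" "e \<in> Y0"
  shows "act e w = 0"
proof -
  have "yang.cls e = yang.cls 0"
    using assms fcar_closed(3) by (intro yang.cls_eq) (simp_all add: twc_def)
  then show ?thesis using act_zero[of w] by (simp add: act_def yclass_cls)
qed

text \<open>The coefficients of \<open>shat t\<close>, the matrix \<open>S\<close> at \<open>u + 1/2\<close>, act as the generators of a free algebra.\<close>

definition hs :: "idx \<Rightarrow> idx free" where
  "hs = (\<lambda>(i, j, r). if i \<in> Idx N \<and> j \<in> Idx N then shat t i j $ r else 0)"

definition ac :: "idx free \<Rightarrow> 'v \<Rightarrow> 'v" where
  "ac e w = act (subst hs e) w"

lemma subst_affine_twc: "(\<And>r. f $ r \<in> twc) \<Longrightarrow> subst_affine \<alpha> \<beta> f $ r \<in> twc"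
  unfolding subst_affine_eval scal.eval_def fps_nth_Abs_fps by (intro twc_sum twc_closed)

lemma shat_twc: "i \<in> Idx N \<Longrightarrow> j \<in> Idx N \<Longrightarrow> shat t i j $ r \<in> twc"
  unfolding shat_def by (intro subst_affine_twc twc_closed)

lemma subst_hs_twc: "subst hs e \<in> twc"
proof (rule subst_closed)
  show "hs x \<in> twc" for x
    using shat_twc twc_closed(3)[of 0] by (cases x) (simp add: hs_def)
qed (intro twc_closed; assumption)+

lemma ac_simps:
  "ac (e + e') w = ac e w + ac e' w" "ac (e * e') w = ac e (ac e' w)" "ac (scal c) w = scale c w"
  "ac e (w + w') = ac e w + ac e w'" "ac e (scale c w) = scale c (ac e w)"
  "ac 0 w = 0" "ac 1 w = w" "ac e 0 = 0"
proof -
  show "ac (e + e') w = ac e w + ac e' w" "ac (e * e') w = ac e (ac e' w)" "ac (scal c) w = scale c w"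
    "ac e (w + w') = ac e w + ac e w'" and s: "ac e (scale c w) = scale c (ac e w)" for c w
    unfolding ac_def by (simp_all add: subst.add subst.mult act_simps subst_hs_twc)
  show "ac 0 w = 0" by (simp add: ac_def act_zero)
  show "ac 1 w = w" using act_simps(3)[of 1 w] by (simp add: ac_def subst.one scal.one)
  show "ac e 0 = 0" using s[of 0 0] by simp
qed

lemma ac_gen: "i \<in> Idx N \<Longrightarrow> j \<in> Idx N \<Longrightarrow> ac (gen (i, j, r)) w = act (shat t i j $ r) w"
  by (simp add: ac_def hs_def)

lemma act_subst_affine:
  assumes "\<And>r. f $ r \<in> twc" "\<And>r. act (f $ r) w = 0"
  shows "act (subst_affine \<alpha> \<beta> f $ r) w = 0"
proof -
  have "act (sum k B) w = 0" if "\<And>a. k a \<in> twc" "\<And>a. act (k a) w = 0" for k and B :: "nat set"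
    by (induction B rule: infinite_finite_induct) (simp_all add: act_zero act_simps that twc_sum)
  then show ?thesis
    unfolding subst_affine_eval scal.eval_def fps_nth_Abs_fps
    by (simp add: twc_closed assms act_simps scale_zero_right)
qed

lemma s_shat: "s t i j = subst_affine 1 (- 1/2) (shat t i j)"
  unfolding shat_def by (simp add: subst_affine_subst_affine subst_affine_id)

lemma n_Idx: "n \<in> Idx N" "- n \<in> Idx N"
  using N_ge by (auto simp: Idx_def rank_def)

text \<open>The shift of u is invertible, so the coefficients of s_kn(u) and those of s_kn(u + 1/2)
  are combinations of each other. As n is the largest index, k < n means k \<noteq> n.\<close>

lemma V_plus_iff: "w \<in> VP \<longleftrightarrow> (\<forall>k\<in>Idx N. k \<noteq> n \<longrightarrow> (\<forall>r. ac (gen (k, n, r)) w = 0))"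
proof -
  have "(\<forall>r. act (shat t k n $ r) w = 0) \<longleftrightarrow> (\<forall>r. act (s t k n $ r) w = 0)" if "k \<in> Idx N" for k
    using act_subst_affine[of "s t k n" w 1 "1/2"] act_subst_affine[of "shat t k n" w 1 "- 1/2"]
      twc_closed(4)[OF that n_Idx(1)] shat_twc[OF that n_Idx(1)]
    unfolding s_shat[symmetric] unfolding shat_def[symmetric] by blast
  moreover have "k < n \<longleftrightarrow> k \<noteq> n" if "k \<in> Idx N" for k using that by (auto simp: Idx_def)
  ultimately show ?thesis
    unfolding V_plus_def mem_Collect_eq act_def[symmetric] using ac_gen n_Idx(1) by simp
qed

text \<open>The left ideal L, formed in the free algebra on the entries of S(u + 1/2), each element
  of which acts on V.\<close>

definition ann :: "idx free set" where
  "ann = {e. \<forall>w\<in>VP. ac e w = 0}"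

lemma left_ann: "left_ideal ann"
  by unfold_locales (simp_all add: ann_def ac_simps)

lemma gen_n_ann: "k \<in> Idx N \<Longrightarrow> k \<noteq> n \<Longrightarrow> gen (k, n, r) \<in> ann"
  using V_plus_iff by (simp add: ann_def)

text \<open>\<open>symmetry_shat\<close> at (-n, l) expresses this entry by the entry at (-l, n)
  taken at two points, and both kill w because -l \<noteq> n.\<close>

lemma gen_minus_n_ann:
  assumes "l \<in> Idx N" "l \<noteq> - n"
  shows "gen (- n, l, r) \<in> ann"
  unfolding ann_def
proof (intro CollectI ballI)
  fix w assume w: "w \<in> VP"
  have l: "- l \<in> Idx N" "- l \<noteq> n" using assms neg_Idx by auto
  \<comment> \<open>The elements that act and kill this one vector. The series involved have
    coefficients in the free algebra on the entries of T, so \<open>ann\<close> does not apply to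
    them.\<close>
  define K where "K = {e \<in> twc. act e w = 0}"
  have K_mult: "scal c * e \<in> K" if "e \<in> K" for c e
    using that by (simp add: K_def twc_closed act_simps)
  have K_sum: "sum k B \<in> K" if "\<And>a. a \<in> B \<Longrightarrow> k a \<in> K" for k and B :: "int set"
    using that twc_closed(3)[of 0]
    by (induction B rule: infinite_finite_induct) (simp_all add: K_def twc_closed act_zero act_simps)
  have K_sc: "(sc1 c * fps_to_fls f) $$ m \<in> K" if "\<And>r. f $ r \<in> K" for c f m
  proof -
    have "0 \<in> K" using twc_closed(3)[of 0] by (simp add: K_def act_zero)
    then have f: "fps_to_fls f $$ k \<in> K" for k using that by simp
    show ?thesis unfolding fls_times_nth(2) sc1_def map_fls_nth[of scal, OF scal.zero] by (intro K_sum K_mult f)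
  qed
  have K1: "shat t (- l) n $ r \<in> K" for r
  proof -
    have "ac (gen (- l, n, r)) w = 0" using V_plus_iff[THEN iffD1, OF w] l by blast
    then show ?thesis
      unfolding K_def ac_gen[OF l(1) n_Idx(1)] using shat_twc[OF l(1) n_Idx(1)] by simp
  qed
  have "s t (- l) n $ r \<in> K" for r
    unfolding K_def using K1 act_subst_affine[of "shat t (- l) n" w 1 "- 1/2"] twc_closed(4)[OF l(1) n_Idx(1)]
    unfolding s_shat[symmetric] by (simp add: K_def)
  then have K2: "subst_affine (- 1) (kappa F N - 1/2) (s t (- l) n) $ r \<in> K" for r
    unfolding K_def by (simp add: subst_affine_twc act_subst_affine)
  obtain c c' where c: "fps_to_fls (shat t (- n) l) - sc1 c * fps_to_fls (shat t (- l) n)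
      - sc1 c' * fps_to_fls (subst_affine (- 1) (kappa F N - 1/2) (s t (- l) n)) \<in> lift1 Y0"
    using symmetry_shat[OF type n_Idx(2) assms(1)] assms(2) by (auto simp: eq_commute[of "- n"])
  define x y z where "x = shat t (- n) l $ r" and "y = (sc1 c * fps_to_fls (shat t (- l) n)) $$ int r"
    and "z = (sc1 c' * fps_to_fls (subst_affine (- 1) (kappa F N - 1/2) (s t (- l) n))) $$ int r"
  have yz: "y \<in> K" "z \<in> K" unfolding y_def z_def using K_sc K1 K2 by blast+
  have x: "x \<in> twc" unfolding x_def by (rule shat_twc[OF n_Idx(2) assms(1)])
  have neg: "- e = scal (- 1) * e" for e :: "idx free" by (simp add: scal.uminus scal.one)
  have "- y \<in> K" "- z \<in> K" unfolding neg[of y] neg[of z] by (intro K_mult yz)+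
  then have yz': "- y \<in> twc" "- z \<in> twc" "act (- y) w = 0" "act (- z) w = 0" by (simp_all add: K_def)
  have "x - y - z \<in> Y0" using c by (auto simp: lift1_def x_def y_def z_def dest: spec[of _ "int r"])
  then have "x + (- y + - z) \<in> Y0" by (simp only: diff_conv_add_uminus add.assoc)
  then have "act (x + (- y + - z)) w = 0" by (intro act_Y0 twc_closed x yz')
  moreover have "act (x + (- y + - z)) w = act x w + (act (- y) w + act (- z) w)"
    by (simp only: act_simps(1) twc_closed(1) x yz'(1,2))
  ultimately have "act x w = 0" unfolding yz'(3,4) by simp
  then show "ac (gen (- n, l, r)) w = 0" by (simp add: ac_gen n_Idx assms x_def)
qed

end

section \<open>The reflection algebra of smaller rank\<close>

lemma at_mult_nth: "(at_u f * at_v g) $$ int p $$ int q = f $ p * g $ q"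
proof -
  interpret bi_fls: ring_morphism bi_fls by (rule bi_fls_morphism)
  have "at_u f * at_v g = bi_fls (bi_u f * fps_const g)"
    by (simp only: bi_fls.mult bi_fls_u bi_fls_v)
  then show ?thesis by (simp add: bi_fls_nth bi_u_def)
qed

lemma half_X_mult_nth:
  fixes f :: "'g free fps"
  shows "(map_fps scal (fps_const c * fps_X) * f) $ r = (if r = 0 then 0 else scal c * f $ (r - 1))"
proof -
  have "map_fps scal (fps_const c * fps_X) = (fps_const (scal c) * fps_X :: 'g free fps)"
    by (rule fps_ext) (simp add: fps_X_def)
  then show ?thesis by (simp add: mult.assoc)
qed

locale coefficient_morphism =
  fixes h :: "idx \<Rightarrow> idx free"
begin

definition H :: "idx free fls fls \<Rightarrow> idx free fls fls" where
  "H = map_fls (map_fls (subst h))"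

sublocale H: ring_morphism H
  unfolding H_def by (intro ring_morphism.map_fls subst_morphism)

lemma H_nth: "H x $$ k $$ l = subst h (x $$ k $$ l)"
proof -
  have "map_fls (subst h) 0 = 0" by (rule fls_eqI) simp
  then show ?thesis by (simp add: H_def)
qed

lemma H_sc2: "H (sc2 c) = sc2 c"
  by (intro fls_eqI) (simp add: H_nth sc2_nth)

lemma H_mult2: "H (mult2 N A B x y) = mult2 N (\<lambda>x y. H (A x y)) (\<lambda>x y. H (B x y)) x y"
  by (simp add: mult2_def H.sum H.mult)

lemma H_at:
  assumes "\<And>r. subst h (f $ r) = g $ r"
  shows "H (at_u f) = at_u g" "H (at_v f) = at_v g"
  by (intro fls_eqI; simp add: H_nth at_nth assms)+

lemma H_in_first:
  assumes "\<And>i j. i \<in> Idx N \<Longrightarrow> j \<in> Idx N \<Longrightarrow> H (f i j) = g i j" "x \<in> Idx N \<times> Idx N" "y \<in> Idx N \<times> Idx N"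
  shows "H (in_first f x y) = in_first g x y" "H (in_second f x y) = in_second g x y"
proof -
  obtain i k j l where xy: "x = (i, k)" "y = (j, l)" by (cases x, cases y)
  then show "H (in_first f x y) = in_first g x y" "H (in_second f x y) = in_second g x y"
    using assms(1)[of i j] assms(1)[of k l] assms(2,3) by (simp_all add: in_first_def in_second_def)
qed

end

context twisted_module
begin

lemma Idx_N: "Idx N = insert n (insert (- n) (Idx (N - 2)))" "n \<notin> Idx (N - 2)" "n > 0"
proof -
  define r where "r = rank (N - 2)"
  have r: "r \<ge> 0" "n = r + 1" and odd: "odd N \<longleftrightarrow> odd (N - 2)"
    using N_ge by (simp_all add: r_def rank_def le_div_geq)
  have "\<bar>i\<bar> \<le> r + 1 \<and> (i = 0 \<longrightarrow> P) \<longleftrightarrow> i = r + 1 \<or> i = - (r + 1) \<or> (\<bar>i\<bar> \<le> r \<and> (i = 0 \<longrightarrow> P))" for i P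
    using r(1) by (smt (verit))
  then show "Idx N = insert n (insert (- n) (Idx (N - 2)))"
    unfolding Idx_def r(2) odd r_def[symmetric] by blast
  show "n \<notin> Idx (N - 2)" "n > 0" using r by (simp_all add: Idx_def r_def[symmetric])
qed

lemma kappa_N: "const2 (kappa F (N - 2)) + 1 = const2 (kappa F N)"
proof -
  have "kappa F N = kappa F (N - 2) + 1"
    using N_ge by (cases F) (simp_all add: of_nat_diff field_simps)
  then show ?thesis by (simp add: const2.add const2.one)
qed

lemma parity': "F = Sympl \<Longrightarrow> even (N - 2)"
  using parity by simp

sublocale r': R_ring sc2 "N - 2" "\<lambda>i. const2 (th F i)" "const2 (ep F)" "const2 (kappa F (N - 2))"
  by (intro R_ring.intro sc2.central_morphism_axioms osp_index_Idx const2_morphism parity')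

sublocale hs: coefficient_morphism hs .

text \<open>\<open>hs\<close> sends each coefficient of the difference into the ideal of the
  extended Yangian, whose elements act as zero. So the relation holds modulo \<open>ann\<close> in a
  free algebra, where functionals can be applied.\<close>

lemma reflection_gens: "r2.meq (lift2 ann)
    (mult2 N (r2.R (var_u - var_v)) (mult2 N (in_first (\<lambda>i j. at_u (gen_series i j)))
      (mult2 N (r2.R (var_u + var_v + 1)) (in_second (\<lambda>i j. at_v (gen_series i j))))))
    (mult2 N (in_second (\<lambda>i j. at_v (gen_series i j))) (mult2 N (r2.R (var_u + var_v + 1))
      (mult2 N (in_first (\<lambda>i j. at_u (gen_series i j))) (r2.R (var_u - var_v)))))"
    (is "r2.meq _ ?L ?M")
  unfolding r2.meq_def
proof (intro ballI)
  fix x y assume xy: "x \<in> Idx N \<times> Idx N" "y \<in> Idx N \<times> Idx N"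
  have R: "hs.H (r2.R z x y) = r2.R z x y" for z x y
    by (cases x; cases y) (simp add: r2.R_def hs.H_sc2)
  have "subst hs (gen_series i j $ r) = shat t i j $ r" if "i \<in> Idx N" "j \<in> Idx N" for i j r
    using that by (simp add: gen_series_def hs_def)
  note at = hs.H_at[OF this]
  have L: "hs.H (?L x y) = mult2 N (r2.R (var_u - var_v)) (mult2 N (in_first (\<lambda>i j. at_u (shat t i j)))
      (mult2 N (r2.R (var_u + var_v + 1)) (in_second (\<lambda>i j. at_v (shat t i j))))) x y"
    unfolding hs.H_mult2 by (intro mult2_cong R hs.H_in_first at xy)
  have M: "hs.H (?M x y) = mult2 N (in_second (\<lambda>i j. at_v (shat t i j))) (mult2 N (r2.R (var_u + var_v + 1))
      (mult2 N (in_first (\<lambda>i j. at_u (shat t i j))) (r2.R (var_u - var_v)))) x y"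
    unfolding hs.H_mult2 by (intro mult2_cong R hs.H_in_first at xy)
  have "hs.H (?L x y - ?M x y) \<in> lift2 Y0"
    using reflection_shat[OF type] xy unfolding hs.H.diff L M r2.meq_def by blast
  then have "subst hs ((?L x y - ?M x y) $$ k $$ l) \<in> Y0" for k l
    unfolding hs.H_nth[symmetric] lift2_def by blast
  then show "?L x y - ?M x y \<in> lift2 ann"
    unfolding lift2_def ann_def ac_def using act_Y0[OF subst_hs_twc] by blast
qed

abbreviation "functional2 \<equiv> functional sc2 N (\<lambda>i. const2 (th F i)) (const2 (ep F)) (const2 (kappa F N))"

lemma ann_by_functionals:
  assumes "\<And>f. functional2 f \<Longrightarrow> (\<And>x. x \<in> lift2 ann \<Longrightarrow> f x = 0) \<Longrightarrow> f y = 0"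
  shows "y \<in> lift2 ann"
proof (rule ccontr)
  assume "y \<notin> lift2 ann"
  then obtain f where f1: "\<And>y z. f (y + z) = f y + f z" "\<And>c y. f (sc2 c * y) = c * f y"
    and f2: "\<And>y. y \<in> lift2 ann \<Longrightarrow> f y = 0" "f y \<noteq> 0"
    using subspace_separation[OF sc2.central_morphism_axioms left_ideal_lift2[OF left_ann]] by metis
  have "functional2 f" by unfold_locales (fact f1)+
  then show False using assms f2 by blast
qed

lemma at_ann: "(\<And>r. g $ r \<in> ann) \<Longrightarrow> x * at_u g \<in> lift2 ann" "(\<And>r. g $ r \<in> ann) \<Longrightarrow> x * at_v g \<in> lift2 ann"
proof -
  note l = left_ideal.mult_left[OF left_ideal_lift2[OF left_ann]]
  show "(\<And>r. g $ r \<in> ann) \<Longrightarrow> x * at_u g \<in> lift2 ann" "(\<And>r. g $ r \<in> ann) \<Longrightarrow> x * at_v g \<in> lift2 ann"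
    using left_ideal.zero[OF left_ann] by (intro l; simp add: lift2_def at_nth)+
qed

lemma uv_neq: "var_u - var_v \<noteq> const2 r" "var_u + var_v \<noteq> const2 r"
  using affine_neq[of 1 "- 1" "- r"] affine_neq[of 1 1 "- r"]
  by (auto simp: const2.one const2.uminus add_eq_0_iff algebra_simps)

text \<open>Vanishing on the lift of \<open>ann\<close> gives the conditions on column n and row -n,
  also after multiplication from the left. The excluded values of a and b are constants, except for
  a = b and a = -b, which would mean 2 v = 0 and 2 u = 0.\<close>

lemma reflection_data_functional:
  assumes f: "functional2 f" and f0: "\<And>x. x \<in> lift2 ann \<Longrightarrow> f x = 0"
  shows "reflection_data (Idx (N - 2)) (\<lambda>i. const2 (th F i)) (const2 (ep F)) (const2 (kappa F (N - 2))) n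
    (var_u - var_v) (var_u + var_v) (\<lambda>i j k l. f (at_u (gen_series i j) * at_v (gen_series k l)))
    (\<lambda>i j k l. f (at_v (gen_series i j) * at_u (gen_series k l)))"
proof -
  interpret f: functional sc2 N "\<lambda>i. const2 (th F i)" "const2 (ep F)" "const2 (kappa F N)" f by fact
  interpret ext: osp_extension "Idx (N - 2)" "\<lambda>i. const2 (th F i)" "const2 (ep F)" "const2 (kappa F (N - 2))" n
  proof (intro osp_extension.intro r'.osp_index_axioms osp_extension_axioms.intro Idx_N)
    show "const2 (th F n) = 1" "const2 (th F (- n)) = const2 (ep F)"
      using Idx_N(3) by (cases F; simp add: const2.one)+
  qed
  have J: "ext.J = Idx N" by (simp add: ext.J_def Idx_N(1))
  let ?a = "var_u - var_v" and ?b = "var_u + var_v" and ?k = "const2 (kappa F (N - 2))"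
  have "?a \<noteq> 0" "?a \<noteq> 1" "?a \<noteq> - 1" "?a \<noteq> ?k" "?a \<noteq> - ?k" "?a \<noteq> ?k + 1" "?a \<noteq> - (?k + 1)"
    "?b \<noteq> 0" "?b \<noteq> - 1" "?b \<noteq> ?k" "?b \<noteq> ?k - 1"
    using uv_neq(1)[of 0] uv_neq(1)[of 1] uv_neq(1)[of "- 1"] uv_neq(1)[of "kappa F (N - 2)"]
      uv_neq(1)[of "- kappa F (N - 2)"] uv_neq(1)[of "kappa F (N - 2) + 1"] uv_neq(1)[of "- (kappa F (N - 2) + 1)"]
      uv_neq(2)[of 0] uv_neq(2)[of "- 1"] uv_neq(2)[of "kappa F (N - 2)"] uv_neq(2)[of "kappa F (N - 2) - 1"]
    by (simp_all only: const2.add const2.diff const2.uminus const2.one const2.zero not_False_eq_True)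
  moreover from this have "?a\<^sup>2 \<noteq> 1" by (simp add: power2_eq_1_iff)
  moreover have two: "(2 :: complex fls fls) \<noteq> 0"
    using affine_neq[of 0 0 2] const2.add[of 1 1] by (simp add: const2.one)
  have "?a \<noteq> ?b" "?a \<noteq> - ?b"
  proof -
    show "?a \<noteq> ?b"
    proof
      assume "?a = ?b"
      then have "2 * var_v = 0" by (simp add: mult_2 algebra_simps)
      then show False using two var_u_neq_0 by simp
    qed
    show "?a \<noteq> - ?b"
    proof
      assume "?a = - ?b"
      then have "2 * var_u = 0" by (simp add: mult_2 algebra_simps)
      then show False using two var_u_neq_0 by simp
    qed
  qed
  moreover have "r2.R_act ?a (\<lambda>i k. r2.middle (?b + 1) (\<lambda>i j k l. f (at_u (gen_series i j) * at_v (gen_series k l))) i k j l) i k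
      = r2.R_act ?a (\<lambda>j l. r2.middle (?b + 1) (\<lambda>i j k l. f (at_v (gen_series i j) * at_u (gen_series k l))) k i l j) j l"
    if "i \<in> Idx N" "k \<in> Idx N" "j \<in> Idx N" "l \<in> Idx N" for i k j l
    using r2.meq_functional[OF reflection_gens f f0, of "(i, k)" "(j, l)"] that
    unfolding f.f_reflection[OF that] by simp
  moreover have "f (x * at_v (gen_series k n)) = 0" "f (x * at_u (gen_series k n)) = 0" if "k \<in> Idx N" "k \<noteq> n" for k x
    using that gen_n_ann by (auto intro!: f0 at_ann simp: gen_series_def)
  moreover have "f (x * at_v (gen_series (- n) l)) = 0" "f (x * at_u (gen_series (- n) l)) = 0" if "l \<in> Idx N" "l \<noteq> - n" for l x
    using that gen_minus_n_ann by (auto intro!: f0 at_ann simp: gen_series_def)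
  ultimately show ?thesis
    by (intro reflection_data.intro ext.osp_extension_axioms reflection_data_axioms.intro, unfold J kappa_N) blast+
qed

text \<open>The case k = l = n is \<open>A_in_nn\<close>; for inner k and l the case of inner i is
  \<open>A_in_inner\<close> and the case i = -n is \<open>A_minus_n_inner\<close>. By
  \<open>V_plus_iff\<close> these products vanishing on V_+ is the stability of V_+.\<close>

lemma product_ann:
  assumes "i \<in> Idx N" "i \<noteq> n" and kl: "k \<in> Idx (N - 2) \<and> l \<in> Idx (N - 2) \<or> k = n \<and> l = n"
  shows "gen (i, n, p) * gen (k, l, q) \<in> ann"
proof -
  have "at_u (gen_series i n) * at_v (gen_series k l) \<in> lift2 ann"
  proof (rule ann_by_functionals)
    fix f assume "functional2 f" "\<And>x. x \<in> lift2 ann \<Longrightarrow> f x = 0"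
    then interpret d: reflection_data "Idx (N - 2)" "\<lambda>i. const2 (th F i)" "const2 (ep F)" "const2 (kappa F (N - 2))" n
      "var_u - var_v" "var_u + var_v" "\<lambda>i j k l. f (at_u (gen_series i j) * at_v (gen_series k l))"
      "\<lambda>i j k l. f (at_v (gen_series i j) * at_u (gen_series k l))"
      by (rule reflection_data_functional)
    have "d.J = Idx N" by (simp add: d.J_def Idx_N(1))
    then show "f (at_u (gen_series i n) * at_v (gen_series k l)) = 0"
      using d.A_in_nn[of i] d.A_in_inner[of i k l] d.A_minus_n_inner[of k l] assms Idx_N(1) by auto
  qed
  then have "(at_u (gen_series i n) * at_v (gen_series k l)) $$ int p $$ int q \<in> ann" by (simp add: lift2_def)
  then show ?thesis unfolding at_mult_nth by (simp add: gen_series_def)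
qed

lemma gen_V_plus:
  assumes "w \<in> VP" "k \<in> Idx (N - 2) \<and> l \<in> Idx (N - 2) \<or> k = n \<and> l = n"
  shows "ac (gen (k, l, q)) w \<in> VP"
  unfolding V_plus_iff ac_simps(2)[symmetric] using product_ann assms by (auto simp: ann_def)

section \<open>The corrected entries and their relations on V_+\<close>

lemma subspace_V_plus: "subspace VP"
  unfolding subspace_def by (auto simp: V_plus_iff ac_simps scale_zero_right)

text \<open>The coefficient of u^-r in s_nn/(2 u) is half of the coefficient of degree r - 1 in
  s_nn, and there is none for r = 0.\<close>

definition circ :: "idx \<Rightarrow> idx free" where
  "circ = (\<lambda>(i, j, r). if i \<in> Idx (N - 2) \<and> j \<in> Idx (N - 2)
     then gen (i, j, r) + (if i = j \<and> r > 0 then scal (1/2) * gen (n, n, r - 1) else 0) else 0)"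

definition ac' :: "idx free \<Rightarrow> 'v \<Rightarrow> 'v" where
  "ac' e w = ac (subst circ e) w"

lemma ac'_simps:
  "ac' (e + e') w = ac' e w + ac' e' w" "ac' (e * e') w = ac' e (ac' e' w)" "ac' (scal c) w = scale c w"
  "ac' e (w + w') = ac' e w + ac' e w'" "ac' e (scale c w) = scale c (ac' e w)"
  "ac' 0 w = 0" "ac' 1 w = w" "ac' e 0 = 0"
  by (simp_all add: ac'_def subst.add subst.mult subst.one ac_simps)

lemma ac'_V_plus:
  assumes "w \<in> VP"
  shows "ac' e w \<in> VP"
proof -
  note sub = subspace_V_plus[unfolded subspace_def]
  have "subst circ e \<in> {e. \<forall>w\<in>VP. ac e w \<in> VP}"
  proof (rule subst_closed)
    fix x :: idx
    obtain i j r where x: "x = (i, j, r)" by (cases x)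
    show "circ x \<in> {e. \<forall>w\<in>VP. ac e w \<in> VP}"
      using sub gen_V_plus by (auto simp: x circ_def ac_simps)
  qed (use sub in \<open>auto simp: ac_simps\<close>)
  then show ?thesis using assms by (simp add: ac'_def)
qed

lemma ac'_gen:
  assumes "i \<in> Idx (N - 2)" "j \<in> Idx (N - 2)"
  shows "ac' (gen (i, j, r)) w = \<rho> (yclass F N (s_circ F N t i j $ r)) w"
proof -
  have "i \<in> Idx N" "j \<in> Idx N" using assms Idx_N(1) by auto
  then have "subst hs (circ (i, j, r)) = s_circ F N t i j $ r"
    using assms n_Idx unfolding s_circ_def shat_def[symmetric]
    by (auto simp: circ_def hs_def subst.add subst.mult half_X_mult_nth)
  then show ?thesis by (simp add: ac'_def ac_def act_def)
qed

definition ann' :: "idx free set" where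
  "ann' = {e. \<forall>w\<in>VP. ac' e w = 0}"

text \<open>Closure under multiplication from the right is where stability of V_+ enters. Being
  two-sided, this annihilator contains the ideal of relations as soon as it contains the
  relations.\<close>

lemma two_sided_ann': "two_sided_ideal ann'"
  by unfold_locales (simp_all add: ann'_def ac'_simps ac'_V_plus)

sublocale circ: coefficient_morphism circ .

definition gc :: "int \<Rightarrow> int \<Rightarrow> idx free fps" where
  "gc i j = gen_series i j + (if i = j then map_fps scal (fps_const (1/2) * fps_X) * gen_series n n else 0)"

lemma gc_nth:
  assumes "i \<in> Idx (N - 2)" "j \<in> Idx (N - 2)"
  shows "subst circ (gen_series i j $ r) = gc i j $ r"
  using assms by (simp add: gc_def gen_series_def circ_def half_X_mult_nth)

lemma at_gc:
  "at_u (gc i j) = at_u (gen_series i j) + sc2 (of_bool (i = j) / (2 * var_u)) * at_u (gen_series n n)"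
  "at_v (gc i j) = at_v (gen_series i j) + sc2 (of_bool (i = j) / (2 * var_v)) * at_v (gen_series n n)"
proof -
  interpret u: ring_morphism "at_u :: idx free fps \<Rightarrow> _" by (rule at_u_morphism)
  interpret v: ring_morphism "at_v :: idx free fps \<Rightarrow> _" by (rule at_v_morphism)
  have half: "const2 (1/2) = 1 / 2"
  proof -
    have "2 * const2 (1/2) = 1" using half2 by (simp only: mult_2)
    then show ?thesis
      by (metis mult_zero_left nonzero_mult_div_cancel_left zero_neq_one)
  qed
  show "at_u (gc i j) = at_u (gen_series i j) + sc2 (of_bool (i = j) / (2 * var_u)) * at_u (gen_series n n)"
    by (simp add: gc_def u.add u.mult at_u_scal cu.mult cu_simps half)
  show "at_v (gc i j) = at_v (gen_series i j) + sc2 (of_bool (i = j) / (2 * var_v)) * at_v (gen_series n n)"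
    by (simp add: gc_def v.add v.mult at_v_scal cv.mult cv_simps half)
qed

lemma reflection_gc: "r'.meq (lift2 ann)
    (mult2 (N - 2) (r'.R (var_u - var_v)) (mult2 (N - 2) (in_first (\<lambda>i j. at_u (gc i j)))
      (mult2 (N - 2) (r'.R (var_u + var_v)) (in_second (\<lambda>i j. at_v (gc i j))))))
    (mult2 (N - 2) (in_second (\<lambda>i j. at_v (gc i j))) (mult2 (N - 2) (r'.R (var_u + var_v))
      (mult2 (N - 2) (in_first (\<lambda>i j. at_u (gc i j))) (r'.R (var_u - var_v)))))"
    (is "r'.meq _ ?L ?M")
proof (rule r'.meq_by_functionals[OF left_ideal_lift2[OF left_ann]])
  fix f x y
  assume "functional sc2 (N - 2) (\<lambda>i. const2 (th F i)) (const2 (ep F)) (const2 (kappa F (N - 2))) f"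
    and f0: "\<And>w. w \<in> lift2 ann \<Longrightarrow> f w = 0" and xy: "x \<in> Idx (N - 2) \<times> Idx (N - 2)" "y \<in> Idx (N - 2) \<times> Idx (N - 2)"
  then interpret g: functional sc2 "N - 2" "\<lambda>i. const2 (th F i)" "const2 (ep F)" "const2 (kappa F (N - 2))" f by simp
  \<comment> \<open>A functional for rank N - 2 is also one for rank N, since nothing but linearity
    over the field is asked of it.\<close>
  have "functional2 f" by unfold_locales (fact g.f_add g.f_sc)+
  then interpret d: reflection_data "Idx (N - 2)" "\<lambda>i. const2 (th F i)" "const2 (ep F)" "const2 (kappa F (N - 2))" n
    "var_u - var_v" "var_u + var_v" "\<lambda>i j k l. f (at_u (gen_series i j) * at_v (gen_series k l))"
    "\<lambda>i j k l. f (at_v (gen_series i j) * at_u (gen_series k l))"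
    by (rule reflection_data_functional[OF _ f0])
  \<comment> \<open>The denominators b + a and b - a of \<open>reflection_reduced\<close> are those
    of the correction at u and at v.\<close>
  have e: "var_u + var_v + (var_u - var_v) = 2 * var_u" "var_u + var_v - (var_u - var_v) = 2 * var_v" by simp_all
  have expand: "f ((x + sc2 p * y) * (x' + sc2 q * y')) = f (x * x') + q * f (x * y') + p * f (y * x') + p * q * f (y * y')"
    for x y x' y' p q
  proof -
    have "(x + sc2 p * y) * (x' + sc2 q * y') = x * x' + sc2 q * (x * y') + sc2 p * (y * x') + sc2 (p * q) * (y * y')"
      by (simp add: distrib_left distrib_right sc2.mult_mult sc2.left_commute[of x] mult.assoc[of "sc2 p" y x'] add.assoc)
    then show ?thesis by (simp only: g.f_add g.f_sc)
  qed
  obtain i k j l where ijkl: "x = (i, k)" "y = (j, l)" and I: "i \<in> Idx (N - 2)" "k \<in> Idx (N - 2)" "j \<in> Idx (N - 2)" "l \<in> Idx (N - 2)"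
    using xy by auto
  show "f (?L x y) = f (?M x y)"
    unfolding ijkl g.f_reflection[OF I]
  proof (rule d.reflection_reduced[OF _ _ I], unfold e)
    fix i j k l
    show "f (at_u (gc i j) * at_v (gc k l)) = f (at_u (gen_series i j) * at_v (gen_series k l))
        + of_bool (k = l) * f (at_u (gen_series i j) * at_v (gen_series n n)) / (2 * var_v)
        + of_bool (i = j) * f (at_u (gen_series n n) * at_v (gen_series k l)) / (2 * var_u)
        + of_bool (i = j) * of_bool (k = l) * f (at_u (gen_series n n) * at_v (gen_series n n)) / (2 * var_u * (2 * var_v))"
      unfolding at_gc expand by simp
    show "f (at_v (gc k l) * at_u (gc i j)) = f (at_v (gen_series k l) * at_u (gen_series i j))
        + of_bool (k = l) * f (at_v (gen_series n n) * at_u (gen_series i j)) / (2 * var_v)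
        + of_bool (i = j) * f (at_v (gen_series k l) * at_u (gen_series n n)) / (2 * var_u)
        + of_bool (i = j) * of_bool (k = l) * f (at_v (gen_series n n) * at_u (gen_series n n)) / (2 * var_u * (2 * var_v))"
      unfolding at_gc expand by simp
  qed
qed

text \<open>The constant terms are right by \<open>shat_0\<close>, and \<open>circ\<close> carries
  the matrix relation to \<open>reflection_gc\<close>.\<close>

lemma reflection_rels_ann': "reflection_rels F (N - 2) (g_diag t) \<subseteq> ann'"
proof -
  let ?N = "N - 2"
  have lead: "gen (i, j, 0) - scal (if i = j then g_diag t i else 0) \<in> ann'" if ij: "i \<in> Idx ?N" "j \<in> Idx ?N" for i j
  proof -
    have ij': "i \<in> Idx N" "j \<in> Idx N" using ij Idx_N(1) by auto
    have "subst hs (subst circ (gen (i, j, 0) - scal (if i = j then g_diag t i else 0)))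
        = shat t i j $ 0 - scal (if i = j then g_diag t i else 0)"
      using ij ij' by (simp add: subst.diff circ_def hs_def)
    then have "subst hs (subst circ (gen (i, j, 0) - scal (if i = j then g_diag t i else 0))) \<in> Y0"
      using shat_0[OF type ij'] by (simp only:)
    then show ?thesis
      unfolding ann'_def ac'_def ac_def using act_Y0[OF subst_hs_twc] by blast
  qed
  let ?S1 = "in_first (\<lambda>i j. at_u (gen_series i j))" and ?S2 = "in_second (\<lambda>i j. at_v (gen_series i j))"
  let ?R = "\<lambda>z. R_free F ?N z :: idx free fls fls mat2"
  let ?L = "mult2 ?N (mult2 ?N (mult2 ?N (?R (var_u - var_v)) ?S1) (?R (var_u + var_v))) ?S2"
  let ?M = "mult2 ?N (mult2 ?N (mult2 ?N ?S2 (?R (var_u + var_v))) ?S1) (?R (var_u - var_v))"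
  have coeffs: "(?L x y - ?M x y) $$ k $$ l \<in> ann'" if xy: "x \<in> Idx ?N \<times> Idx ?N" "y \<in> Idx ?N \<times> Idx ?N" for x y k l
  proof -
    have R: "circ.H (?R z x y) = r'.R z x y" if "x \<in> Idx ?N \<times> Idx ?N" "y \<in> Idx ?N \<times> Idx ?N" for z x y
      unfolding R_free_eq[OF r'.R_ring_axioms that] by (cases x; cases y) (simp add: r'.R_def circ.H_sc2)
    note at = circ.H_at[OF gc_nth]
    have L: "circ.H (?L x y) = mult2 ?N (r'.R (var_u - var_v)) (mult2 ?N (in_first (\<lambda>i j. at_u (gc i j)))
        (mult2 ?N (r'.R (var_u + var_v)) (in_second (\<lambda>i j. at_v (gc i j))))) x y"
      unfolding mult2_assoc circ.H_mult2 by (intro mult2_cong R circ.H_in_first at xy)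
    have M: "circ.H (?M x y) = mult2 ?N (in_second (\<lambda>i j. at_v (gc i j))) (mult2 ?N (r'.R (var_u + var_v))
        (mult2 ?N (in_first (\<lambda>i j. at_u (gc i j))) (r'.R (var_u - var_v)))) x y"
      unfolding mult2_assoc circ.H_mult2 by (intro mult2_cong R circ.H_in_first at xy)
    have "circ.H (?L x y - ?M x y) \<in> lift2 ann"
      using reflection_gc xy unfolding circ.H.diff L M r'.meq_def by blast
    then have "subst circ ((?L x y - ?M x y) $$ k $$ l) \<in> ann"
      unfolding circ.H_nth[symmetric] lift2_def by blast
    then show ?thesis by (simp add: ann_def ann'_def ac'_def)
  qed
  show ?thesis
    unfolding reflection_rels_def Let_def eq_coeffs_def using lead coeffs by blast
qed

sublocale refl: presentation "gens (N - 2)" "reflection_rels F (N - 2) (g_diag t)"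
  by unfold_locales (rule reflection_rels_fcar)

text \<open>A class acts through a chosen representative; by \<open>sigma_cls\<close> the choice
  makes no difference on V_+.\<close>

definition \<sigma> :: "idx free set \<Rightarrow> 'v \<Rightarrow> 'v" where
  "\<sigma> x w = ac' (SOME e. e \<in> fcar (gens (N - 2)) \<and> refl.cls e = x) w"

lemma sigma_cls:
  assumes e: "e \<in> fcar (gens (N - 2))" and w: "w \<in> VP"
  shows "\<sigma> (refl.cls e) w = ac' e w"
proof -
  define e' where "e' = (SOME e'. e' \<in> fcar (gens (N - 2)) \<and> refl.cls e' = refl.cls e)"
  have e': "e' \<in> fcar (gens (N - 2)) \<and> refl.cls e' = refl.cls e"
    unfolding e'_def by (rule someI[of _ e]) (simp add: e)
  then have "e' - e \<in> rel_ideal (gens (N - 2)) (reflection_rels F (N - 2) (g_diag t))"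
    using e by (intro refl.cls_eqD) auto
  then have "e' - e \<in> ann'"
    using refl.rel_ideal_minimal[OF two_sided_ann' reflection_rels_ann'] by blast
  then have "ac' (e' - e) w = 0" using w by (simp add: ann'_def)
  moreover have "ac' e' w = ac' (e' - e) w + ac' e w" by (simp add: ac'_simps(1)[symmetric])
  ultimately show ?thesis by (simp add: \<sigma>_def e'_def)
qed

lemma rep_sigma: "algebra_rep (reflection_algebra F (N - 2) (g_diag t)) scale VP \<sigma>"
proof -
  have alg: "reflection_algebra F (N - 2) (g_diag t) = refl.alg" by (simp add: reflection_algebra_def)
  note cl = fcar_closed[where X = "gens (N - 2)"]
  have "\<exists>e\<in>fcar (gens (N - 2)). x = refl.cls e" if "x \<in> carrier refl.alg" for x
    using that unfolding refl.alg_simps(1) by blast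
  note ex = this
  have V: "ac' e w \<in> VP" "w + w' \<in> VP" "scale c w \<in> VP" if "w \<in> VP" "w' \<in> VP" for e w w' c
    using that ac'_V_plus subspace_V_plus unfolding subspace_def by blast+
  show ?thesis
    unfolding algebra_rep_def alg
  proof (intro conjI ballI allI)
    show "Modules.module.subspace scale VP" by (rule subspace_V_plus)
  next
    fix x w assume "x \<in> carrier refl.alg" "w \<in> VP"
    then show "\<sigma> x w \<in> VP" using ex[of x] by (auto simp: sigma_cls V)
  next
    fix x w w' assume "x \<in> carrier refl.alg" "w \<in> VP" "w' \<in> VP"
    then show "\<sigma> x (w + w') = \<sigma> x w + \<sigma> x w'" using ex[of x] by (auto simp: sigma_cls V ac'_simps)
  next
    fix x c w assume "x \<in> carrier refl.alg" "w \<in> VP"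
    then show "\<sigma> x (scale c w) = scale c (\<sigma> x w)" using ex[of x] by (auto simp: sigma_cls V ac'_simps)
  next
    fix x y w assume "x \<in> carrier refl.alg" "y \<in> carrier refl.alg" "w \<in> VP"
    then show "\<sigma> (x \<oplus>\<^bsub>refl.alg\<^esub> y) w = \<sigma> x w + \<sigma> y w"
      using ex[of x] ex[of y] cl(1) by (auto simp: refl.alg_simps sigma_cls V ac'_simps)
  next
    fix x y w assume "x \<in> carrier refl.alg" "y \<in> carrier refl.alg" "w \<in> VP"
    then show "\<sigma> (x \<otimes>\<^bsub>refl.alg\<^esub> y) w = \<sigma> x (\<sigma> y w)"
      using ex[of x] ex[of y] cl(2) by (auto simp: refl.alg_simps sigma_cls V ac'_simps)
  next
    fix c x w assume "x \<in> carrier refl.alg" "w \<in> VP"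
    then show "\<sigma> (c \<odot>\<^bsub>refl.alg\<^esub> x) w = scale c (\<sigma> x w)"
      using ex[of x] cl(2,5) by (auto simp: refl.alg_simps sigma_cls V ac'_simps)
  next
    fix w assume "w \<in> VP"
    then show "\<sigma> \<one>\<^bsub>refl.alg\<^esub> w = w" using cl(4) by (simp add: refl.alg_simps(4) sigma_cls ac'_simps)
  qed
qed

end

theorem lemma4p12:
  fixes F :: lie_type and N :: nat and t :: sym_type
    and scale :: "complex \<Rightarrow> 'v::ab_group_add \<Rightarrow> 'v"
    and \<rho> :: "idx free set \<Rightarrow> 'v \<Rightarrow> 'v"
  assumes "of_type F N t"
    and "F = Orth \<Longrightarrow> N - 2 \<ge> 3"
    and "F = Sympl \<Longrightarrow> N - 2 \<ge> 2"
    and "vector_space scale"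
    and "algebra_rep (tw_yangian F N t) scale UNIV \<rho>"
  shows "(\<forall>i\<in>Idx (N - 2). \<forall>j\<in>Idx (N - 2). \<forall>r. \<forall>w\<in>V_plus F N t \<rho>.
            \<rho> (yclass F N (s_circ F N t i j $ r)) w \<in> V_plus F N t \<rho>) \<and>
         (\<exists>\<sigma>. algebra_rep (reflection_algebra F (N - 2) (g_diag t)) scale (V_plus F N t \<rho>) \<sigma> \<and>
            (\<forall>i\<in>Idx (N - 2). \<forall>j\<in>Idx (N - 2). \<forall>r. \<forall>w\<in>V_plus F N t \<rho>.
               \<sigma> (rclass F (N - 2) (g_diag t) (gen (i, j, r))) w
                 = \<rho> (yclass F N (s_circ F N t i j $ r)) w))"
proof -
  \<comment> \<open>Subtraction of naturals truncates, so this bound is also what makes N - 2 a true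
    difference.\<close>
  have "N \<ge> 4" using assms(2,3) by (cases F) auto
  moreover have "F = Sympl \<Longrightarrow> even N" using assms(1) by (cases t) auto
  ultimately interpret twisted_module F N t scale \<rho>
    using assms(1,4,5) by (intro twisted_module.intro yangian.intro twisted_module_axioms.intro)
  have gen: "gen (i, j, r) \<in> fcar (gens (N - 2))" if "i \<in> Idx (N - 2)" "j \<in> Idx (N - 2)" for i j r
    using that by (intro fcar_closed) (simp add: gens_def)
  show ?thesis
    using ac'_V_plus rep_sigma sigma_cls[OF gen]
    by (intro conjI exI[of _ \<sigma>]) (simp_all add: ac'_gen[symmetric] rclass_def)
qed

end
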